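(* Let $d\geq 1$, let $J:\mathbb Z^d\times \mathbb Z^d \to [0,\infty)$ be a symmetric, integrable, translation-invariant kernel, and suppose that there exist constants $0<\alpha<d$ and $c>0$ such that $J(x,y) \geq c\|x-y\|_\infty^{-d-\alpha}$ for all distinct $x,y \in \mathbb Z^d$. Then there exists a constant $A=A(d,\alpha)<\infty$ (depending only on $d$ and $\alpha$) such that \[ \frac{1}{|\Lambda_r|}\sum_{x\in \Lambda_r} \mathbf P_{\beta_c}(0\leftrightarrow x) \leq \frac{A}{c\beta_c} r^{-d+\alpha} \] for every $r\geq 1$.
   Context: A kernel $J$ is symmetric if $J(x,y)=J(y,x)$, translation-invariant if $J(x,y)=J(0,y-x)$, and integrable if $\sum_{y\in\mathbb Z^d}J(x,y)<\infty$ for every $x$. For $\beta\geq 0$, long-range percolation on $\mathbb Z^d$ with kernel $J$ and parameter $\beta$ is the random graph with vertex set $\mathbb Z^d$ in which each unordered pair $\{x,y\}$ of distinct points is an edge independently with probability $1-\exp(-\beta J(x,y))$; $\mathbf P_\beta$ denotes its law. Clusters are connected components, $\{x\leftrightarrow y\}$ is the event that $x,y$ are in the same cluster, and $\beta_c=\inf\{\beta\geq 0:\mathbf P_\beta(\text{an infinite cluster exists})>0\}$ (under the hypotheses, $0<\beta_c<\infty$). $\Lambda_r=[-r,r]^d\cap\mathbb Z^d$. *)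

theory Defs
  imports "HOL-Analysis.Analysis" "HOL-Probability.Probability"
begin

definition pairs :: "'a set set" where
  "pairs = {e. card e = 2}"

text \<open>Kernel value on an unordered pair (well defined for symmetric kernels).\<close>
definition pair_weight :: "('a \<Rightarrow> 'a \<Rightarrow> real) \<Rightarrow> 'a set \<Rightarrow> real" where
  "pair_weight J e = (let x = (SOME x. x \<in> e) in J x (SOME y. y \<in> e \<and> y \<noteq> x))"

text \<open>Law of long-range percolation: independent edges, edge {x,y} open with
  probability 1 - exp(- beta J(x,y)). A configuration is a function on unordered pairs.\<close>
definition lrp :: "('a \<Rightarrow> 'a \<Rightarrow> real) \<Rightarrow> real \<Rightarrow> ('a set \<Rightarrow> bool) measure" where
  "lrp J \<beta> = (\<Pi>\<^sub>M e\<in>pairs. measure_pmf (bernoulli_pmf (1 - exp (- \<beta> * pair_weight J e))))"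

definition adj :: "('a set \<Rightarrow> bool) \<Rightarrow> ('a \<times> 'a) set" where
  "adj \<omega> = {(u, v). u \<noteq> v \<and> \<omega> {u, v}}"

definition connected_in :: "('a set \<Rightarrow> bool) \<Rightarrow> 'a \<Rightarrow> 'a \<Rightarrow> bool" where
  "connected_in \<omega> x y \<longleftrightarrow> (x, y) \<in> (adj \<omega>)\<^sup>*"

definition conn_prob :: "('a \<Rightarrow> 'a \<Rightarrow> real) \<Rightarrow> real \<Rightarrow> 'a \<Rightarrow> 'a \<Rightarrow> real" where
  "conn_prob J \<beta> x y = measure (lrp J \<beta>) {\<omega> \<in> space (lrp J \<beta>). connected_in \<omega> x y}"

definition has_infinite_cluster :: "('a set \<Rightarrow> bool) \<Rightarrow> bool" where
  "has_infinite_cluster \<omega> \<longleftrightarrow> (\<exists>x. infinite {y. connected_in \<omega> x y})"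

definition beta_c :: "('a \<Rightarrow> 'a \<Rightarrow> real) \<Rightarrow> real" where
  "beta_c J = Inf {\<beta>. \<beta> \<ge> 0 \<and>
      measure (lrp J \<beta>) {\<omega> \<in> space (lrp J \<beta>). has_infinite_cluster \<omega>} > 0}"

definition linf :: "int ^ 'd::finite \<Rightarrow> real" where
  "linf x = real_of_int (Max (range (\<lambda>i. \<bar>x $ i\<bar>)))"

definition box :: "real \<Rightarrow> (int ^ 'd::finite) set" where
  "box r = {x. \<forall>i. real_of_int \<bar>x $ i\<bar> \<le> r}"

definition kernel_ok :: "(int ^ 'd::finite \<Rightarrow> int ^ 'd \<Rightarrow> real) \<Rightarrow> bool" where
  "kernel_ok J \<longleftrightarrow> (\<forall>x y. J x y \<ge> 0) \<and> (\<forall>x y. J x y = J y x)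
     \<and> (\<forall>x y. J x y = J 0 (y - x)) \<and> (\<forall>x. J x summable_on UNIV)"

end

theory Submission
  imports Defs
begin

text \<open>
  For \<open>\<beta>\<close> without percolation, compare the kernel \<open>W = \<beta> J\<close> with \<open>W - h\<close>, where
  \<open>h {x, y} = lam * (max \<bar>x\<bar> \<bar>y\<bar> + g) powr (- d - \<alpha>)\<close> is a part of the interaction near the origin
  that is held back. The part \<open>h\<close> can be given back scale by scale as independent sprinkling.

  If at some scale the expected size of the largest cluster in a cube of side \<open>2 ^ k\<close> exceeded
  a constant times \<open>2 powr (k * (d + \<alpha>) / 2)\<close>, then sprinkling at the next scales would merge the
  largest clusters of neighbouring cubes with summable relative losses, so that a positive density
  would survive at all scales and percolation would occur. Given this bound (and its fourth moment
  version, by the van den Berg--Kesten inequality), the second moment \<open>F\<close> of the cluster sizes in a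
  cube satisfies \<open>F' \<ge> F\<^sup>2 / 4\<close> under sprinkling, unless it is small from the start; since \<open>F\<close> cannot
  explode, the susceptibility of \<open>W - h\<close> in a cube is at most of order \<open>2 powr (k * \<alpha>)\<close>. Finally,
  a connection in \<open>W\<close> either exists in \<open>W - h\<close> or uses a first edge of \<open>h\<close>. With \<open>a\<close> the supremum
  over \<open>k\<close> of the susceptibility at scale \<open>k\<close> divided by \<open>2 powr (k * \<alpha>)\<close>, this gives
  \<open>a \<le> C + a / 2\<close>; here \<open>a\<close> is finite because \<open>\<beta>\<close> may be compared with a slightly larger
  non-percolating parameter. The bound passes to \<open>beta_c\<close> by left-continuity, and it also shows that
  percolation occurs for large \<open>\<beta>\<close>, so that the set in the definition of \<open>beta_c\<close> is nonempty.
\<close>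

text \<open>Sprinkling costs weight, and sacrificing a fixed fraction of \<open>W\<close> gives a
  bound inversely proportional to that fraction, which is useless at criticality. The hole
  \<open>h\<close> is therefore centred at the origin: at scale n it still offers each pair a rate
  of order n^(-d-\<alpha>), but it fades with the distance of the pair from the origin, so that it
  can be restored perturbatively. A translation by b only changes \<open>g\<close> to at most g +
  |b|, so all subcubes of a cube can be compared with one reference kernel. The natural cluster size
  is rate^(-1/2), that is n^((d+\<alpha>)/2): two clusters of this size are joined with probability
  of order one. It is small against the volume n^d because \<alpha> < d, and the growing ratio
  n^((d-\<alpha>)/2) makes the merging losses summable. For connections into a box of side K,
  restoring the hole at scale n costs n^\<alpha> (reduced susceptibility) times n^(-d-\<alpha>)
  (hole) times K^d n^\<alpha> (full susceptibility), hence K^\<alpha> (K/n)^(d-\<alpha>). Holding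
  back only scales far above K makes the sum over n small. The factor \<open>lam\<close> of the hole
  cancels against the 1/\<open>lam\<close> of the reduced bound, so this smallness depends only on d
  and \<alpha>.\<close>

section \<open>Finite product measures on edge sets\<close>

definition pexp :: "'e set \<Rightarrow> ('e \<Rightarrow> real) \<Rightarrow> ('e set \<Rightarrow> real) \<Rightarrow> real" where
  "pexp E w f = (\<Sum>G\<in>Pow E. (\<Prod>e\<in>E. if e \<in> G then 1 - exp (- w e) else exp (- w e)) * f G)"

lemma pexp_empty [simp]: "pexp {} w f = f {}"
  by (simp add: pexp_def)

lemma pexp_insert:
  assumes "finite E" "e \<notin> E"
  shows "pexp (insert e E) w f
    = exp (- w e) * pexp E w f + (1 - exp (- w e)) * pexp E w (\<lambda>G. f (insert e G))"
proof -
  let ?p = "\<lambda>G e. if e \<in> G then 1 - exp (- w e) else exp (- w e)"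
  have disj: "Pow E \<inter> insert e ` Pow E = {}" using assms by auto
  have inj: "inj_on (insert e) (Pow E)" using assms by (auto simp: inj_on_def)
  have "pexp (insert e E) w f = (\<Sum>G\<in>Pow E. prod (?p G) (insert e E) * f G)
      + (\<Sum>G\<in>insert e ` Pow E. prod (?p G) (insert e E) * f G)"
    unfolding pexp_def Pow_insert by (rule sum.union_disjoint) (use assms disj in auto)
  also have "(\<Sum>G\<in>Pow E. prod (?p G) (insert e E) * f G) = exp (- w e) * pexp E w f"
    unfolding pexp_def sum_distrib_left
    by (rule sum.cong) (use assms in \<open>auto simp: prod.insert\<close>)
  also have "(\<Sum>G\<in>insert e ` Pow E. prod (?p G) (insert e E) * f G)
      = (1 - exp (- w e)) * pexp E w (\<lambda>G. f (insert e G))"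
    unfolding pexp_def sum_distrib_left sum.reindex[OF inj] o_def
  proof (rule sum.cong)
    fix G assume "G \<in> Pow E"
    have "prod (?p (insert e G)) E = prod (?p G) E"
      by (rule prod.cong) (use assms in auto)
    then show "prod (?p (insert e G)) (insert e E) * f (insert e G)
      = (1 - exp (- w e)) * (prod (?p G) E * f (insert e G))"
      using assms by (simp add: prod.insert)
  qed simp
  finally show ?thesis .
qed

lemma pexp_cong: "(\<And>G. G \<subseteq> E \<Longrightarrow> f G = g G) \<Longrightarrow> pexp E w f = pexp E w g"
  unfolding pexp_def by (rule sum.cong) auto

lemma pexp_mono:
  assumes "\<And>e. 0 \<le> w e" "\<And>G. G \<subseteq> E \<Longrightarrow> f G \<le> g G"
  shows "pexp E w f \<le> pexp E w g"
  unfolding pexp_def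
  by (intro sum_mono mult_left_mono prod_nonneg) (use assms in auto)

lemma pexp_add: "pexp E w (\<lambda>G. f G + g G) = pexp E w f + pexp E w g"
  unfolding pexp_def by (simp add: distrib_left sum.distrib)

lemma pexp_diff: "pexp E w (\<lambda>G. f G - g G) = pexp E w f - pexp E w g"
  unfolding pexp_def by (simp add: right_diff_distrib sum_subtractf)

lemma pexp_cmult: "pexp E w (\<lambda>G. c * f G) = c * pexp E w f"
  unfolding pexp_def sum_distrib_left by (rule sum.cong) auto

lemma pexp_multc: "pexp E w (\<lambda>G. f G * c) = pexp E w f * c"
  using pexp_cmult[of E w c f] by (simp add: mult.commute)

lemma pexp_sum: "pexp E w (\<lambda>G. \<Sum>i\<in>I. f i G) = (\<Sum>i\<in>I. pexp E w (f i))"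
  unfolding pexp_def sum_distrib_left by (rule sum.swap)

lemma pexp_const: "finite E \<Longrightarrow> pexp E w (\<lambda>_. c) = c"
  by (induction E rule: finite_induct) (auto simp: pexp_insert algebra_simps)

lemma pexp_nonneg:
  assumes "\<And>e. 0 \<le> w e" "\<And>G. G \<subseteq> E \<Longrightarrow> 0 \<le> f G"
  shows "0 \<le> pexp E w f"
  using pexp_mono[of w E "\<lambda>_. 0" f] assms by (simp add: pexp_def)

text \<open>A configuration of weight \<open>w + v\<close> is the union of independent ones, since
  \<open>exp (- w - v)\<close> is the product of the probabilities of being closed.\<close>
lemma pexp_union:
  assumes "finite E"
  shows "pexp E (\<lambda>e. w e + v e) f = pexp E w (\<lambda>G. pexp E v (\<lambda>\<eta>. f (G \<union> \<eta>)))"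
  using assms
proof (induction E arbitrary: f rule: finite_induct)
  case (insert e E)
  let ?I = "insert e E"
  let ?g = "\<lambda>G. pexp E v (\<lambda>\<eta>. f (G \<union> \<eta>))" and ?h = "\<lambda>G. pexp E v (\<lambda>\<eta>. f (insert e (G \<union> \<eta>)))"
  have ex: "exp (- (w e + v e)) = exp (- w e) * exp (- v e)"
    by (simp add: mult_exp_exp)
  have 1: "pexp ?I v (\<lambda>\<eta>. f (G \<union> \<eta>)) = exp (- v e) * ?g G + (1 - exp (- v e)) * ?h G" for G
    using insert.hyps by (simp add: pexp_insert)
  have "pexp ?I w (\<lambda>G. pexp ?I v (\<lambda>\<eta>. f (G \<union> \<eta>)))
      = exp (- w e) * (exp (- v e) * pexp E w ?g + (1 - exp (- v e)) * pexp E w ?h) + (1 - exp (- w e)) * pexp E w ?h"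
    unfolding 1 pexp_add pexp_cmult using insert.hyps by (simp add: pexp_insert insert_absorb2 algebra_simps)
  also have "\<dots> = exp (- (w e + v e)) * pexp E w ?g + (1 - exp (- (w e + v e))) * pexp E w ?h"
    unfolding ex by (simp add: algebra_simps)
  finally show ?case
    using insert.hyps by (simp add: pexp_insert insert.IH)
qed simp

lemma pexp_mono_set:
  assumes "finite E'" "E \<subseteq> E'" "\<And>e. 0 \<le> w e" "mono f"
  shows "pexp E w f \<le> pexp E' w f"
proof -
  have "pexp E w f \<le> pexp (E \<union> F) w f" if "finite F" "F \<subseteq> E' - E" for F
    using that
  proof (induction F rule: finite_induct)
    case (insert x F)
    have fE: "finite (E \<union> F)" using insert assms by (auto intro: finite_subset)
    have "pexp (E \<union> F) w f \<le> pexp (E \<union> F) w (\<lambda>G. f (insert x G))"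
      by (rule pexp_mono) (use assms in \<open>auto intro: monoD\<close>)
    then have "(1 - exp (- w x)) * pexp (E \<union> F) w f \<le> (1 - exp (- w x)) * pexp (E \<union> F) w (\<lambda>G. f (insert x G))"
      using assms(3)[of x] by (intro mult_left_mono) auto
    then have "pexp (E \<union> F) w f \<le> pexp (E \<union> insert x F) w f"
      using insert fE by (simp add: pexp_insert algebra_simps)
    then show ?case using insert by auto
  qed simp
  from this[of "E' - E"] assms show ?thesis
    by (simp add: Un_Diff_cancel finite_subset sup.absorb2)
qed

lemma pexp_mono_weight:
  assumes "finite E" "\<And>e. 0 \<le> w e" "\<And>e. w e \<le> v e" "mono f"
  shows "pexp E w f \<le> pexp E v f"
proof -
  have "pexp E v f = pexp E (\<lambda>e. w e + (v e - w e)) f" by simp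
  also have "\<dots> = pexp E w (\<lambda>G. pexp E (\<lambda>e. v e - w e) (\<lambda>\<eta>. f (G \<union> \<eta>)))"
    by (rule pexp_union) fact
  also have "\<dots> \<ge> pexp E w (\<lambda>G. pexp E (\<lambda>e. v e - w e) (\<lambda>\<eta>. f G))"
    by (intro pexp_mono) (use assms in \<open>auto intro: monoD\<close>)
  finally show ?thesis using assms by (simp add: pexp_const)
qed

lemma pexp_indep:
  assumes "finite E"
  shows "pexp E w (\<lambda>G. f (G \<inter> T) * g (G - T)) = pexp E w (\<lambda>G. f (G \<inter> T)) * pexp E w (\<lambda>G. g (G - T))"
  using assms
proof (induction E arbitrary: f g rule: finite_induct)
  case (insert e E)
  show ?case
  proof (cases "e \<in> T")
    case True
    then show ?thesis
      using insert.hyps insert.IH[of f g] insert.IH[of "\<lambda>G. f (insert e G)" g]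
      by (simp add: pexp_insert insert_Diff_if Int_insert_left algebra_simps)
  next
    case False
    then show ?thesis
      using insert.hyps insert.IH[of f g] insert.IH[of f "\<lambda>G. g (insert e G)"]
      by (simp add: pexp_insert insert_Diff_if Int_insert_left algebra_simps)
  qed
qed simp

lemma pexp_disjnt:
  assumes "finite E"
  shows "pexp E w (\<lambda>G. of_bool (G \<inter> C = {})) = exp (- (\<Sum>e\<in>E \<inter> C. w e))"
  using assms
proof (induction E rule: finite_induct)
  case (insert e E)
  have z: "pexp E w (\<lambda>G. 0) = 0" by (simp add: pexp_def)
  show ?case
    using insert by (cases "e \<in> C") (auto simp: pexp_insert Int_insert_left z algebra_simps exp_add exp_diff exp_minus field_simps)
qed simp

lemma pexp_bij:
  assumes "finite E" "inj_on T E"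
  shows "pexp (T ` E) w f = pexp E (\<lambda>e. w (T e)) (\<lambda>G. f (T ` G))"
  using assms
proof (induction E arbitrary: f rule: finite_induct)
  case (insert e E)
  then show ?case by (simp add: pexp_insert)
qed simp

lemma pexp_square_ge: "finite E \<Longrightarrow> (\<And>e. 0 \<le> w e) \<Longrightarrow> (pexp E w f)\<^sup>2 \<le> pexp E w (\<lambda>G. (f G)\<^sup>2)"
proof -
  assume a: "finite E" "\<And>e. 0 \<le> w e"
  let ?m = "pexp E w f"
  have "0 \<le> pexp E w (\<lambda>G. (f G - ?m)\<^sup>2)" using a by (intro pexp_nonneg) auto
  also have "\<dots> = pexp E w (\<lambda>G. ((f G)\<^sup>2 + ?m\<^sup>2) - 2 * ?m * f G)" by (simp add: power2_diff algebra_simps)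
  also have "\<dots> = pexp E w (\<lambda>G. (f G)\<^sup>2) + ?m\<^sup>2 - 2 * ?m * ?m"
    unfolding pexp_diff pexp_add pexp_cmult using a by (simp add: pexp_const)
  finally show ?thesis by (simp add: power2_eq_square)
qed

text \<open>The van den Berg--Kesten inequality, for an up-closed relation instead of a pair of
  increasing events: this form is stable under conditioning on one edge.\<close>
lemma pexp_BK:
  assumes "finite E" "\<And>e. 0 \<le> w e"
    and "\<And>I J I' J'. Q I J \<Longrightarrow> I \<subseteq> I' \<Longrightarrow> J \<subseteq> J' \<Longrightarrow> Q I' J'"
  shows "pexp E w (\<lambda>G. of_bool (\<exists>I J. I \<inter> J = {} \<and> I \<union> J \<subseteq> G \<and> Q I J))
      \<le> pexp E w (\<lambda>G. pexp E w (\<lambda>\<eta>. of_bool (Q G \<eta>)))"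
  using assms(1,3)
proof (induction E arbitrary: Q rule: finite_induct)
  case empty
  then show ?case by auto
next
  case (insert e E)
  let ?R = "\<lambda>Q G. \<exists>I J. I \<inter> J = {} \<and> I \<union> J \<subseteq> G \<and> Q I J"
  \<comment> \<open>Disjoint witnesses inside \<open>insert e G\<close> cannot both use
    \<open>e\<close>. With \<open>e\<close> removed they are disjoint witnesses inside
    \<open>G\<close> for the relation that grants \<open>e\<close> to one of the two sides, which is
    again up-closed.\<close>
  let ?Q' = "\<lambda>I J. Q (insert e I) J \<or> Q I (insert e J)"
  let ?p = "1 - exp (- w e)"
  have p: "0 \<le> ?p" "?p \<le> 1" using assms(2)[of e] by auto
  have R: "?R Q (insert e G) \<Longrightarrow> ?R ?Q' G" for G
  proof -
    assume "?R Q (insert e G)"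
    then obtain I J where IJ: "I \<inter> J = {}" "I \<union> J \<subseteq> insert e G" "Q I J" by blast
    show ?thesis
    proof (cases "e \<in> I")
      case True
      then have "Q (insert e (I - {e})) J" "J - {e} = J" using IJ by (auto simp: insert_absorb)
      then show ?thesis using IJ by (intro exI[of _ "I - {e}"] exI[of _ J]) auto
    next
      case False
      have "Q I (insert e (J - {e}))" using IJ(3) insert.prems[of I J I "insert e (J - {e})"] by blast
      then show ?thesis using IJ False by (intro exI[of _ I] exI[of _ "J - {e}"]) auto
    qed
  qed
  have "pexp E w (\<lambda>G. of_bool (?R Q (insert e G))) \<le> pexp E w (\<lambda>G. of_bool (?R ?Q' G))"
    by (intro pexp_mono) (use assms(2) R in auto)
  also have "\<dots> \<le> pexp E w (\<lambda>G. pexp E w (\<lambda>\<eta>. of_bool (?Q' G \<eta>)))"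
  proof (rule insert.IH)
    fix I J I' J' assume "?Q' I J" "I \<subseteq> I'" "J \<subseteq> J'"
    then show "?Q' I' J'" using insert.prems[of "insert e I" J "insert e I'" J']
      insert.prems[of I "insert e J" I' "insert e J'"] by blast
  qed
  finally have 1: "pexp E w (\<lambda>G. of_bool (?R Q (insert e G))) \<le> pexp E w (\<lambda>G. pexp E w (\<lambda>\<eta>. of_bool (?Q' G \<eta>)))" .
  have 2: "pexp E w (\<lambda>G. of_bool (?R Q G)) \<le> pexp E w (\<lambda>G. pexp E w (\<lambda>\<eta>. of_bool (Q G \<eta>)))"
    by (rule insert.IH) (use insert.prems in blast)
  have "pexp (insert e E) w (\<lambda>G. of_bool (?R Q G))
     = (1 - ?p) * pexp E w (\<lambda>G. of_bool (?R Q G)) + ?p * pexp E w (\<lambda>G. of_bool (?R Q (insert e G)))"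
    using insert.hyps by (simp add: pexp_insert)
  also have "\<dots> \<le> (1 - ?p) * pexp E w (\<lambda>G. pexp E w (\<lambda>\<eta>. of_bool (Q G \<eta>)))
      + ?p * pexp E w (\<lambda>G. pexp E w (\<lambda>\<eta>. of_bool (?Q' G \<eta>)))"
    by (intro add_mono mult_left_mono 1 2) (use p in auto)
  also have "\<dots> = pexp E w (\<lambda>G. pexp E w (\<lambda>\<eta>. (1 - ?p) * of_bool (Q G \<eta>) + ?p * of_bool (?Q' G \<eta>)))"
    by (simp add: pexp_add pexp_cmult)
  also have "\<dots> \<le> pexp E w (\<lambda>G. pexp E w (\<lambda>\<eta>. (1 - ?p) * ((1 - ?p) * of_bool (Q G \<eta>) + ?p * of_bool (Q G (insert e \<eta>)))
       + ?p * ((1 - ?p) * of_bool (Q (insert e G) \<eta>) + ?p * of_bool (Q (insert e G) (insert e \<eta>)))))"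
  proof (intro pexp_mono assms(2))
    fix G \<eta>
    have m: "Q G \<eta> \<Longrightarrow> Q G (insert e \<eta>)" "Q G \<eta> \<Longrightarrow> Q (insert e G) \<eta>"
      "Q G (insert e \<eta>) \<Longrightarrow> Q (insert e G) (insert e \<eta>)" "Q (insert e G) \<eta> \<Longrightarrow> Q (insert e G) (insert e \<eta>)"
      using insert.prems by blast+
    \<comment> \<open>The critical case is that \<open>e\<close> on either side suffices but is
      needed on one: then \<open>?p\<close> is compared with
      \<open>2 * ?p * (1 - ?p) + ?p * ?p\<close>, which is at least \<open>?p\<close> since the
      square of \<open>?p\<close> is at most \<open>?p\<close>.\<close>
    have pp: "?p * ?p \<le> ?p" using mult_left_le[OF p(2,1)] by simp
    show "(1 - ?p) * of_bool (Q G \<eta>) + ?p * of_bool (?Q' G \<eta>) \<le> (1 - ?p) * ((1 - ?p) * of_bool (Q G \<eta>) + ?p * of_bool (Q G (insert e \<eta>)))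
       + ?p * ((1 - ?p) * of_bool (Q (insert e G) \<eta>) + ?p * of_bool (Q (insert e G) (insert e \<eta>)))"
      using m p pp zero_le_square[of ?p] by (cases "Q G \<eta>"; cases "Q G (insert e \<eta>)"; cases "Q (insert e G) \<eta>";
         cases "Q (insert e G) (insert e \<eta>)") (auto simp: algebra_simps)
  qed
  also have "\<dots> = pexp (insert e E) w (\<lambda>G. pexp (insert e E) w (\<lambda>\<eta>. of_bool (Q G \<eta>)))"
    unfolding pexp_insert[OF insert.hyps] pexp_add pexp_cmult by (simp add: algebra_simps)
  finally show ?case .
qed

section \<open>Connectivity and cluster sizes for an edge set\<close>

definition conn :: "'a set set \<Rightarrow> 'a \<Rightarrow> 'a \<Rightarrow> bool" where
  "conn G x y \<longleftrightarrow> connected_in (\<lambda>e. e \<in> G) x y"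

lemma conn_refl [simp]: "conn G x x"
  by (simp add: conn_def connected_in_def)

lemma conn_trans [trans]: "conn G x y \<Longrightarrow> conn G y z \<Longrightarrow> conn G x z"
  by (auto simp: conn_def connected_in_def)

lemma conn_sym: "conn G x y \<Longrightarrow> conn G y x"
proof -
  have "sym (adj (\<lambda>e. e \<in> G))" by (auto simp: adj_def sym_def insert_commute)
  then show "conn G x y \<Longrightarrow> conn G y x"
    unfolding conn_def connected_in_def by (metis sym_rtrancl symD)
qed

lemma conn_commute: "conn G x y \<longleftrightarrow> conn G y x"
  by (auto dest: conn_sym)

lemma conn_mono: "G \<subseteq> \<eta> \<Longrightarrow> conn G x y \<Longrightarrow> conn \<eta> x y"
  unfolding conn_def connected_in_def
  by (erule rtrancl_mono[THEN subsetD, rotated]) (auto simp: adj_def)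

lemma conn_edge: "{x, y} \<in> G \<Longrightarrow> conn G x y"
  by (cases "x = y") (auto simp: conn_def connected_in_def adj_def)

lemma conn_induct [consumes 1, case_names refl step]:
  assumes "conn G x y" "P x"
    and "\<And>y z. conn G x y \<Longrightarrow> P y \<Longrightarrow> y \<noteq> z \<Longrightarrow> {y, z} \<in> G \<Longrightarrow> P z"
  shows "P y"
  using assms(1)[unfolded conn_def connected_in_def]
proof (induction rule: rtrancl_induct)
  case (step y z)
  then show ?case using assms(3)[of y z] by (auto simp: conn_def connected_in_def adj_def)
qed fact

lemma conn_insertD:
  assumes "conn (insert {u, v} G) x y"
  shows "conn G x y \<or> (conn G x u \<and> conn G v y) \<or> (conn G x v \<and> conn G u y)"
  using assms
proof (induction rule: conn_induct)
  case (step y z)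
  show ?case
  proof (cases "{y, z} \<in> G")
    case True
    then show ?thesis using step.IH conn_trans[of G _ y z] conn_edge[of y z G] by blast
  next
    case False
    then have "{y, z} = {u, v}" using step by auto
    then have "(y = u \<and> z = v) \<or> (y = v \<and> z = u)" by (auto simp: doubleton_eq_iff)
    then show ?thesis using step.IH by (auto intro: conn_trans)
  qed
qed simp

text \<open>\<open>L\<close> only selects the points that are counted: connecting paths may use all
  of \<open>G\<close>, also outside \<open>L\<close>.\<close>

definition cl :: "'a set set \<Rightarrow> 'a set \<Rightarrow> 'a \<Rightarrow> nat" where
  "cl G L x = card {y\<in>L. conn G x y}"

definition mx :: "'a set set \<Rightarrow> 'a set \<Rightarrow> nat" where
  "mx G L = Max (cl G L ` L)"

lemma cl_mono: "finite L \<Longrightarrow> G \<subseteq> \<eta> \<Longrightarrow> cl G L x \<le> cl \<eta> L x"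
  unfolding cl_def by (rule card_mono) (auto intro: conn_mono)

lemma cl_le_card: "finite L \<Longrightarrow> cl G L x \<le> card L"
  unfolding cl_def by (rule card_mono) auto

lemma cl_conn: "conn G x y \<Longrightarrow> cl G L x = cl G L y"
  unfolding cl_def by (rule arg_cong[where f = card]) (auto intro: conn_trans conn_sym)

lemma cl_sum: "finite L \<Longrightarrow> real (cl G L x) = (\<Sum>y\<in>L. of_bool (conn G x y))"
  unfolding cl_def by (simp add: sum.If_cases of_bool_def Int_def)

lemma cl_pos: "finite L \<Longrightarrow> x \<in> L \<Longrightarrow> 1 \<le> cl G L x"
  unfolding cl_def by (auto simp: Suc_le_eq card_gt_0_iff)

text \<open>This includes points outside \<open>L\<close>: if the cluster of \<open>x\<close> meets
  \<open>L\<close>, its count is the one seen from a point of \<open>L\<close>, and otherwise it is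
  0.\<close>

lemma cl_le_mx:
  assumes "finite L"
  shows "cl G L x \<le> mx G L"
proof (cases "cl G L x = 0")
  case False
  then have "{y\<in>L. conn G x y} \<noteq> {}" unfolding cl_def by (metis card.empty)
  then obtain y where "y \<in> L" "conn G x y" by blast
  then have "cl G L x = cl G L y" "cl G L y \<in> cl G L ` L" by (auto intro: cl_conn)
  then show ?thesis using assms by (simp add: mx_def)
qed simp

lemma mx_attained:
  assumes "finite L" "L \<noteq> {}"
  obtains x where "x \<in> L" "cl G L x = mx G L"
proof -
  have "mx G L \<in> cl G L ` L" unfolding mx_def by (rule Max_in) (use assms in auto)
  then show ?thesis using that by force
qed

lemma mx_mono: "finite L \<Longrightarrow> L \<noteq> {} \<Longrightarrow> G \<subseteq> \<eta> \<Longrightarrow> mx G L \<le> mx \<eta> L"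
  using mx_attained[of L G] cl_le_mx[of L \<eta>] cl_mono[of L G \<eta>] by (metis le_trans)

lemma mx_le_card: "finite L \<Longrightarrow> L \<noteq> {} \<Longrightarrow> mx G L \<le> card L"
  by (metis cl_le_card mx_attained)

lemma mx_pos: "finite L \<Longrightarrow> L \<noteq> {} \<Longrightarrow> 1 \<le> mx G L"
  by (metis cl_pos mx_attained)

lemma conn_restrict:
  assumes "conn G v y" "\<And>e. e \<in> G \<Longrightarrow> e \<noteq> {} \<Longrightarrow> e \<subseteq> {z. conn G v z} \<Longrightarrow> e \<in> \<eta>"
  shows "conn \<eta> v y"
  using assms(1)
proof (induction rule: conn_induct)
  case (step y z)
  then have "{y, z} \<in> \<eta>" using assms(2)[of "{y, z}"] conn_trans[OF step.hyps(1) conn_edge[OF step.hyps(3)]] step.hyps by auto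
  then show ?case using step.IH conn_edge conn_trans by metis
qed simp

section \<open>Edge-disjoint splitting of a cluster and tails of the largest cluster\<close>

lemma split_cluster:
  assumes "finite G" "finite L" "1 \<le> m" "m \<le> cl G L v"
  shows "\<exists>u I. I \<subseteq> G \<and> m \<le> cl I L u \<and> cl I L u < 2 * m \<and> conn (G - I) u v
     \<and> (\<forall>y. conn G v y \<longrightarrow> conn I u y \<or> conn (G - I) u y)"
  using assms(1,4)
proof (induction "card G" arbitrary: G v rule: less_induct)
  case less
  show ?case
  proof (cases "cl G L v < 2 * m")
    case True
    then show ?thesis using less.prems by (intro exI[of _ v] exI[of _ G]) auto
  next
    case False
    have "\<exists>y. y \<noteq> v \<and> conn G v y"
    proof (rule ccontr)
      assume "\<not> ?thesis"
      then have "{y\<in>L. conn G v y} \<subseteq> {v}" by auto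
      from card_mono[OF _ this] have "cl G L v \<le> 1" unfolding cl_def by simp
      with False assms(3) show False by linarith
    qed
    then obtain y where y: "y \<noteq> v" "conn G v y" by blast
    have "\<exists>w. w \<noteq> v \<and> {v, w} \<in> G"
    proof -
      have "y = v \<or> (\<exists>w. w \<noteq> v \<and> {v, w} \<in> G)" using y(2)
        by (induction rule: conn_induct) auto
      with y show ?thesis by auto
    qed
    then obtain w where w: "w \<noteq> v" "{v, w} \<in> G" by blast
    define G' where "G' = G - {{v, w}}"
    have G': "G = insert {v, w} G'" "{v, w} \<notin> G'" "finite G'" "G' \<subseteq> G"
      using w less.prems by (auto simp: G'_def)
    have card': "card G' < card G" using w less.prems unfolding G'_def by (metis card_Diff1_less)
    show ?thesis
    proof (cases "conn G' v w")
      case True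
      have eq: "conn G' v y" if "conn G v y" for y
        using conn_insertD[of v w G' v y] that G'(1) True conn_trans conn_sym by metis
      have "cl G L v \<le> cl G' L v" unfolding cl_def using assms(2) eq by (intro card_mono) auto
      then have "m \<le> cl G' L v" using less.prems by linarith
      from less.hyps[OF card' G'(3) this] obtain u I where
        I: "I \<subseteq> G'" "m \<le> cl I L u" "cl I L u < 2 * m" "conn (G' - I) u v"
         "\<And>y. conn G' v y \<Longrightarrow> conn I u y \<or> conn (G' - I) u y" by blast
      have s: "G' - I \<subseteq> G - I" using G'(4) by auto
      have "conn I u y \<or> conn (G - I) u y" if "conn G v y" for y
        using I(5)[OF eq[OF that]] conn_mono[OF s] by blast
      then show ?thesis using I(1-3) conn_mono[OF s I(4)] G'(4)
        by (intro exI[of _ u] exI[of _ I]) blast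
    next
      case nc: False
      \<comment> \<open>\<open>{v, w}\<close> is a bridge. \<open>G2\<close> consists of the edges
        on the side of \<open>w\<close>, \<open>G1\<close> of all others, and as the cluster has at
        least \<open>2 * m\<close> points one side keeps at least \<open>m\<close> of them.\<close>
      define C where "C = {z. conn G' w z}"
      define G2 where "G2 = {e\<in>G'. e \<subseteq> C}"
      define G1 where "G1 = G' - G2"
      have sub: "G1 \<subseteq> G'" "G2 \<subseteq> G'" "G1 \<inter> G2 = {}" "finite G1" "finite G2"
        using G'(3) by (auto simp: G1_def G2_def)
      have c2: "conn G2 w y" if "conn G' w y" for y
        using that by (rule conn_restrict) (auto simp: G2_def C_def)
      have c1: "conn G1 v y" if "conn G' v y" for y
        using that
      proof (induction rule: conn_induct)
        case (step y z)
        have "y \<notin> C" using step.hyps(1) nc conn_trans conn_sym unfolding C_def by (metis mem_Collect_eq)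
        then have "{y, z} \<in> G1" using step by (auto simp: G1_def G2_def)
        then show ?case using step.IH conn_edge conn_trans by metis
      qed simp
      have cases: "conn G1 v y \<or> conn G2 w y" if "conn G v y" for y
        using conn_insertD[of v w G' v y] that G'(1) nc c1 c2 by auto
      have "cl G L v \<le> card ({y\<in>L. conn G1 v y} \<union> {y\<in>L. conn G2 w y})"
        unfolding cl_def using assms(2) cases by (intro card_mono) auto
      also have "\<dots> \<le> cl G1 L v + cl G2 L w" unfolding cl_def by (rule card_Un_le)
      finally consider "m \<le> cl G2 L w" | "m \<le> cl G1 L v" using False by linarith
      then show ?thesis
      proof cases
        case 1
        have "card G2 < card G" using card' card_mono[OF G'(3) sub(2)] by linarith
        from less.hyps[OF this sub(5) 1] obtain u I where
          I: "I \<subseteq> G2" "m \<le> cl I L u" "cl I L u < 2 * m" "conn (G2 - I) u w"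
           "\<And>y. conn G2 w y \<Longrightarrow> conn I u y \<or> conn (G2 - I) u y" by blast
        have s: "G2 - I \<subseteq> G - I" "G1 \<subseteq> G - I" "{w, v} \<in> G - I"
          using I(1) sub G' by (auto simp: insert_commute)
        have uv: "conn (G - I) u v"
          using conn_mono[OF s(1) I(4)] conn_edge[OF s(3)] by (rule conn_trans)
        have "conn I u y \<or> conn (G - I) u y" if "conn G v y" for y
          using cases[OF that] I(5)[of y] conn_mono[OF s(1)] conn_mono[OF s(2)] conn_trans[OF uv] by blast
        then show ?thesis using I uv sub G'(4) by (intro exI[of _ u] exI[of _ I]) blast
      next
        case 2
        have "card G1 < card G" using card' card_mono[OF G'(3) sub(1)] by linarith
        from less.hyps[OF this sub(4) 2] obtain u I where
          I: "I \<subseteq> G1" "m \<le> cl I L u" "cl I L u < 2 * m" "conn (G1 - I) u v"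
           "\<And>y. conn G1 v y \<Longrightarrow> conn I u y \<or> conn (G1 - I) u y" by blast
        have s: "G1 - I \<subseteq> G - I" "G2 \<subseteq> G - I" "{v, w} \<in> G - I"
          using I(1) sub G' by auto
        have uv: "conn (G - I) u v" using conn_mono[OF s(1) I(4)] .
        have uw: "conn (G - I) u w" using uv conn_edge[OF s(3)] by (rule conn_trans)
        have "conn I u y \<or> conn (G - I) u y" if "conn G v y" for y
          using cases[OF that] I(5)[of y] conn_mono[OF s(1)] conn_mono[OF s(2)] conn_trans[OF uw] by blast
        then show ?thesis using I uv sub G'(4) by (intro exI[of _ u] exI[of _ I]) blast
      qed
    qed
  qed
qed

text \<open>The piece \<open>I\<close> takes fewer than \<open>2 * m\<close> of at least
  \<open>3 * m\<close> points, so more than \<open>m\<close> remain for the edge-disjoint rest. This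
  is the disjoint occurrence to which \<open>pexp_BK\<close> applies.\<close>

lemma split_mx:
  assumes "finite G" "finite L" "L \<noteq> {}" "1 \<le> m" "3 * m \<le> mx G L"
  shows "\<exists>I J. I \<inter> J = {} \<and> I \<union> J \<subseteq> G \<and> m \<le> mx I L \<and> m \<le> mx J L"
proof -
  obtain v where v: "cl G L v = mx G L" using mx_attained[OF assms(2,3)] by metis
  then have "m \<le> cl G L v" using assms by linarith
  from split_cluster[OF assms(1,2,4) this] obtain u I where
    I: "I \<subseteq> G" "m \<le> cl I L u" "cl I L u < 2 * m"
      "\<And>y. conn G v y \<Longrightarrow> conn I u y \<or> conn (G - I) u y" by blast
  have "cl G L v \<le> card ({y\<in>L. conn I u y} \<union> {y\<in>L. conn (G - I) u y})"
    unfolding cl_def using assms(2) I(4) by (intro card_mono) auto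
  also have "\<dots> \<le> cl I L u + cl (G - I) L u" unfolding cl_def by (rule card_Un_le)
  finally have "m \<le> cl (G - I) L u" using assms(5) v I(3) by linarith
  then show ?thesis using I(1,2) cl_le_mx[OF assms(2)]
    by (intro exI[of _ I] exI[of _ "G - I"]) (auto intro: order_trans)
qed

lemma pexp_mx_tail:
  assumes "finite E" "\<And>e. 0 \<le> w e" "finite L" "L \<noteq> {}" "1 \<le> m"
  shows "pexp E w (\<lambda>G. of_bool (3 * m \<le> mx G L)) \<le> (pexp E w (\<lambda>G. of_bool (m \<le> mx G L)))\<^sup>2"
proof -
  let ?Q = "\<lambda>I J. m \<le> mx I L \<and> m \<le> mx J L"
  have "pexp E w (\<lambda>G. of_bool (3 * m \<le> mx G L))
      \<le> pexp E w (\<lambda>G. of_bool (\<exists>I J. I \<inter> J = {} \<and> I \<union> J \<subseteq> G \<and> ?Q I J))"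
    using split_mx[OF finite_subset[OF _ assms(1)] assms(3-5)] assms(2) by (intro pexp_mono) auto
  also have "\<dots> \<le> pexp E w (\<lambda>G. pexp E w (\<lambda>\<eta>. of_bool (?Q G \<eta>)))"
    by (rule pexp_BK) (use assms mx_mono[OF assms(3,4)] in \<open>auto intro: order_trans\<close>)
  also have "\<dots> = pexp E w (\<lambda>G. pexp E w (\<lambda>\<eta>. of_bool (m \<le> mx G L) * of_bool (m \<le> mx \<eta> L)))"
    by (simp add: of_bool_conj)
  also have "\<dots> = (pexp E w (\<lambda>G. of_bool (m \<le> mx G L)))\<^sup>2"
    by (simp add: pexp_cmult pexp_multc power2_eq_square)
  finally show ?thesis .
qed

text \<open>Iterated squaring yields a doubly exponential tail; a geometric one is enough for
  moments, and \<open>2 * j + 2\<close> is at least \<open>Suc j + 1\<close>.\<close>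

lemma pexp_mx_tail_iter:
  assumes "finite E" "\<And>e. 0 \<le> w e" "finite L" "L \<noteq> {}" "1 \<le> m"
    and "pexp E w (\<lambda>G. of_bool (m \<le> mx G L)) \<le> p" "p \<le> 1"
  shows "pexp E w (\<lambda>G. of_bool (3 ^ j * m \<le> mx G L)) \<le> p ^ (j + 1)"
proof (induction j)
  case (Suc j)
  have p0: "0 \<le> p" using assms(6) pexp_nonneg[of w E "\<lambda>G. of_bool (m \<le> mx G L)"] assms(2) by auto
  have "pexp E w (\<lambda>G. of_bool (3 ^ Suc j * m \<le> mx G L)) \<le> (pexp E w (\<lambda>G. of_bool (3 ^ j * m \<le> mx G L)))\<^sup>2"
    using pexp_mx_tail[OF assms(1-4), of "3 ^ j * m"] assms(5) by (simp add: mult.assoc)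
  also have "\<dots> \<le> (p ^ (j + 1))\<^sup>2"
    by (intro power_mono Suc pexp_nonneg assms) auto
  also have "\<dots> = p ^ (2 * j + 2)" unfolding power_mult[symmetric] by (rule arg_cong[where f = "power p"]) simp
  also have "\<dots> \<le> p ^ (Suc j + 1)" by (rule power_decreasing) (use p0 assms(7) in auto)
  finally show ?case .
qed (use assms in simp)

text \<open>The value 162 is \<open>2 * 3 ^ 4\<close>: a layer costs the factor \<open>3 ^ 4\<close>
  in the fourth moment and gains \<open>1 / 162\<close> in probability, so the layers sum like
  powers of 1/2. \<open>card L\<close> layers suffice because \<open>mx G L\<close> is at most
  \<open>card L\<close>, which is below \<open>3 ^ card L\<close>.\<close>

lemma pexp_mx_fourth_moment:
  assumes "finite E" "\<And>e. 0 \<le> w e" "finite L" "L \<noteq> {}" "1 \<le> m"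
    and "pexp E w (\<lambda>G. of_bool (m \<le> mx G L)) \<le> 1 / 162"
  shows "pexp E w (\<lambda>G. real (mx G L) ^ 4) \<le> 2 * real m ^ 4"
proof -
  let ?n = "card L"
  have half: "(\<Sum>j<n. (1 / 2 :: real) ^ (j + 1)) = 1 - (1 / 2) ^ n" for n
    by (induction n) auto
  let ?t = "\<lambda>j G. of_bool (3 ^ j * m \<le> mx G L) :: real"
  have pt: "real (mx G L) ^ 4 \<le> real m ^ 4 + (\<Sum>j<?n. (3 ^ (j + 1) * real m) ^ 4 * ?t j G)" for G
  proof (cases "m \<le> mx G L")
    case False
    then have "real (mx G L) ^ 4 \<le> real m ^ 4" by (intro power_mono) auto
    also have "\<dots> \<le> real m ^ 4 + (\<Sum>j<?n. (3 ^ (j + 1) * real m) ^ 4 * ?t j G)"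
      by (simp add: sum_nonneg)
    finally show ?thesis .
  next
    case True
    \<comment> \<open>With \<open>j\<close> the first level above the maximum, the single summand of
      index \<open>j - 1\<close> already dominates the fourth power; \<open>j\<close> is positive
      because \<open>m\<close> does not exceed the maximum.\<close>
    define P where "P j \<longleftrightarrow> mx G L < 3 ^ j * m" for j
    have lt: "i < 3 ^ i" for i :: nat by (induction i) auto
    have "mx G L \<le> ?n" using assms mx_le_card by blast
    also have "?n < 3 ^ ?n * m" using lt[of ?n] assms(5) by (metis less_le_trans mult.right_neutral mult_le_mono2)
    finally have Pn: "P ?n" by (simp add: P_def)
    define j where "j = (LEAST j. P j)"
    have "\<not> P 0" using True by (simp add: P_def)
    moreover have Pj: "P j" unfolding j_def by (rule LeastI[of P, OF Pn])
    moreover have "j \<le> ?n" unfolding j_def by (rule Least_le[of P, OF Pn])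
    ultimately have j: "P j" "j \<le> ?n" "j \<noteq> 0" by metis+
    have "\<not> P (j - 1)" using not_less_Least[of "j - 1" P] j(3) unfolding j_def by auto
    then have t: "?t (j - 1) G = 1" by (simp add: P_def)
    have "real (mx G L) \<le> real (3 ^ j * m)" using j(1) unfolding P_def by linarith
    then have "real (mx G L) ^ 4 \<le> real (3 ^ j * m) ^ 4" by (intro power_mono) auto
    moreover have "real (3 ^ j * m) = 3 ^ (j - 1 + 1) * real m" using j(3) by simp
    ultimately have "real (mx G L) ^ 4 \<le> (3 ^ (j - 1 + 1) * real m) ^ 4 * ?t (j - 1) G"
      by (simp only: t mult_1_right)
    also have "\<dots> \<le> (\<Sum>j<?n. (3 ^ (j + 1) * real m) ^ 4 * ?t j G)"
      using j by (intro member_le_sum[of _ _ "\<lambda>j. (3 ^ (j + 1) * real m) ^ 4 * ?t j G"]) auto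
    finally show ?thesis by (simp add: add_increasing)
  qed
  have "pexp E w (\<lambda>G. real (mx G L) ^ 4)
     \<le> pexp E w (\<lambda>G. real m ^ 4 + (\<Sum>j<?n. (3 ^ (j + 1) * real m) ^ 4 * ?t j G))"
    by (intro pexp_mono assms pt)
  also have "\<dots> = real m ^ 4 + (\<Sum>j<?n. (3 ^ (j + 1) * real m) ^ 4 * pexp E w (?t j))"
    unfolding pexp_add pexp_sum pexp_cmult using assms by (simp add: pexp_const)
  also have "\<dots> \<le> real m ^ 4 + (\<Sum>j<?n. (3 ^ (j + 1) * real m) ^ 4 * (1 / 162) ^ (j + 1))"
    by (intro add_left_mono sum_mono mult_left_mono pexp_mx_tail_iter assms) auto
  also have "(\<Sum>j<?n. (3 ^ (j + 1) * real m) ^ 4 * (1 / 162) ^ (j + 1)) = real m ^ 4 * (\<Sum>j<?n. (1 / 2) ^ (j + 1))"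
    unfolding sum_distrib_left
  proof (rule sum.cong)
    fix j
    have "(3 ^ (j + 1) * real m) ^ 4 * (1 / 162) ^ (j + 1) = real m ^ 4 * ((3 ^ 4) ^ (j + 1) * (1 / 162) ^ (j + 1))"
      by (simp only: power_mult_distrib power_mult[symmetric] mult_ac)
    also have "(3 ^ 4) ^ (j + 1) * (1 / 162) ^ (j + 1) = (1 / 2 :: real) ^ (j + 1)"
      unfolding power_mult_distrib[symmetric] by simp
    finally show "(3 ^ (j + 1) * real m) ^ 4 * (1 / 162) ^ (j + 1) = real m ^ 4 * (1 / 2) ^ (j + 1)" .
  qed simp
  finally have "pexp E w (\<lambda>G. real (mx G L) ^ 4) \<le> real m ^ 4 + real m ^ 4 * (\<Sum>j<?n. (1 / 2) ^ (j + 1))" .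
  also have "\<dots> \<le> real m ^ 4 + real m ^ 4 * 1"
    by (intro add_left_mono mult_left_mono) (use half[of ?n] in auto)
  finally show ?thesis by simp
qed

definition cross :: "'a set \<Rightarrow> 'a set \<Rightarrow> 'a set set" where
  "cross A B = (\<lambda>(a, b). {a, b}) ` (A \<times> B)"

definition pairs_in :: "'a set \<Rightarrow> 'a set set" where
  "pairs_in L = {e. e \<subseteq> L \<and> card e = 2}"

lemma finite_pairs_in [simp]: "finite L \<Longrightarrow> finite (pairs_in L)"
  unfolding pairs_in_def by (rule finite_subset[of _ "Pow L"]) auto

lemma pair_in_pairs_in [simp]: "{a, b} \<in> pairs_in L \<longleftrightarrow> a \<in> L \<and> b \<in> L \<and> a \<noteq> b"
  by (auto simp: pairs_in_def card_insert_if)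

lemma card_cross:
  assumes "A \<inter> B = {}"
  shows "card (cross A B) = card A * card B"
proof -
  have "inj_on (\<lambda>(a, b). {a, b}) (A \<times> B)"
    using assms by (auto simp: inj_on_def doubleton_eq_iff)
  then show ?thesis by (simp add: cross_def card_image card_cartesian_product)
qed

lemma conn_insert_cross:
  assumes "a \<in> A" "b \<in> B" "{a, b} \<in> G" "\<And>y. y \<in> A \<Longrightarrow> conn G x y" "\<And>y. y \<in> B \<Longrightarrow> conn G x' y"
  shows "conn G x x'"
  using conn_trans[OF conn_trans[OF assms(4)[OF assms(1)] conn_edge[OF assms(3)]] conn_sym[OF assms(5)[OF assms(2)]]] .

section \<open>Merging the large clusters of the subcubes by sprinkling\<close>

text \<open>Two clusters with at least \<open>s\<close> points each stay unjoined by the new edges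
  with probability at most \<open>exp (- (q * s\<^sup>2))\<close>, and \<open>\<delta>\<close> is
  the union bound over ordered pairs of subcubes. Subcubes whose largest cluster is below
  \<open>s\<close> are given up, at the cost of \<open>s\<close> each.\<close>

lemma pexp_merge:
  assumes E: "finite E" "pairs_in L \<subseteq> E" and w: "\<And>e. 0 \<le> w e" and q: "0 \<le> q" and s: "0 \<le> s"
    and I: "finite I" "\<And>i. i \<in> I \<Longrightarrow> finite (c i) \<and> c i \<noteq> {} \<and> c i \<subseteq> L"
      "\<And>i j. i \<in> I \<Longrightarrow> j \<in> I \<Longrightarrow> i \<noteq> j \<Longrightarrow> c i \<inter> c j = {}"
    and L: "finite L"
    and \<delta>: "\<delta> = real (card I) ^ 2 * exp (- (q * s\<^sup>2))" "\<delta> \<le> 1"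
  shows "(1 - \<delta>) * (\<Sum>i\<in>I. pexp E w (\<lambda>G. real (mx G (c i))) - s)
     \<le> pexp E (\<lambda>e. w e + (if e \<in> pairs_in L then q else 0)) (\<lambda>G. real (mx G L))"
proof -
  define v where "v = (\<lambda>e. if e \<in> pairs_in L then q else 0)"
  have v: "0 \<le> v e" for e using q by (simp add: v_def)
  have main: "(1 - \<delta>) * (\<Sum>i\<in>I. real (mx G (c i)) - s) \<le> pexp E v (\<lambda>\<eta>. real (mx (G \<union> \<eta>) L))" for G
  proof -
    have "\<exists>x. x \<in> c i \<and> cl G (c i) x = mx G (c i)" if "i \<in> I" for i
      using I(2)[OF that] mx_attained by metis
    then obtain x where x: "\<And>i. i \<in> I \<Longrightarrow> x i \<in> c i \<and> cl G (c i) (x i) = mx G (c i)" by metis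
    define A where "A i = {y\<in>c i. conn G (x i) y}" for i
    have A: "finite (A i)" "A i \<subseteq> c i" "card (A i) = mx G (c i)" if "i \<in> I" for i
      using x[OF that] I(2)[OF that] by (auto simp: A_def cl_def)
    define H where "H = {i\<in>I. s \<le> real (mx G (c i))}"
    have HI: "H \<subseteq> I" and fH: "finite H" using I(1) by (auto simp: H_def)
    let ?X = "{p\<in>H \<times> H. fst p \<noteq> snd p}"
    let ?bad = "\<lambda>p \<eta>. of_bool (\<eta> \<inter> cross (A (fst p)) (A (snd p)) = {}) :: real"
    define T where "T = (\<Sum>i\<in>H. real (mx G (c i)))"
    have T0: "0 \<le> T" by (simp add: T_def sum_nonneg)
    have pt: "T * (1 - (\<Sum>p\<in>?X. ?bad p \<eta>)) \<le> real (mx (G \<union> \<eta>) L)" for \<eta>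
    proof (cases "\<forall>p\<in>?X. \<eta> \<inter> cross (A (fst p)) (A (snd p)) \<noteq> {}")
      case True
      then have S0: "(\<Sum>p\<in>?X. ?bad p \<eta>) = 0" by (intro sum.neutral) auto
      show ?thesis
      proof (cases "H = {}")
        case True
        then show ?thesis by (simp add: T_def)
      next
        case False
        then obtain k where k: "k \<in> H" by blast
        have con: "conn (G \<union> \<eta>) (x k) (x i)" if i: "i \<in> H" for i
        proof (cases "i = k")
          case False
          then have "(k, i) \<in> ?X" using k i by auto
          then have "\<eta> \<inter> cross (A k) (A i) \<noteq> {}" using True by force
          then obtain a b where "a \<in> A k" "b \<in> A i" "{a, b} \<in> G \<union> \<eta>" unfolding cross_def by auto
          then show ?thesis
            by (rule conn_insert_cross) (auto simp: A_def intro: conn_mono[of G])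
        qed simp
        \<comment> \<open>The sets \<open>A i\<close> may belong to one and the same cluster of
          \<open>G\<close>; their sizes add up because the subcubes are disjoint.\<close>
        have "A i \<inter> A j = {}" if "i \<in> H" "j \<in> H" "i \<noteq> j" for i j
          using A(2)[of i] A(2)[of j] I(3)[of i j] that HI by blast
        then have "card (\<Union>i\<in>H. A i) = (\<Sum>i\<in>H. card (A i))"
          using A(1) HI by (intro card_UN_disjoint fH) auto
        then have "real (card (\<Union>i\<in>H. A i)) = (\<Sum>i\<in>H. real (card (A i)))" by simp
        also have "\<dots> = T" unfolding T_def using A HI by (intro sum.cong) auto
        finally have "T = real (card (\<Union>i\<in>H. A i))" ..
        also have "(\<Union>i\<in>H. A i) \<subseteq> {y\<in>L. conn (G \<union> \<eta>) (x k) y}"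
        proof safe
          fix i y assume iy: "i \<in> H" "y \<in> A i"
          have "conn (G \<union> \<eta>) (x i) y" using iy(2) conn_mono[of G "G \<union> \<eta>"] by (auto simp: A_def)
          with con[OF iy(1)] show "conn (G \<union> \<eta>) (x k) y" by (rule conn_trans)
          show "y \<in> L" using iy A(2)[of i] I(2)[of i] HI by blast
        qed
        then have "card (\<Union>i\<in>H. A i) \<le> cl (G \<union> \<eta>) L (x k)"
          unfolding cl_def using L by (intro card_mono) auto
        also have "\<dots> \<le> mx (G \<union> \<eta>) L" by (rule cl_le_mx[OF L])
        finally show ?thesis unfolding S0 by simp
      qed
    next
      case False
      then obtain p where p: "p \<in> ?X" "\<eta> \<inter> cross (A (fst p)) (A (snd p)) = {}" by blast
      have "1 = ?bad p \<eta>" using p by simp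
      also have "\<dots> \<le> (\<Sum>p\<in>?X. ?bad p \<eta>)"
        by (rule member_le_sum) (use p fH in auto)
      finally have "T * (1 - (\<Sum>p\<in>?X. ?bad p \<eta>)) \<le> 0" using T0 by (simp add: mult_nonneg_nonpos)
      then show ?thesis by linarith
    qed
    have bad: "pexp E v (?bad p) \<le> exp (- (q * s\<^sup>2))" if p: "p \<in> ?X" for p
    proof -
      obtain i j where ij: "p = (i, j)" "i \<in> H" "j \<in> H" "i \<noteq> j" using p by (cases p) auto
      have IJ: "i \<in> I" "j \<in> I" using ij HI by auto
      have disj: "A i \<inter> A j = {}" using A[OF IJ(1)] A[OF IJ(2)] I(3)[OF IJ ij(4)] by blast
      have sub: "cross (A i) (A j) \<subseteq> pairs_in L"
      proof -
        have "A i \<subseteq> L" "A j \<subseteq> L" using A(2) I(2) IJ by blast+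
        then show ?thesis using disj by (fastforce simp: cross_def)
      qed
      have "(\<Sum>e\<in>E \<inter> cross (A i) (A j). v e) = (\<Sum>e\<in>cross (A i) (A j). q)"
        by (rule sum.cong) (use sub E in \<open>auto simp: v_def\<close>)
      also have "\<dots> = q * (real (mx G (c i)) * real (mx G (c j)))"
        using card_cross[OF disj] A(3) IJ by simp
      finally have eq: "pexp E v (?bad p) = exp (- (q * (real (mx G (c i)) * real (mx G (c j)))))"
        by (simp add: pexp_disjnt[OF E(1)] ij(1))
      have "s * s \<le> real (mx G (c i)) * real (mx G (c j))"
        using ij s by (intro mult_mono) (auto simp: H_def)
      then have "q * s\<^sup>2 \<le> q * (real (mx G (c i)) * real (mx G (c j)))"
        using q by (intro mult_left_mono) (auto simp: power2_eq_square)
      then show ?thesis unfolding eq by simp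
    qed
    have "real (card ?X) \<le> real (card (H \<times> H))" using fH by (intro of_nat_mono card_mono) auto
    also have "\<dots> \<le> real (card I) ^ 2"
      using card_mono[OF I(1) HI] by (simp add: card_cartesian_product power2_eq_square mult_mono)
    finally have cX: "real (card ?X) \<le> real (card I) ^ 2" .
    have "(\<Sum>p\<in>?X. pexp E v (?bad p)) \<le> (\<Sum>p\<in>?X. exp (- (q * s\<^sup>2)))" by (rule sum_mono) (rule bad)
    also have "\<dots> \<le> \<delta>" unfolding \<delta>(1) using cX by (simp add: mult_right_mono)
    finally have sb: "(\<Sum>p\<in>?X. pexp E v (?bad p)) \<le> \<delta>" .
    \<comment> \<open>Subtracting \<open>s\<close> everywhere replaces the indicator of
      \<open>H\<close> by an expression linear in \<open>mx\<close>, whose expectation is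
      available.\<close>
    have "(\<Sum>i\<in>I. real (mx G (c i)) - s) \<le> (\<Sum>i\<in>I. if i \<in> H then real (mx G (c i)) else 0)"
      using s by (intro sum_mono) (auto simp: H_def)
    also have "\<dots> = T" unfolding T_def using I(1) HI by (simp add: sum.If_cases Int_absorb1)
    finally have "(1 - \<delta>) * (\<Sum>i\<in>I. real (mx G (c i)) - s) \<le> (1 - \<delta>) * T"
      using \<delta>(2) by (intro mult_left_mono) auto
    also have "\<dots> \<le> (1 - (\<Sum>p\<in>?X. pexp E v (?bad p))) * T"
      using sb T0 by (intro mult_right_mono) auto
    also have "\<dots> = pexp E v (\<lambda>\<eta>. T * (1 - (\<Sum>p\<in>?X. ?bad p \<eta>)))"
      by (simp add: pexp_cmult pexp_diff pexp_sum pexp_const[OF E(1)])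
    also have "\<dots> \<le> pexp E v (\<lambda>\<eta>. real (mx (G \<union> \<eta>) L))"
      by (intro pexp_mono v pt)
    finally show ?thesis .
  qed
  have "(1 - \<delta>) * (\<Sum>i\<in>I. pexp E w (\<lambda>G. real (mx G (c i))) - s)
     = pexp E w (\<lambda>G. (1 - \<delta>) * (\<Sum>i\<in>I. real (mx G (c i)) - s))"
    by (simp add: pexp_cmult pexp_sum pexp_diff pexp_const[OF E(1)])
  also have "\<dots> \<le> pexp E w (\<lambda>G. pexp E v (\<lambda>\<eta>. real (mx (G \<union> \<eta>) L)))"
    by (intro pexp_mono w main)
  also have "\<dots> = pexp E (\<lambda>e. w e + v e) (\<lambda>G. real (mx G L))"
    by (rule pexp_union[symmetric]) (rule E)
  finally show ?thesis unfolding v_def .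
qed

section \<open>Leaving the cluster of a weaker percolation\<close>

text \<open>Whether the cluster of \<open>x\<close> equals \<open>A\<close> is decided by the edges
  meeting \<open>A\<close>: those inside connect it, those leaving must be absent. Hence the event
  is independent of all edges off \<open>A\<close>.\<close>

lemma cluster_restrict:
  assumes "\<Union>G \<subseteq> V"
  shows "{z\<in>V. conn G x z} = A \<longleftrightarrow> {z\<in>V. conn (G \<inter> {e. e \<inter> A \<noteq> {}}) x z} = A"
    (is "_ \<longleftrightarrow> {z\<in>V. conn ?\<eta> x z} = A")
proof
  assume A: "{z\<in>V. conn G x z} = A"
  have "conn ?\<eta> x z" if "conn G x z" for z
    using that
  proof (rule conn_restrict)
    fix e assume e: "e \<in> G" "e \<noteq> {}" "e \<subseteq> {z. conn G x z}"
    then obtain z where "z \<in> e" "z \<in> V" "conn G x z" using assms by blast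
    then have "z \<in> e \<inter> A" using A by auto
    then show "e \<in> ?\<eta>" using e(1) by auto
  qed
  moreover have "conn G x z" if "conn ?\<eta> x z" for z using that by (rule conn_mono[rotated]) auto
  ultimately show "{z\<in>V. conn ?\<eta> x z} = A" using A by auto
next
  assume A: "{z\<in>V. conn ?\<eta> x z} = A"
  have "conn ?\<eta> x z" if "conn G x z" for z
    using that
  proof (induction rule: conn_induct)
    case (step y z)
    have "y \<in> A" using A assms step.hyps(3) step.IH by blast
    then have "{y, z} \<in> ?\<eta>" using step.hyps(3) by auto
    from conn_trans[OF step.IH conn_edge[OF this]] show ?case .
  qed simp
  moreover have "conn G x z" if "conn ?\<eta> x z" for z using that by (rule conn_mono[rotated]) auto
  ultimately show "{z\<in>V. conn G x z} = A" using A by auto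
qed

text \<open>Cutting at the last visit to \<open>A\<close>, rather than the first exit, makes the
  remaining path avoid every edge that meets \<open>A\<close>.\<close>

lemma last_exit:
  assumes "conn \<zeta> x y" "x \<in> A" "y \<notin> A"
  shows "\<exists>z\<in>A. \<exists>u. u \<notin> A \<and> {z, u} \<in> \<zeta> \<and> conn (\<zeta> - {e. e \<inter> A \<noteq> {}}) u y"
proof -
  have "y \<notin> A \<longrightarrow> ?thesis" using assms(1)
  proof (induction rule: conn_induct)
    case (step y z)
    show ?case
    proof (cases "y \<in> A")
      case True
      then show ?thesis using step.hyps by (intro impI bexI[of _ y] exI[of _ z]) auto
    next
      case False
      show ?thesis
      proof
        assume z: "z \<notin> A"
        obtain t u where tu: "t \<in> A" "u \<notin> A" "{t, u} \<in> \<zeta>" "conn (\<zeta> - {e. e \<inter> A \<noteq> {}}) u y"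
          using False step.IH by blast
        have "{y, z} \<in> \<zeta> - {e. e \<inter> A \<noteq> {}}" using z False step.hyps by auto
        from conn_trans[OF tu(4) conn_edge[OF this]] show "\<exists>t\<in>A. \<exists>u. u \<notin> A \<and> {t, u} \<in> \<zeta> \<and> conn (\<zeta> - {e. e \<inter> A \<noteq> {}}) u z"
          using tu(1-3) by blast
      qed
    qed
  qed (use assms in simp)
  with assms(3) show ?thesis by blast
qed

text \<open>Condition on the cluster \<open>A\<close> of \<open>x\<close> under \<open>w\<close>
  alone. A connection present only in the union leaves \<open>A\<close> for the last time through an
  edge of weight \<open>v\<close>. The events that the cluster is \<open>A\<close>, that this edge
  is open in \<open>\<eta>\<close>, and that the rest of the path exists off \<open>A\<close> are
  independent; summing over \<open>A\<close> containing \<open>z\<close> restores the event that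
  \<open>x\<close> is connected to \<open>z\<close>.\<close>

lemma pexp_conn_le:
  assumes E: "finite E" and w: "\<And>e. 0 \<le> w e" and v: "\<And>e. 0 \<le> v e"
    and V: "finite V" "\<Union>E \<subseteq> V" "x \<in> V"
  shows "pexp E (\<lambda>e. w e + v e) (\<lambda>G. of_bool (conn G x y)) \<le> pexp E w (\<lambda>G. of_bool (conn G x y))
    + (\<Sum>z\<in>V. \<Sum>u\<in>V. pexp E w (\<lambda>G. of_bool (conn G x z)) * v {z, u} * pexp E (\<lambda>e. w e + v e) (\<lambda>G. of_bool (conn G u y)))"
proof -
  define T where "T A = {e :: 'a set. e \<inter> A \<noteq> {}}" for A
  let ?C = "\<lambda>G. {z\<in>V. conn G x z}"
  let ?\<tau> = "\<lambda>u. pexp E (\<lambda>e. w e + v e) (\<lambda>G. of_bool (conn G u y)) :: real"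
  let ?f = "\<lambda>A G. of_bool (?C G = A) :: real"
  let ?g = "\<lambda>A u G \<eta>. of_bool (conn ((G \<union> \<eta>) - T A) u y) :: real"
  have pt: "of_bool (conn (G \<union> \<eta>) x y) \<le> (of_bool (conn G x y) :: real)
      + (\<Sum>A\<in>Pow V. \<Sum>z\<in>V. \<Sum>u\<in>V. of_bool (z \<in> A \<and> u \<notin> A) * (?f A G * (of_bool ({z, u} \<in> \<eta>) * ?g A u G \<eta>)))"
    (is "_ \<le> _ + ?S G \<eta>") if "G \<subseteq> E" "\<eta> \<subseteq> E" for G \<eta>
  proof (cases "conn (G \<union> \<eta>) x y \<and> \<not> conn G x y")
    case True
    define A where "A = ?C G"
    have "x \<in> A" "y \<notin> A" using True V by (auto simp: A_def)
    from last_exit[OF _ this, of "G \<union> \<eta>"] True obtain z u where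
      zu: "z \<in> A" "u \<notin> A" "{z, u} \<in> G \<union> \<eta>" "conn ((G \<union> \<eta>) - T A) u y"
      unfolding T_def by blast
    have uV: "u \<in> V" "z \<in> V" using zu(3) that V by auto
    \<comment> \<open>The exit edge comes from \<open>\<eta>\<close>, since an edge of
      \<open>G\<close> would put \<open>u\<close> into the cluster \<open>A\<close>.\<close>
    have "{z, u} \<notin> G"
    proof
      assume "{z, u} \<in> G"
      then have "conn G x u" using zu(1) conn_edge conn_trans unfolding A_def by (metis mem_Collect_eq)
      then show False using zu(2) uV by (simp add: A_def)
    qed
    then have e: "{z, u} \<in> \<eta>" using zu(3) by simp
    have AV: "A \<in> Pow V" by (auto simp: A_def)
    let ?F = "\<lambda>A z u. of_bool (z \<in> A \<and> u \<notin> A) * (?f A G * (of_bool ({z, u} \<in> \<eta>) * ?g A u G \<eta>))"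
    have "1 = ?F A z u" using zu e by (simp add: A_def)
    also have "\<dots> \<le> (\<Sum>u\<in>V. ?F A z u)" by (rule member_le_sum) (use uV V in auto)
    also have "\<dots> \<le> (\<Sum>z\<in>V. \<Sum>u\<in>V. ?F A z u)"
      by (rule member_le_sum[of z V "\<lambda>z. \<Sum>u\<in>V. ?F A z u"]) (use uV V in \<open>auto intro: sum_nonneg\<close>)
    also have "\<dots> \<le> ?S G \<eta>"
      by (rule member_le_sum[of A "Pow V" "\<lambda>A. \<Sum>z\<in>V. \<Sum>u\<in>V. ?F A z u"]) (use AV V in \<open>auto intro!: sum_nonneg\<close>)
    finally show ?thesis by (simp add: True)
  next
    case False
    have "0 \<le> ?S G \<eta>" by (intro sum_nonneg) auto
    then show ?thesis using False by auto
  qed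
  \<comment> \<open>The first use of \<open>pexp_indep\<close> separates, inside
    \<open>\<eta>\<close>, the edge \<open>{z, u}\<close> from the edges off \<open>A\<close>; the
    second separates, inside \<open>G\<close>, the event that the cluster is \<open>A\<close> from
    those edges.\<close>
  have bound: "pexp E w (\<lambda>G. ?f A G * pexp E v (\<lambda>\<eta>. of_bool ({z, u} \<in> \<eta>) * ?g A u G \<eta>))
     \<le> pexp E w (?f A) * v {z, u} * ?\<tau> u" if zA: "z \<in> A" for A z u
  proof -
    let ?e = "{z, u}"
    have eT: "?e \<in> T A" using zA by (auto simp: T_def)
    have in1: "pexp E v (\<lambda>\<eta>. of_bool (?e \<in> \<eta>) * ?g A u G \<eta>) \<le> v ?e * pexp E v (?g A u G)" for G
    proof -
      have "pexp E v (\<lambda>\<eta>. of_bool (?e \<in> \<eta>) * ?g A u G \<eta>)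
          = pexp E v (\<lambda>\<eta>. of_bool (?e \<in> \<eta> \<inter> T A) * of_bool (conn ((G - T A) \<union> (\<eta> - T A)) u y))"
        using eT by (simp add: Un_Diff)
      also have "\<dots> = pexp E v (\<lambda>\<eta>. of_bool (?e \<in> \<eta> \<inter> T A)) * pexp E v (\<lambda>\<eta>. of_bool (conn ((G - T A) \<union> (\<eta> - T A)) u y))"
        by (rule pexp_indep[OF E, where f = "\<lambda>\<eta>. of_bool (?e \<in> \<eta>)" and g = "\<lambda>\<eta>. of_bool (conn ((G - T A) \<union> \<eta>) u y)"])
      also have "\<dots> = pexp E v (\<lambda>\<eta>. of_bool (?e \<in> \<eta>)) * pexp E v (?g A u G)"
        using eT by (simp add: Un_Diff)
      also have "pexp E v (\<lambda>\<eta>. of_bool (?e \<in> \<eta>)) = pexp E v (\<lambda>\<eta>. 1 - of_bool (\<eta> \<inter> {?e} = {}))"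
        by (rule pexp_cong) auto
      also have "\<dots> = 1 - exp (- (\<Sum>e\<in>E \<inter> {?e}. v e))"
        unfolding pexp_diff pexp_const[OF E] pexp_disjnt[OF E] ..
      also have "\<dots> \<le> (\<Sum>e\<in>E \<inter> {?e}. v e)"
        using exp_ge_add_one_self[of "- (\<Sum>e\<in>E \<inter> {?e}. v e)"] by linarith
      also have "\<dots> \<le> v ?e" using v[of ?e] by (cases "?e \<in> E") auto
      finally show ?thesis by (simp add: mult_right_mono pexp_nonneg v)
    qed
    have "pexp E w (\<lambda>G. ?f A G * pexp E v (\<lambda>\<eta>. of_bool (?e \<in> \<eta>) * ?g A u G \<eta>))
        \<le> pexp E w (\<lambda>G. ?f A G * (v ?e * pexp E v (?g A u G)))"
      by (intro pexp_mono w mult_left_mono in1) auto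
    also have "\<dots> = v ?e * pexp E w (\<lambda>G. ?f A G * pexp E v (?g A u G))"
      unfolding pexp_cmult[symmetric] by (simp only: mult_ac)
    also have "pexp E w (\<lambda>G. ?f A G * pexp E v (?g A u G))
        = pexp E w (\<lambda>G. ?f A (G \<inter> T A) * pexp E v (?g A u (G - T A)))"
    proof (rule pexp_cong)
      fix G assume "G \<subseteq> E"
      then have "\<Union>G \<subseteq> V" using V by blast
      from cluster_restrict[OF this, of x A]
      show "?f A G * pexp E v (?g A u G) = ?f A (G \<inter> T A) * pexp E v (?g A u (G - T A))"
        by (simp add: T_def Un_Diff)
    qed
    also have "\<dots> = pexp E w (\<lambda>G. ?f A (G \<inter> T A)) * pexp E w (\<lambda>G. pexp E v (?g A u (G - T A)))"
      by (rule pexp_indep[OF E, where f = "?f A" and g = "\<lambda>G. pexp E v (?g A u G)"])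
    also have "pexp E w (\<lambda>G. ?f A (G \<inter> T A)) = pexp E w (?f A)"
    proof (rule pexp_cong)
      fix G assume "G \<subseteq> E"
      then have "\<Union>G \<subseteq> V" using V by blast
      from cluster_restrict[OF this, of x A] show "?f A (G \<inter> T A) = ?f A G" by (simp add: T_def)
    qed
    finally have 1: "pexp E w (\<lambda>G. ?f A G * pexp E v (\<lambda>\<eta>. of_bool (?e \<in> \<eta>) * ?g A u G \<eta>))
        \<le> v ?e * (pexp E w (?f A) * pexp E w (\<lambda>G. pexp E v (?g A u (G - T A))))" .
    have 2: "pexp E w (\<lambda>G. pexp E v (?g A u (G - T A))) \<le> ?\<tau> u"
      unfolding pexp_union[OF E]
    proof (intro pexp_mono w v)
      fix G \<eta>
      have "(G - T A) \<union> \<eta> - T A \<subseteq> G \<union> \<eta>" by auto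
      from conn_mono[OF this, of u y] show "?g A u (G - T A) \<eta> \<le> of_bool (conn (G \<union> \<eta>) u y)" by simp
    qed
    have "v ?e * (pexp E w (?f A) * pexp E w (\<lambda>G. pexp E v (?g A u (G - T A))))
        \<le> v ?e * (pexp E w (?f A) * ?\<tau> u)"
      by (intro mult_left_mono 2 v pexp_nonneg w) auto
    with 1 show ?thesis by (simp only: mult_ac)
  qed
  have "pexp E (\<lambda>e. w e + v e) (\<lambda>G. of_bool (conn G x y))
      \<le> pexp E w (\<lambda>G. pexp E v (\<lambda>\<eta>. of_bool (conn G x y) + ?S G \<eta>))"
    unfolding pexp_union[OF E] by (intro pexp_mono w v pt)
  also have "\<dots> = pexp E w (\<lambda>G. of_bool (conn G x y))
     + (\<Sum>A\<in>Pow V. \<Sum>z\<in>V. \<Sum>u\<in>V. of_bool (z \<in> A \<and> u \<notin> A) *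
          pexp E w (\<lambda>G. ?f A G * pexp E v (\<lambda>\<eta>. of_bool ({z, u} \<in> \<eta>) * ?g A u G \<eta>)))"
    unfolding pexp_add pexp_sum pexp_cmult pexp_const[OF E] ..
  also have "\<dots> \<le> pexp E w (\<lambda>G. of_bool (conn G x y))
     + (\<Sum>A\<in>Pow V. \<Sum>z\<in>V. \<Sum>u\<in>V. of_bool (z \<in> A) * (pexp E w (?f A) * v {z, u} * ?\<tau> u))"
  proof (intro add_left_mono sum_mono)
    fix A z u
    have "0 \<le> pexp E w (?f A) * v {z, u} * ?\<tau> u"
      using w v by (intro mult_nonneg_nonneg pexp_nonneg) (auto intro: add_nonneg_nonneg)
    then show "of_bool (z \<in> A \<and> u \<notin> A) * pexp E w (\<lambda>G. ?f A G * pexp E v (\<lambda>\<eta>. of_bool ({z, u} \<in> \<eta>) * ?g A u G \<eta>))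
       \<le> of_bool (z \<in> A) * (pexp E w (?f A) * v {z, u} * ?\<tau> u)"
      using bound[of z A u] by (cases "z \<in> A"; cases "u \<in> A") auto
  qed
  also have "(\<Sum>A\<in>Pow V. \<Sum>z\<in>V. \<Sum>u\<in>V. of_bool (z \<in> A) * (pexp E w (?f A) * v {z, u} * ?\<tau> u))
     = (\<Sum>z\<in>V. \<Sum>u\<in>V. (\<Sum>A\<in>Pow V. of_bool (z \<in> A) * pexp E w (?f A)) * v {z, u} * ?\<tau> u)"
    by (subst sum.swap, rule sum.cong[OF refl], subst sum.swap, rule sum.cong[OF refl])
      (simp add: sum_distrib_right mult.assoc)
  also have "\<dots> = (\<Sum>z\<in>V. \<Sum>u\<in>V. pexp E w (\<lambda>G. of_bool (conn G x z)) * v {z, u} * ?\<tau> u)"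
  proof (intro sum.cong refl arg_cong2[where f = "(*)"])
    fix z assume z: "z \<in> V"
    have "(\<Sum>A\<in>Pow V. of_bool (z \<in> A) * pexp E w (?f A)) = pexp E w (\<lambda>G. \<Sum>A\<in>Pow V. of_bool (z \<in> A) * ?f A G)"
      by (simp add: pexp_sum pexp_cmult)
    also have "\<dots> = pexp E w (\<lambda>G. of_bool (conn G x z))"
    proof (rule pexp_cong)
      fix G
      have "(\<Sum>A\<in>Pow V. of_bool (z \<in> A) * ?f A G) = (\<Sum>A\<in>Pow V. if A = ?C G then of_bool (z \<in> A) else 0)"
        by (rule sum.cong) auto
      also have "\<dots> = of_bool (conn G x z)" using V z by (subst sum.delta) auto
      finally show "(\<Sum>A\<in>Pow V. of_bool (z \<in> A) * ?f A G) = of_bool (conn G x z)" .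
    qed
    finally show "(\<Sum>A\<in>Pow V. of_bool (z \<in> A) * pexp E w (?f A)) = pexp E w (\<lambda>G. of_bool (conn G x z))" .
  qed
  finally show ?thesis .
qed

section \<open>Without a giant cluster, sprinkling makes the second moment explode\<close>

text \<open>Equivalently, the sum over all clusters of the squared number of their points in
  \<open>L\<close>; its expectation is the sum of the two-point function over \<open>L\<close> times
  \<open>L\<close>.\<close>

definition ssq :: "'a set set \<Rightarrow> 'a set \<Rightarrow> real" where
  "ssq G L = (\<Sum>x\<in>L. real (cl G L x))"

lemma ssq_mono: "finite L \<Longrightarrow> G \<subseteq> \<eta> \<Longrightarrow> ssq G L \<le> ssq \<eta> L"
  unfolding ssq_def by (intro sum_mono of_nat_mono cl_mono)

lemma ssq_ge_card: "finite L \<Longrightarrow> real (card L) \<le> ssq G L"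
  using sum_bounded_below[of L 1 "\<lambda>x. real (cl G L x)"] cl_pos[of L _ G] by (force simp: ssq_def)

lemma ssq_le: "finite L \<Longrightarrow> ssq G L \<le> real (card L) ^ 2"
  using sum_bounded_above[of L "\<lambda>x. real (cl G L x)" "real (card L)"] cl_le_card[of L G]
  by (simp add: ssq_def power2_eq_square)

lemma ssq_conn: "finite L \<Longrightarrow> ssq G L = (\<Sum>x\<in>L. \<Sum>y\<in>L. of_bool (conn G x y))"
  unfolding ssq_def by (simp add: cl_sum)

lemma mx_sq_le_ssq:
  assumes "finite L" "L \<noteq> {}"
  shows "real (mx G L) ^ 2 \<le> ssq G L"
proof -
  obtain x where x: "x \<in> L" "cl G L x = mx G L" using mx_attained[OF assms] .
  let ?C = "{y\<in>L. conn G x y}"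
  have "real (mx G L) ^ 2 = (\<Sum>y\<in>?C. real (cl G L x))"
    using x(2) by (simp add: cl_def power2_eq_square)
  also have "\<dots> = (\<Sum>y\<in>?C. real (cl G L y))"
    by (rule sum.cong) (auto dest: cl_conn[where L = L])
  also have "\<dots> \<le> ssq G L" unfolding ssq_def by (rule sum_mono2) (use assms in auto)
  finally show ?thesis .
qed

text \<open>The new edge connects every point of the one cluster with every point of the other, in
  both orders.\<close>

lemma ssq_insert:
  assumes L: "finite L" and zu: "\<not> conn G z u"
  shows "ssq G L + 2 * (real (cl G L z) * real (cl G L u)) \<le> ssq (insert {z, u} G) L"
proof -
  let ?o = "insert {z, u} G"
  let ?b = "\<lambda>P. of_bool P :: real"
  have pt: "?b (conn G x y) + (?b (conn G z x) * ?b (conn G u y) + ?b (conn G u x) * ?b (conn G z y))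
      \<le> ?b (conn ?o x y)" for x y
  proof -
    have m: "conn G a b \<Longrightarrow> conn ?o a b" for a b by (rule conn_mono[of G]) auto
    have e: "conn ?o z u" by (rule conn_edge) simp
    have 1: "conn G z x \<Longrightarrow> conn G u y \<Longrightarrow> conn ?o x y" "conn G u x \<Longrightarrow> conn G z y \<Longrightarrow> conn ?o x y"
      using m e conn_sym conn_trans by metis+
    have 2: "conn G x y \<Longrightarrow> conn G z x \<Longrightarrow> \<not> conn G u y" "conn G x y \<Longrightarrow> conn G u x \<Longrightarrow> \<not> conn G z y"
      "conn G z x \<Longrightarrow> \<not> conn G u x"
      using zu conn_sym conn_trans by metis+
    show ?thesis
      using 1 2 m[of x y] by (cases "conn G x y"; cases "conn G z x"; cases "conn G u x"; cases "conn G u y"; cases "conn G z y") auto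
  qed
  have "ssq G L + 2 * (real (cl G L z) * real (cl G L u))
     = (\<Sum>x\<in>L. \<Sum>y\<in>L. ?b (conn G x y) + (?b (conn G z x) * ?b (conn G u y) + ?b (conn G u x) * ?b (conn G z y)))"
    unfolding sum.distrib sum_product[symmetric] cl_sum[OF L, symmetric] ssq_def[symmetric] by simp
  also have "\<dots> \<le> ssq ?o L"
    unfolding ssq_conn[OF L] by (intro sum_mono pt)
  finally show ?thesis .
qed

text \<open>By \<open>ssq_insert\<close>, a lower bound for the derivative of \<open>ssq\<close>
  when all pairs in \<open>L\<close> receive new edges at unit rate; ordered pairs absorb the factor
  2.\<close>

definition merge_rate :: "'a set set \<Rightarrow> 'a set \<Rightarrow> real" where
  "merge_rate G L = (\<Sum>z\<in>L. \<Sum>u\<in>L. of_bool (\<not> conn G z u) * (real (cl G L z) * real (cl G L u)))"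

text \<open>Without the restriction to unconnected pairs the sum is the square of
  \<open>ssq\<close>. The connected pairs contribute the sum of cubes \<open>cl ^ 3\<close>, at most
  \<open>mx\<^sup>2 * ssq\<close>, which is split by the inequality of the means so that only the
  fourth power of \<open>mx\<close> is lost.\<close>

lemma merge_rate_ge:
  assumes L: "finite L"
  shows "(ssq G L)\<^sup>2 / 2 - real (mx G L) ^ 4 / 2 \<le> merge_rate G L"
proof -
  let ?c = "\<lambda>x. real (cl G L x)"
  have "(\<Sum>u\<in>L. of_bool (conn G z u) * (?c z * ?c u)) = ?c z ^ 3" for z
  proof -
    have "(\<Sum>u\<in>L. of_bool (conn G z u) * (?c z * ?c u)) = (\<Sum>u\<in>L. of_bool (conn G z u) * (?c z * ?c z))"
      by (rule sum.cong) (auto dest: cl_conn[where L = L])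
    also have "\<dots> = ?c z ^ 3" unfolding sum_distrib_right[symmetric] cl_sum[OF L, symmetric]
      by (simp add: power3_eq_cube)
    finally show ?thesis .
  qed
  then have "(\<Sum>z\<in>L. \<Sum>u\<in>L. of_bool (conn G z u) * (?c z * ?c u)) = (\<Sum>z\<in>L. ?c z ^ 3)" by simp
  also have "\<dots> \<le> (\<Sum>z\<in>L. real (mx G L) ^ 2 * ?c z)"
  proof (rule sum_mono)
    fix z
    have "?c z ^ 2 \<le> real (mx G L) ^ 2" using cl_le_mx[OF L, of G z] by (intro power_mono) auto
    then show "?c z ^ 3 \<le> real (mx G L) ^ 2 * ?c z"
      using mult_right_mono[of "?c z ^ 2" "real (mx G L) ^ 2" "?c z"] by (simp add: power3_eq_cube power2_eq_square)
  qed
  also have "\<dots> = real (mx G L) ^ 2 * ssq G L" by (simp add: ssq_def sum_distrib_left)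
  also have "\<dots> \<le> (ssq G L)\<^sup>2 / 2 + real (mx G L) ^ 4 / 2"
    using zero_le_power2[of "real (mx G L) ^ 2 - ssq G L"]
    by (simp add: power2_diff power_mult[symmetric] field_simps)
  finally have 1: "(\<Sum>z\<in>L. \<Sum>u\<in>L. of_bool (conn G z u) * (?c z * ?c u)) \<le> (ssq G L)\<^sup>2 / 2 + real (mx G L) ^ 4 / 2" .
  have "(\<Sum>z\<in>L. \<Sum>u\<in>L. of_bool (conn G z u) * (?c z * ?c u)) + merge_rate G L = (\<Sum>z\<in>L. \<Sum>u\<in>L. ?c z * ?c u)"
    unfolding merge_rate_def sum.distrib[symmetric] by (intro sum.cong) auto
  also have "\<dots> = (ssq G L)\<^sup>2" by (simp add: ssq_def sum_product power2_eq_square)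
  finally show ?thesis using 1 by (simp add: field_simps)
qed

lemma merge_rate_le_sum_pairs:
  assumes L: "finite L"
  shows "merge_rate G L \<le> (\<Sum>e\<in>pairs_in L. ssq (insert e G) L - ssq G L)"
proof -
  let ?A = "{p\<in>L \<times> L. fst p \<noteq> snd p}"
  let ?g = "\<lambda>p. of_bool (\<not> conn G (fst p) (snd p)) * (real (cl G L (fst p)) * real (cl G L (snd p)))"
  let ?d = "\<lambda>e. ssq (insert e G) L - ssq G L"
  have d0: "0 \<le> ?d e" for e using ssq_mono[OF L, of G "insert e G"] by auto
  have "merge_rate G L = (\<Sum>p\<in>L \<times> L. ?g p)"
    unfolding merge_rate_def by (simp add: sum.cartesian_product case_prod_beta)
  also have "\<dots> = (\<Sum>p\<in>?A. ?g p)" by (rule sum.mono_neutral_right) (use L in auto)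
  also have "\<dots> = (\<Sum>e\<in>pairs_in L. \<Sum>p | p \<in> ?A \<and> {fst p, snd p} = e. ?g p)"
    by (rule sum.group[symmetric]) (use L in auto)
  also have "\<dots> \<le> (\<Sum>e\<in>pairs_in L. ?d e)"
  proof (rule sum_mono)
    fix e assume "e \<in> pairs_in L"
    then obtain a b where e: "e = {a, b}" "a \<noteq> b" by (auto simp: pairs_in_def card_2_iff)
    let ?B = "{p. p \<in> ?A \<and> {fst p, snd p} = e}"
    have sub: "?B \<subseteq> {(a, b), (b, a)}" using e by (auto simp: doubleton_eq_iff)
    then have card: "card ?B \<le> 2" using card_mono[OF _ sub] e(2) by simp
    have "?g p \<le> ?d e / 2" if "p \<in> ?B" for p
      using ssq_insert[OF L, of G "fst p" "snd p"] that d0[of e] by (cases "conn G (fst p) (snd p)") auto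
    then have "(\<Sum>p\<in>?B. ?g p) \<le> of_nat (card ?B) * (?d e / 2)" by (rule sum_bounded_above)
    also have "\<dots> \<le> 2 * (?d e / 2)" using card d0[of e] by (intro mult_right_mono) auto
    finally show "(\<Sum>p\<in>?B. ?g p) \<le> ?d e" by simp
  qed
  finally show ?thesis .
qed

definition sprinkle :: "real \<Rightarrow> 'a set \<Rightarrow> 'a set \<Rightarrow> real" where
  "sprinkle q L e = (if e \<in> pairs_in L then q else 0)"

lemma sprinkle_nonneg [simp]: "0 \<le> q \<Longrightarrow> 0 \<le> sprinkle q L e"
  by (simp add: sprinkle_def)

lemma pexp_single_edge:
  assumes E: "finite E" "pairs_in L \<subseteq> E" and h: "0 \<le> h" and e: "e \<in> pairs_in L"
  shows "(1 - exp (- h)) * exp (- (h * real (card (pairs_in L))))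
    \<le> pexp E (sprinkle h L) (\<lambda>\<eta>. of_bool (\<eta> \<inter> pairs_in L = {e}))"
proof -
  let ?P = "pairs_in L" and ?v = "sprinkle h L"
  define E' where "E' = E - {e}"
  have E': "finite E'" "e \<notin> E'" "E = insert e E'" using E e by (auto simp: E'_def)
  have "(\<Sum>f\<in>E' \<inter> (?P - {e}). ?v f) \<le> (\<Sum>f\<in>?P. h)"
  proof -
    have "(\<Sum>f\<in>E' \<inter> (?P - {e}). ?v f) = (\<Sum>f\<in>E' \<inter> (?P - {e}). h)"
      by (rule sum.cong) (auto simp: sprinkle_def)
    also have "\<dots> \<le> (\<Sum>f\<in>?P. h)" by (rule sum_mono2) (use finite_subset[OF E(2,1)] h in auto)
    finally show ?thesis .
  qed
  then have 1: "exp (- (h * real (card ?P))) \<le> pexp E' ?v (\<lambda>\<eta>. of_bool (\<eta> \<inter> (?P - {e}) = {}))"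
    unfolding pexp_disjnt[OF E'(1)] by (simp add: mult.commute)
  have "pexp E ?v (\<lambda>\<eta>. of_bool (\<eta> \<inter> ?P = {e}))
     = exp (- ?v e) * pexp E' ?v (\<lambda>\<eta>. of_bool (\<eta> \<inter> ?P = {e})) + (1 - exp (- ?v e)) * pexp E' ?v (\<lambda>\<eta>. of_bool (insert e \<eta> \<inter> ?P = {e}))"
    unfolding E'(3) by (rule pexp_insert[OF E'(1,2)])
  also have "pexp E' ?v (\<lambda>\<eta>. of_bool (insert e \<eta> \<inter> ?P = {e})) = pexp E' ?v (\<lambda>\<eta>. of_bool (\<eta> \<inter> (?P - {e}) = {}))"
    by (rule pexp_cong) (use e E' in auto)
  also have "?v e = h" using e by (simp add: sprinkle_def)
  finally have eq: "pexp E ?v (\<lambda>\<eta>. of_bool (\<eta> \<inter> ?P = {e})) = exp (- h) * pexp E' ?v (\<lambda>\<eta>. of_bool (\<eta> \<inter> ?P = {e}))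
    + (1 - exp (- h)) * pexp E' ?v (\<lambda>\<eta>. of_bool (\<eta> \<inter> (?P - {e}) = {}))" .
  have "0 \<le> exp (- h) * pexp E' ?v (\<lambda>\<eta>. of_bool (\<eta> \<inter> ?P = {e}))"
    using h by (intro mult_nonneg_nonneg pexp_nonneg) auto
  moreover have "(1 - exp (- h)) * exp (- (h * real (card ?P))) \<le> (1 - exp (- h)) * pexp E' ?v (\<lambda>\<eta>. of_bool (\<eta> \<inter> (?P - {e}) = {}))"
    by (intro mult_left_mono 1) (use h in auto)
  ultimately show ?thesis unfolding eq by linarith
qed

text \<open>Only sprinklings with exactly one new pair in \<open>L\<close> are exploited, and all
  others are covered by monotonicity. For small \<open>h\<close> this loses only a second-order
  term.\<close>

lemma pexp_ssq_increment:
  assumes E: "finite E" "pairs_in L \<subseteq> E" and h: "0 \<le> h" and w: "\<And>e. 0 \<le> w e" and L: "finite L"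
  shows "pexp E w (\<lambda>G. ssq G L) + (1 - exp (- h)) * exp (- (h * real (card (pairs_in L)))) * pexp E w (\<lambda>G. merge_rate G L)
     \<le> pexp E (\<lambda>e. w e + sprinkle h L e) (\<lambda>G. ssq G L)"
proof -
  let ?P = "pairs_in L" and ?c = "(1 - exp (- h)) * exp (- (h * real (card (pairs_in L))))"
  have fP: "finite ?P" using finite_subset[OF E(2,1)] .
  have main: "ssq G L + ?c * merge_rate G L \<le> pexp E (sprinkle h L) (\<lambda>\<eta>. ssq (G \<union> \<eta>) L)" for G
  proof -
    let ?d = "\<lambda>e. ssq (insert e G) L - ssq G L"
    have d0: "0 \<le> ?d e" for e using ssq_mono[OF L, of G "insert e G"] by auto
    have pt: "ssq G L + (\<Sum>e\<in>?P. of_bool (\<eta> \<inter> ?P = {e}) * ?d e) \<le> ssq (G \<union> \<eta>) L" for \<eta>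
    proof (cases "\<exists>e\<in>?P. \<eta> \<inter> ?P = {e}")
      case True
      then obtain e where e: "e \<in> ?P" "\<eta> \<inter> ?P = {e}" by blast
      have "(\<Sum>f\<in>?P. of_bool (\<eta> \<inter> ?P = {f}) * ?d f) = (\<Sum>f\<in>?P. if f = e then ?d f else 0)"
        by (rule sum.cong) (use e in auto)
      also have "\<dots> = ?d e" using e fP by (simp add: sum.delta)
      finally have "(\<Sum>f\<in>?P. of_bool (\<eta> \<inter> ?P = {f}) * ?d f) = ?d e" .
      moreover have "ssq (insert e G) L \<le> ssq (G \<union> \<eta>) L" by (rule ssq_mono[OF L]) (use e in auto)
      ultimately show ?thesis by linarith
    next
      case False
      then have "(\<Sum>e\<in>?P. of_bool (\<eta> \<inter> ?P = {e}) * ?d e) = 0" by (intro sum.neutral) auto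
      then show ?thesis using ssq_mono[OF L, of G "G \<union> \<eta>"] by auto
    qed
    have c0: "0 \<le> ?c" using h by simp
    have "ssq G L + ?c * merge_rate G L \<le> ssq G L + ?c * (\<Sum>e\<in>?P. ?d e)"
      by (intro add_left_mono mult_left_mono merge_rate_le_sum_pairs L c0)
    also have "\<dots> = ssq G L + (\<Sum>e\<in>?P. ?c * ?d e)" by (simp add: sum_distrib_left)
    also have "\<dots> \<le> ssq G L + (\<Sum>e\<in>?P. pexp E (sprinkle h L) (\<lambda>\<eta>. of_bool (\<eta> \<inter> ?P = {e})) * ?d e)"
      by (intro add_left_mono sum_mono mult_right_mono d0 pexp_single_edge E h)
    also have "\<dots> = pexp E (sprinkle h L) (\<lambda>\<eta>. ssq G L + (\<Sum>e\<in>?P. of_bool (\<eta> \<inter> ?P = {e}) * ?d e))"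
      by (simp add: pexp_add pexp_sum pexp_multc pexp_const[OF E(1)])
    also have "\<dots> \<le> pexp E (sprinkle h L) (\<lambda>\<eta>. ssq (G \<union> \<eta>) L)"
      using h by (intro pexp_mono pt) auto
    finally show ?thesis .
  qed
  have "pexp E w (\<lambda>G. ssq G L) + ?c * pexp E w (\<lambda>G. merge_rate G L) = pexp E w (\<lambda>G. ssq G L + ?c * merge_rate G L)"
    by (simp only: pexp_add pexp_cmult)
  also have "\<dots> \<le> pexp E w (\<lambda>G. pexp E (sprinkle h L) (\<lambda>\<eta>. ssq (G \<union> \<eta>) L))"
    by (intro pexp_mono w main)
  finally show ?thesis by (simp only: pexp_union[OF E(1)])
qed

text \<open>Discrete form of (1/F)' \<le> -k for F' \<ge> k F^2. The crude bound \<open>B\<close> on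
  \<open>F\<close> makes the decrement the same at every step, and its effect disappears as the step
  size tends to 0.\<close>

lemma inverse_step:
  fixes F F' k B :: real
  assumes "0 < F" "F \<le> B" "0 \<le> k" "F + k * F\<^sup>2 \<le> F'"
  shows "1 / F' \<le> 1 / F - k / (1 + k * B)"
proof -
  have B: "0 < 1 + k * F" "0 < 1 + k * B" using assms by (auto intro!: add_pos_nonneg)
  have 0: "0 < F + k * F\<^sup>2" using assms by (intro add_pos_nonneg) auto
  have "1 / F' \<le> 1 / (F + k * F\<^sup>2)"
    by (intro divide_left_mono mult_pos_pos less_le_trans[OF 0 assms(4)] 0 assms) simp
  also have "F + k * F\<^sup>2 = F * (1 + k * F)" by (simp add: algebra_simps power2_eq_square)
  also have "1 / (F * (1 + k * F)) = 1 / F - k / (1 + k * F)"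
    using assms(1) B by (simp add: field_simps)
  also have "\<dots> \<le> 1 / F - k / (1 + k * B)"
    using assms B by (intro diff_left_mono divide_left_mono mult_pos_pos) (auto intro: mult_left_mono)
  finally show ?thesis .
qed

text \<open>The second moment \<open>F\<close> obeys \<open>F' \<ge> F\<^sup>2 / 4\<close> along the sprinkling as long as the largest
  cluster does not dominate, and would be infinite at time \<open>4 / F\<close>. The differential inequality is
  replaced by small increments.\<close>
lemma pexp_ssq_le:
  assumes E: "finite E" "pairs_in L \<subseteq> E" and w: "\<And>e. 0 \<le> w e" and L: "finite L" "L \<noteq> {}" and q: "0 < q"
    and a: "\<And>t. 0 \<le> t \<Longrightarrow> t \<le> q \<Longrightarrow> pexp E (\<lambda>e. w e + sprinkle t L e) (\<lambda>G. real (mx G L) ^ 4) \<le> a"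
    and big: "2 * a \<le> (pexp E w (\<lambda>G. ssq G L))\<^sup>2"
  shows "pexp E w (\<lambda>G. ssq G L) \<le> 4 / q"
proof -
  define F where "F t = pexp E (\<lambda>e. w e + sprinkle t L e) (\<lambda>G. ssq G L)" for t
  have F0: "F 0 = pexp E w (\<lambda>G. ssq G L)" by (simp add: F_def sprinkle_def)
  define B where "B = real (card L) ^ 2"
  define M where "M = real (card (pairs_in L))"
  have wt: "0 \<le> w e + sprinkle t L e" if "0 \<le> t" for e t using w that by simp
  have cL: "1 \<le> real (card L)" using L by (simp add: Suc_le_eq card_gt_0_iff)
  have Fpos: "0 < F t" if "0 \<le> t" for t
  proof -
    have "1 \<le> pexp E (\<lambda>e. w e + sprinkle t L e) (\<lambda>G. 1)" by (simp add: pexp_const[OF E(1)])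
    also have "\<dots> \<le> F t" unfolding F_def
      using order_trans[OF cL ssq_ge_card[OF L(1)]] that by (intro pexp_mono wt) auto
    finally show ?thesis by linarith
  qed
  have FB: "F t \<le> B" if "0 \<le> t" for t
  proof -
    have "F t \<le> pexp E (\<lambda>e. w e + sprinkle t L e) (\<lambda>G. B)"
      unfolding F_def B_def using ssq_le[OF L(1)] that by (intro pexp_mono wt) auto
    then show ?thesis by (simp add: pexp_const[OF E(1)])
  qed
  have Fge: "F 0 \<le> F t" if "0 \<le> t" for t
    unfolding F_def using that w ssq_mono[OF L(1)]
    by (intro pexp_mono_weight E) (auto simp: sprinkle_def mono_def)
  have step: "1 / F (t + h) \<le> 1 / F t - ((1 - exp (- h)) * exp (- (h * M)) / 4) / (1 + ((1 - exp (- h)) * exp (- (h * M)) / 4) * B)"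
    if t: "0 \<le> t" "t \<le> q" and h: "0 \<le> h" for t h
  proof (rule inverse_step)
    let ?c = "(1 - exp (- h)) * exp (- (h * M))"
    let ?w = "\<lambda>e. w e + sprinkle t L e"
    have c0: "0 \<le> ?c" using h by simp
    show "0 < F t" "F t \<le> B" using Fpos FB t by auto
    show "0 \<le> ?c / 4" using c0 by simp
    have "2 * a \<le> (F t)\<^sup>2"
      using big Fge[OF t(1)] Fpos[of 0] unfolding F0[symmetric] by (intro order_trans[OF big[folded F0]] power_mono) auto
    have "(F t)\<^sup>2 \<le> pexp E ?w (\<lambda>G. (ssq G L)\<^sup>2)" unfolding F_def
      by (rule pexp_square_ge) (use E wt t in auto)
    \<comment> \<open>The half gained from the square of \<open>ssq\<close> pays for the fourth
      moment of \<open>mx\<close>, which is at most half of the square of \<open>F t\<close>; one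
      quarter is left.\<close>
    then have "(F t)\<^sup>2 / 4 \<le> pexp E ?w (\<lambda>G. (ssq G L)\<^sup>2) / 2 - pexp E ?w (\<lambda>G. real (mx G L) ^ 4) / 2"
      using \<open>2 * a \<le> (F t)\<^sup>2\<close> a[OF t] by linarith
    also have "\<dots> = pexp E ?w (\<lambda>G. (1 / 2) * (ssq G L)\<^sup>2 - (1 / 2) * real (mx G L) ^ 4)"
      unfolding pexp_diff pexp_cmult by simp
    also have "\<dots> \<le> pexp E ?w (\<lambda>G. merge_rate G L)"
      by (intro pexp_mono wt t) (use merge_rate_ge[OF L(1)] in simp)
    finally have "F t + ?c * ((F t)\<^sup>2 / 4) \<le> F t + ?c * pexp E ?w (\<lambda>G. merge_rate G L)"
      by (intro add_left_mono mult_left_mono c0)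
    also have "\<dots> \<le> pexp E (\<lambda>e. ?w e + sprinkle h L e) (\<lambda>G. ssq G L)"
      unfolding F_def M_def by (intro pexp_ssq_increment E h wt t L)
    also have "(\<lambda>e. ?w e + sprinkle h L e) = (\<lambda>e. w e + sprinkle (t + h) L e)"
      by (auto simp: sprinkle_def)
    finally show "F t + ?c / 4 * (F t)\<^sup>2 \<le> F (t + h)" by (simp add: F_def)
  qed
  define c where "c h = ((1 - exp (- h)) * exp (- (h * M)) / 4) / (1 + ((1 - exp (- h)) * exp (- (h * M)) / 4) * B)" for h
  have iter: "1 / F (real i * h) \<le> 1 / F 0 - real i * c h" if "0 \<le> h" "real i * h \<le> q + h" for i h
    using that(2)
  proof (induction i)
    case (Suc i)
    have le: "real i * h \<le> q" using Suc.prems by (simp add: algebra_simps)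
    have "1 / F (real i * h + h) \<le> 1 / F (real i * h) - c h"
      unfolding c_def using that le by (intro step) auto
    also have "\<dots> \<le> 1 / F 0 - real (Suc i) * c h" using Suc.IH le that by (simp add: algebra_simps)
    finally show ?case by (simp add: algebra_simps)
  qed simp
  have bound: "real n * c (q / real n) \<le> 1 / F 0" if "0 < n" for n
  proof -
    have "1 / F (real n * (q / real n)) \<le> 1 / F 0 - real n * c (q / real n)"
      using q that by (intro iter) auto
    moreover have "0 < 1 / F (real n * (q / real n))" using Fpos[of "real n * (q / real n)"] q by simp
    ultimately show ?thesis by linarith
  qed
  \<comment> \<open>Only the first order \<open>h / 4\<close> matters: after n steps of size
    \<open>q / n\<close> the total decrement of \<open>1 / F\<close> tends to \<open>q / 4\<close>,
    whatever the volume-dependent constants \<open>M\<close> and \<open>B\<close> are.\<close>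
  have c_ge: "h / 4 * exp (- (h * (1 + M + B / 4))) \<le> c h" if h: "0 \<le> h" for h
  proof -
    let ?k = "(1 - exp (- h)) * exp (- (h * M)) / 4"
    have B0: "0 \<le> B" and M0: "0 \<le> M" by (auto simp: B_def M_def)
    have "(1 + h) * exp (- h) \<le> exp h * exp (- h)" by (intro mult_right_mono exp_ge_add_one_self) auto
    then have "h * exp (- h) \<le> 1 - exp (- h)" by (simp add: exp_minus field_simps)
    then have k1: "h * exp (- h) * exp (- (h * M)) / 4 \<le> ?k" by (intro divide_right_mono mult_right_mono) auto
    have "1 - exp (- h) \<le> h" using exp_ge_add_one_self[of "- h"] by simp
    then have "(1 - exp (- h)) * exp (- (h * M)) \<le> h * 1" using h M0 by (intro mult_mono) auto
    then have k2: "?k \<le> h / 4" by simp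
    have k0: "0 \<le> ?k" using h by simp
    have le: "1 + ?k * B \<le> exp (h / 4 * B)"
      using exp_ge_add_one_self[of "h / 4 * B"] mult_right_mono[OF k2 B0] by linarith
    have "h / 4 * exp (- (h * (1 + M + B / 4))) = h * exp (- h) * exp (- (h * M)) / 4 * exp (- (h / 4 * B))"
      by (simp add: mult_exp_exp algebra_simps)
    also have "\<dots> \<le> ?k * exp (- (h / 4 * B))" by (intro mult_right_mono k1) auto
    also have "\<dots> = ?k / exp (h / 4 * B)" by (simp add: exp_minus field_simps)
    also have "\<dots> \<le> c h" unfolding c_def
      using le k0 B0 by (intro divide_left_mono mult_pos_pos) (auto intro!: add_pos_nonneg)
    finally show ?thesis .
  qed
  have "(\<lambda>n. q / 4 * exp (- (q / real n * (1 + M + B / 4)))) \<longlonglongrightarrow> q / 4 * exp (- (0 * (1 + M + B / 4)))"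
    by (intro tendsto_intros lim_const_over_n)
  then have "(\<lambda>n. q / 4 * exp (- (q / real n * (1 + M + B / 4)))) \<longlonglongrightarrow> q / 4" by simp
  moreover have "q / 4 * exp (- (q / real n * (1 + M + B / 4))) \<le> 1 / F 0" if "0 < n" for n
    using bound[OF that] mult_left_mono[OF c_ge[of "q / real n"], of "real n"] q that by (simp add: field_simps)
  ultimately have "q / 4 \<le> 1 / F 0"
    by (intro tendsto_upperbound[where F = sequentially]) (auto intro: eventually_sequentiallyI[of 1])
  then show ?thesis using Fpos[of 0] q unfolding F0[symmetric] by (simp add: field_simps)
qed

section \<open>Infinite volume\<close>

definition fin_edges :: "'a set set set" where
  "fin_edges = {E. finite E \<and> E \<subseteq> pairs}"

text \<open>For a bounded increasing \<open>f\<close> this is the infinite-volume expectation as a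
  monotone limit; estimates are proved for finite edge sets and then passed to the supremum.\<close>

definition EE :: "('a set \<Rightarrow> real) \<Rightarrow> ('a set set \<Rightarrow> real) \<Rightarrow> real" where
  "EE w f = (SUP E\<in>fin_edges. pexp E w f)"

lemma fin_edgesD: "E \<in> fin_edges \<Longrightarrow> finite E" "E \<in> fin_edges \<Longrightarrow> E \<subseteq> pairs"
  by (auto simp: fin_edges_def)

lemma fin_edges_empty [simp]: "{} \<in> fin_edges"
  by (simp add: fin_edges_def)

lemma fin_edges_Un [simp]: "E \<in> fin_edges \<Longrightarrow> F \<in> fin_edges \<Longrightarrow> E \<union> F \<in> fin_edges"
  by (simp add: fin_edges_def)

lemma fin_edges_pairs_in [simp]: "finite L \<Longrightarrow> pairs_in L \<in> fin_edges"
  by (auto simp: fin_edges_def pairs_def pairs_in_def finite_subset[of _ "Pow L"])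

lemma pexp_le_bound:
  assumes "finite E" "\<And>e. 0 \<le> w e" "\<And>G. f G \<le> B"
  shows "pexp E w f \<le> B"
  using pexp_mono[of w E f "\<lambda>_. B"] assms by (simp add: pexp_const)

lemma pexp_le_EE:
  assumes "E \<in> fin_edges" "\<And>e. 0 \<le> w e" "\<And>G. f G \<le> B"
  shows "pexp E w f \<le> EE w f"
  unfolding EE_def
  by (rule cSUP_upper[OF assms(1) bdd_aboveI2[of _ _ B]]) (use assms in \<open>auto intro: pexp_le_bound dest: fin_edgesD\<close>)

lemma EE_least:
  assumes "\<And>E. E \<in> fin_edges \<Longrightarrow> E\<^sub>0 \<subseteq> E \<Longrightarrow> pexp E w f \<le> C" "mono f" "E\<^sub>0 \<in> fin_edges" "\<And>e. 0 \<le> w e"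
  shows "EE w f \<le> C"
  unfolding EE_def
proof (rule cSUP_least)
  show "fin_edges \<noteq> {}" by (metis empty_iff fin_edges_empty)
  fix E :: "'a set set" assume E: "E \<in> fin_edges"
  have "pexp E w f \<le> pexp (E \<union> E\<^sub>0) w f"
    by (rule pexp_mono_set) (use assms E in \<open>auto dest: fin_edgesD\<close>)
  also have "\<dots> \<le> C" using assms E by auto
  finally show "pexp E w f \<le> C" .
qed

text \<open>Finite edge sets are directed, so for increasing functions a single one is nearly
  optimal for all finitely many indices at once.\<close>

lemma EE_sum_le:
  fixes f :: "'i \<Rightarrow> 'a set set \<Rightarrow> real"
  assumes I: "finite I" and f: "\<And>i. i \<in> I \<Longrightarrow> mono (f i)"
    and w: "\<And>i e. i \<in> I \<Longrightarrow> 0 \<le> w i e" and E0: "E\<^sub>0 \<in> fin_edges"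
    and le: "\<And>E. E \<in> fin_edges \<Longrightarrow> E\<^sub>0 \<subseteq> E \<Longrightarrow> (\<Sum>i\<in>I. pexp E (w i) (f i)) \<le> C"
  shows "(\<Sum>i\<in>I. EE (w i) (f i)) \<le> C"
proof (cases "I = {}")
  case True
  then show ?thesis using le[OF E0] by simp
next
  case False
  show ?thesis
  proof (rule field_le_epsilon)
    fix \<epsilon> :: real assume \<epsilon>: "0 < \<epsilon>"
    have "\<exists>E\<in>fin_edges. EE (w i) (f i) - \<epsilon> / card I < pexp E (w i) (f i)" for i
    proof (rule ccontr)
      assume "\<not> ?thesis"
      then have "pexp E (w i) (f i) \<le> EE (w i) (f i) - \<epsilon> / card I" if "E \<in> fin_edges" for E
        using that by (meson not_less)
      moreover have "fin_edges \<noteq> ({} :: 'a set set set)" using fin_edges_empty by blast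
      ultimately have "EE (w i) (f i) \<le> EE (w i) (f i) - \<epsilon> / card I"
        unfolding EE_def[of "w i" "f i"] by (intro cSUP_least) (auto simp: EE_def)
      then show False using \<epsilon> I False by (simp add: field_simps card_gt_0_iff)
    qed
    then obtain E where E: "\<And>i. E i \<in> fin_edges" "\<And>i. EE (w i) (f i) - \<epsilon> / card I < pexp (E i) (w i) (f i)"
      by metis
    define F where "F = E\<^sub>0 \<union> (\<Union>i\<in>I. E i)"
    have F: "F \<in> fin_edges" using E(1) E0 I by (auto simp: F_def fin_edges_def)
    have "(\<Sum>i\<in>I. EE (w i) (f i)) \<le> (\<Sum>i\<in>I. pexp F (w i) (f i) + \<epsilon> / card I)"
    proof (rule sum_mono)
      fix i assume i: "i \<in> I"
      have "pexp (E i) (w i) (f i) \<le> pexp F (w i) (f i)"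
        by (rule pexp_mono_set) (use i f w fin_edgesD(1)[OF F] in \<open>auto simp: F_def\<close>)
      then show "EE (w i) (f i) \<le> pexp F (w i) (f i) + \<epsilon> / card I" using E(2)[of i] by linarith
    qed
    also have "\<dots> = (\<Sum>i\<in>I. pexp F (w i) (f i)) + \<epsilon>" using I False by (simp add: sum.distrib)
    also have "\<dots> \<le> C + \<epsilon>" using le[OF F] by (simp add: F_def)
    finally show "(\<Sum>i\<in>I. EE (w i) (f i)) \<le> C + \<epsilon>" .
  qed
qed

lemma EE_mono_weight:
  assumes "mono f" "\<And>G. f G \<le> B" "\<And>e. 0 \<le> w e" "\<And>e. w e \<le> v e"
  shows "EE w f \<le> EE v f"
proof (rule EE_least[OF _ assms(1) fin_edges_empty assms(3)])
  fix E :: "'a set set" assume E: "E \<in> fin_edges"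
  have "pexp E w f \<le> pexp E v f" using E assms by (intro pexp_mono_weight) (auto dest: fin_edgesD)
  also have "\<dots> \<le> EE v f" using assms order_trans[OF assms(3,4)] by (intro pexp_le_EE[OF E]) auto
  finally show "pexp E w f \<le> EE v f" .
qed

lemma EE_bij:
  fixes t :: "'a \<Rightarrow> 'b"
  assumes "bij t"
  shows "EE w f = EE (\<lambda>e. w (t ` e)) (\<lambda>G. f ((`) t ` G))"
proof -
  have inj: "inj ((`) t)" by (auto simp: inj_def inj_image_eq_iff[OF bij_is_inj[OF assms]])
  have *: "(`) ((`) t) ` fin_edges = (fin_edges :: 'b set set set)"
  proof (intro equalityI subsetI)
    fix E :: "'b set set" assume "E \<in> (`) ((`) t) ` fin_edges"
    then show "E \<in> fin_edges" using assms
      by (auto simp: fin_edges_def pairs_def bij_def card_image inj_on_subset)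
  next
    fix E :: "'b set set" assume E: "E \<in> fin_edges"
    let ?s = "inv t"
    have "(`) ?s ` E \<in> fin_edges" using E bij_imp_bij_inv[OF assms]
      by (auto simp: fin_edges_def pairs_def bij_def card_image inj_on_subset)
    moreover have "E = (`) t ` (`) ?s ` E"
      using assms by (auto simp: image_image bij_def surj_f_inv_f)
    ultimately show "E \<in> (`) ((`) t) ` fin_edges" by blast
  qed
  have "EE w f = (SUP E\<in>fin_edges. pexp ((`) t ` E) w f)"
    unfolding EE_def by (subst *[symmetric]) (simp add: image_image)
  also have "\<dots> = EE (\<lambda>e. w (t ` e)) (\<lambda>G. f ((`) t ` G))"
    unfolding EE_def by (intro SUP_cong refl pexp_bij) (auto dest: fin_edgesD intro: inj_on_subset[OF inj])
  finally show ?thesis .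
qed

section \<open>Two-point function and expected largest cluster in infinite volume\<close>

definition tau :: "('a set \<Rightarrow> real) \<Rightarrow> 'a \<Rightarrow> 'a \<Rightarrow> real" where
  "tau w x y = EE w (\<lambda>G. of_bool (conn G x y))"

definition Emx :: "('a set \<Rightarrow> real) \<Rightarrow> 'a set \<Rightarrow> real" where
  "Emx w L = EE w (\<lambda>G. real (mx G L))"

lemma mono_of_conn: "mono (\<lambda>G. of_bool (conn G x y) :: real)"
  by (auto simp: mono_def intro: conn_mono)

lemma mono_real_mx: "finite L \<Longrightarrow> L \<noteq> {} \<Longrightarrow> mono (\<lambda>G. real (mx G L))"
  by (auto simp: mono_def intro: mx_mono)

lemma pexp_conn_le_tau: "E \<in> fin_edges \<Longrightarrow> (\<And>e. 0 \<le> w e) \<Longrightarrow> pexp E w (\<lambda>G. of_bool (conn G x y)) \<le> tau w x y"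
  unfolding tau_def by (rule pexp_le_EE[where B = 1]) auto

lemma pexp_mx_le_Emx:
  "E \<in> fin_edges \<Longrightarrow> (\<And>e. 0 \<le> w e) \<Longrightarrow> finite L \<Longrightarrow> L \<noteq> {} \<Longrightarrow> pexp E w (\<lambda>G. real (mx G L)) \<le> Emx w L"
  unfolding Emx_def by (rule pexp_le_EE[where B = "real (card L)"]) (auto intro: mx_le_card)

lemma tau_nonneg: "(\<And>e. 0 \<le> w e) \<Longrightarrow> 0 \<le> tau w x y"
  by (rule order_trans[OF _ pexp_conn_le_tau[of "{}"]]) auto

lemma tau_refl_ge: "(\<And>e. 0 \<le> w e) \<Longrightarrow> 1 \<le> tau w x x"
  by (rule order_trans[OF _ pexp_conn_le_tau[of "{}"]]) auto

lemma tau_mono: "(\<And>e. 0 \<le> w e) \<Longrightarrow> (\<And>e. w e \<le> v e) \<Longrightarrow> tau w x y \<le> tau v x y"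
  unfolding tau_def by (rule EE_mono_weight[where B = 1, OF mono_of_conn]) auto

lemma tau_sym: "tau w x y = tau w y x"
  unfolding tau_def by (subst conn_commute) rule

lemma Emx_mono: "finite L \<Longrightarrow> L \<noteq> {} \<Longrightarrow> (\<And>e. 0 \<le> w e) \<Longrightarrow> (\<And>e. w e \<le> v e) \<Longrightarrow> Emx w L \<le> Emx v L"
  unfolding Emx_def by (rule EE_mono_weight[where B = "real (card L)", OF mono_real_mx]) (auto intro: mx_le_card)

lemma Emx_ge_1: "finite L \<Longrightarrow> L \<noteq> {} \<Longrightarrow> (\<And>e. 0 \<le> w e) \<Longrightarrow> 1 \<le> Emx w L"
  using mx_pos[of L "{}"] by (intro order_trans[OF _ pexp_mx_le_Emx[of "{}"]]) auto

lemma conn_image: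
  assumes "bij t"
  shows "conn ((`) t ` G) (t x) (t y) \<longleftrightarrow> conn G x y"
proof -
  have edge: "{a, b} \<in> G \<Longrightarrow> {t a, t b} \<in> (`) t ` G" for t :: "'c \<Rightarrow> 'd" and G a b
    by (rule image_eqI[of _ _ "{a, b}"]) auto
  have 1: "conn ((`) t ` G) (t x) (t y)" if "conn G x y" for t :: "'c \<Rightarrow> 'd" and G x y
    using that
  proof (induction rule: conn_induct)
    case (step y z)
    from conn_trans[OF step.IH conn_edge[OF edge[OF step.hyps(3)]]] show ?case .
  qed simp
  have inv: "(`) (inv t) ` (`) t ` G = G" using assms by (simp add: image_image bij_def)
  have [simp]: "inv t (t z) = z" for z using assms by (simp add: bij_def)
  show ?thesis
  proof
    assume "conn ((`) t ` G) (t x) (t y)"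
    from 1[OF this, of "inv t"] show "conn G x y" unfolding inv by simp
  qed (rule 1)
qed

lemma mx_image:
  assumes "bij t"
  shows "mx ((`) t ` G) (t ` L) = mx G L"
proof -
  have "cl ((`) t ` G) (t ` L) (t x) = cl G L x" for x
  proof -
    have "{y \<in> t ` L. conn ((`) t ` G) (t x) y} = t ` {y \<in> L. conn G x y}"
      using conn_image[OF assms] by auto
    then show ?thesis unfolding cl_def by (simp add: card_image[OF inj_on_subset[OF bij_is_inj[OF assms] subset_UNIV]])
  qed
  then show ?thesis unfolding mx_def by (simp add: image_image)
qed

lemma tau_image: "bij t \<Longrightarrow> tau w (t x) (t y) = tau (\<lambda>e. w (t ` e)) x y"
  unfolding tau_def by (subst EE_bij[of t]) (auto simp: conn_image)

lemma Emx_image: "bij t \<Longrightarrow> Emx w (t ` L) = Emx (\<lambda>e. w (t ` e)) L"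
  unfolding Emx_def by (subst EE_bij[of t]) (auto simp: mx_image)

text \<open>The largest cluster alone contributes its square to \<open>ssq\<close>. This turns a
  cluster of positive density into a two-point function of positive average.\<close>

lemma Emx_sq_le:
  assumes w: "\<And>e. 0 \<le> w e" and L: "finite L" "L \<noteq> {}"
  shows "(Emx w L)\<^sup>2 \<le> (\<Sum>x\<in>L. \<Sum>y\<in>L. tau w x y)"
proof -
  let ?R = "\<Sum>x\<in>L. \<Sum>y\<in>L. tau w x y"
  have "Emx w L \<le> sqrt ?R"
    unfolding Emx_def
  proof (rule EE_least[OF _ mono_real_mx[OF L] fin_edges_empty w])
    fix E :: "'a set set" assume E: "E \<in> fin_edges"
    have "(pexp E w (\<lambda>G. real (mx G L)))\<^sup>2 \<le> pexp E w (\<lambda>G. (real (mx G L))\<^sup>2)"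
      by (rule pexp_square_ge[OF fin_edgesD(1)[OF E] w])
    also have "\<dots> \<le> pexp E w (\<lambda>G. ssq G L)"
      by (intro pexp_mono w mx_sq_le_ssq L)
    also have "\<dots> = (\<Sum>x\<in>L. \<Sum>y\<in>L. pexp E w (\<lambda>G. of_bool (conn G x y)))"
      by (simp add: ssq_conn[OF L(1)] pexp_sum)
    also have "\<dots> \<le> ?R" by (intro sum_mono pexp_conn_le_tau E w)
    finally show "pexp E w (\<lambda>G. real (mx G L)) \<le> sqrt ?R" by (rule real_le_rsqrt)
  qed
  moreover have "0 \<le> Emx w L" using Emx_ge_1[of L w] L w by force
  moreover have "0 \<le> ?R" by (intro sum_nonneg tau_nonneg w)
  ultimately show ?thesis using power_mono[of "Emx w L" "sqrt ?R" 2] by simp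
qed

lemma Emx_merge:
  assumes u: "\<And>e. 0 \<le> u e" "\<And>e. u e + sprinkle q L e \<le> v e" and q: "0 \<le> q" and s: "0 \<le> s"
    and I: "finite I" "\<And>i. i \<in> I \<Longrightarrow> finite (c i) \<and> c i \<noteq> {} \<and> c i \<subseteq> L"
      "\<And>i j. i \<in> I \<Longrightarrow> j \<in> I \<Longrightarrow> i \<noteq> j \<Longrightarrow> c i \<inter> c j = {}"
    and L: "finite L" "L \<noteq> {}"
    and y: "\<And>i. i \<in> I \<Longrightarrow> y \<le> Emx u (c i)"
    and \<delta>: "\<delta> = real (card I) ^ 2 * exp (- (q * s\<^sup>2))" "\<delta> < 1"
  shows "(1 - \<delta>) * (real (card I) * (y - s)) \<le> Emx v L"
proof -
  have v: "0 \<le> v e" for e using u[of e] q by (meson add_nonneg_nonneg order_trans sprinkle_nonneg)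
  have "(\<Sum>i\<in>I. EE u (\<lambda>G. real (mx G (c i)))) \<le> Emx v L / (1 - \<delta>) + real (card I) * s"
  proof (rule EE_sum_le[OF I(1)])
    show "mono (\<lambda>G. real (mx G (c i)))" if "i \<in> I" for i using I(2)[OF that] by (intro mono_real_mx) auto
    show "pairs_in L \<in> fin_edges" using L by simp
    fix E assume E: "E \<in> fin_edges" "pairs_in L \<subseteq> E"
    have "(1 - \<delta>) * (\<Sum>i\<in>I. pexp E u (\<lambda>G. real (mx G (c i))) - s)
        \<le> pexp E (\<lambda>e. u e + (if e \<in> pairs_in L then q else 0)) (\<lambda>G. real (mx G L))"
      by (rule pexp_merge) (use E u q s I L \<delta> in \<open>auto dest: fin_edgesD\<close>)
    also have "\<dots> \<le> pexp E v (\<lambda>G. real (mx G L))"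
      using u q by (intro pexp_mono_weight mono_real_mx L) (use E in \<open>auto simp: sprinkle_def dest: fin_edgesD\<close>)
    also have "\<dots> \<le> Emx v L" by (rule pexp_mx_le_Emx[OF E(1) v L])
    finally show "(\<Sum>i\<in>I. pexp E u (\<lambda>G. real (mx G (c i)))) \<le> Emx v L / (1 - \<delta>) + real (card I) * s"
      using \<delta>(2) by (simp add: sum_subtractf field_simps)
  qed (use u in auto)
  moreover have "real (card I) * y \<le> (\<Sum>i\<in>I. EE u (\<lambda>G. real (mx G (c i))))"
    using y unfolding Emx_def by (intro sum_bounded_below) auto
  ultimately have "real (card I) * (y - s) \<le> Emx v L / (1 - \<delta>)" by (simp add: algebra_simps)
  then show ?thesis using \<delta>(2) by (simp add: field_simps)
qed

text \<open>Markov's inequality and the fourth moment bound control the largest cluster throughout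
  the sprinkling by the same constant times Y = \<open>Z / sqrt q\<close>. Either the second moment
  is of order Y^2 already, or the largest cluster is negligible and the explosion argument bounds it
  by \<open>4 / q\<close>; both are of order \<open>1 / q\<close>.\<close>

lemma sum_tau_le_of_Emx:
  assumes w: "\<And>e. 0 \<le> w e" "\<And>e. w e + sprinkle q L e \<le> v e" and q: "0 < q"
    and L: "finite L" "L \<noteq> {}" and Z: "Emx v L \<le> Z / sqrt q"
  shows "(\<Sum>x\<in>L. \<Sum>y\<in>L. tau w x y) \<le> (2 * 163\<^sup>2 * Z\<^sup>2 + 4) / q"
proof -
  define Y where "Y = Z / sqrt q"
  \<comment> \<open>Markov's inequality at level \<open>162 * Y\<close> gives exactly the
    probability required by \<open>pexp_mx_fourth_moment\<close>; rounding up costs at most one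
    further \<open>Y\<close> because \<open>Y\<close> is at least 1.\<close>
  define m where "m = nat \<lceil>162 * Y\<rceil>"
  have v: "0 \<le> v e" for e using w[of e] q by (meson add_nonneg_nonneg less_imp_le order_trans sprinkle_nonneg)
  have Y1: "1 \<le> Y" using Emx_ge_1[of L v] L v Z unfolding Y_def by force
  have m: "162 * Y \<le> real m" "real m \<le> 163 * Y" "1 \<le> m"
  proof -
    show 1: "162 * Y \<le> real m" unfolding m_def by (rule real_nat_ceiling_ge)
    have "real m \<le> 162 * Y + 1" using Y1 of_int_ceiling_le_add_one[of "162 * Y"] by (simp add: m_def)
    then show "real m \<le> 163 * Y" using Y1 by linarith
    show "1 \<le> m" using 1 Y1 by linarith
  qed
  have fe: "pairs_in L \<in> fin_edges" using L by simp
  have le: "(\<Sum>p\<in>L \<times> L. pexp E w (\<lambda>G. of_bool (conn G (fst p) (snd p)))) \<le> (2 * 163\<^sup>2 * Z\<^sup>2 + 4) / q"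
    if E: "E \<in> fin_edges" "pairs_in L \<subseteq> E" for E
  proof -
    note fE = fin_edgesD(1)[OF E(1)]
    let ?a = "2 * (163 * Y) ^ 4"
    have a: "pexp E (\<lambda>e. w e + sprinkle t L e) (\<lambda>G. real (mx G L) ^ 4) \<le> ?a" if t: "0 \<le> t" "t \<le> q" for t
    proof -
      let ?w = "\<lambda>e. w e + sprinkle t L e"
      have w0: "0 \<le> ?w e" for e using w t by (simp add: add_nonneg_nonneg)
      have "pexp E ?w (\<lambda>G. real (mx G L)) \<le> pexp E v (\<lambda>G. real (mx G L))"
      proof (intro pexp_mono_weight fE w0 mono_real_mx L)
        show "?w e \<le> v e" for e using w(2)[of e] t by (auto simp: sprinkle_def split: if_splits)
      qed
      also have "\<dots> \<le> Emx v L" by (rule pexp_mx_le_Emx[OF E(1) v L])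
      finally have EY: "pexp E ?w (\<lambda>G. real (mx G L)) \<le> Y" using Z by (simp add: Y_def)
      have "real m * pexp E ?w (\<lambda>G. of_bool (m \<le> mx G L)) = pexp E ?w (\<lambda>G. real m * of_bool (m \<le> mx G L))"
        by (simp add: pexp_cmult)
      also have "\<dots> \<le> pexp E ?w (\<lambda>G. real (mx G L))"
        by (intro pexp_mono w0) auto
      also have "\<dots> \<le> real m * (1 / 162)" using EY m by simp
      finally have "pexp E ?w (\<lambda>G. of_bool (m \<le> mx G L)) \<le> 1 / 162"
        using m(3) by simp
      then have "pexp E ?w (\<lambda>G. real (mx G L) ^ 4) \<le> 2 * real m ^ 4"
        by (intro pexp_mx_fourth_moment fE w0 L m)
      also have "\<dots> \<le> ?a" using m by (intro mult_left_mono power_mono) auto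
      finally show ?thesis .
    qed
    let ?F = "pexp E w (\<lambda>G. ssq G L)"
    have "?F \<le> (2 * 163\<^sup>2 * Z\<^sup>2 + 4) / q"
    proof (cases "2 * ?a \<le> ?F\<^sup>2")
      case True
      have "?F \<le> 4 / q" by (rule pexp_ssq_le[OF fE E(2) w(1) L q a True]) auto
      also have "\<dots> \<le> (2 * 163\<^sup>2 * Z\<^sup>2 + 4) / q" using q by (intro divide_right_mono) auto
      finally show ?thesis .
    next
      case False
      have "2 * ?a = (2 * (163 * Y)\<^sup>2)\<^sup>2" by (simp add: power_mult_distrib power_mult[symmetric])
      then have "?F\<^sup>2 \<le> (2 * (163 * Y)\<^sup>2)\<^sup>2" using False by linarith
      then have "?F \<le> 2 * (163 * Y)\<^sup>2" by (rule power2_le_imp_le) auto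
      also have "\<dots> = 2 * 163\<^sup>2 * Z\<^sup>2 / q" using q by (simp add: Y_def power_mult_distrib power_divide)
      also have "\<dots> \<le> (2 * 163\<^sup>2 * Z\<^sup>2 + 4) / q" using q by (intro divide_right_mono) auto
      finally show ?thesis .
    qed
    moreover have "?F = (\<Sum>p\<in>L \<times> L. pexp E w (\<lambda>G. of_bool (conn G (fst p) (snd p))))"
      by (simp add: ssq_conn[OF L(1)] pexp_sum sum.cartesian_product case_prod_beta)
    ultimately show ?thesis by simp
  qed
  have "(\<Sum>p\<in>L \<times> L. EE w (\<lambda>G. of_bool (conn G (fst p) (snd p)))) \<le> (2 * 163\<^sup>2 * Z\<^sup>2 + 4) / q"
    by (rule EE_sum_le[OF _ mono_of_conn _ fe le]) (use L w in auto)
  then show ?thesis by (simp add: tau_def sum.cartesian_product case_prod_beta)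
qed

section \<open>Cubes in the lattice\<close>

lemma linf_attained: "\<exists>i. linf x = real_of_int \<bar>x $ i\<bar>"
proof -
  have "Max (range (\<lambda>i. \<bar>x $ i\<bar>)) \<in> range (\<lambda>i. \<bar>x $ i\<bar>)" by (rule Max_in) auto
  then obtain i where "Max (range (\<lambda>i. \<bar>x $ i\<bar>)) = \<bar>x $ i\<bar>" by blast
  then have "linf x = real_of_int \<bar>x $ i\<bar>" by (simp only: linf_def)
  then show ?thesis by blast
qed

lemma linf_le_iff: "linf x \<le> r \<longleftrightarrow> (\<forall>i. real_of_int \<bar>x $ i\<bar> \<le> r)"
proof
  assume "linf x \<le> r"
  moreover have "\<bar>x $ i\<bar> \<le> Max (range (\<lambda>i. \<bar>x $ i\<bar>))" for i by (rule Max_ge) auto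
  then have "real_of_int \<bar>x $ i\<bar> \<le> linf x" for i unfolding linf_def of_int_le_iff .
  ultimately show "\<forall>i. real_of_int \<bar>x $ i\<bar> \<le> r" using order_trans by blast
qed (metis linf_attained)

lemma box_linf: "box r = {x. linf x \<le> r}"
  by (simp add: box_def linf_le_iff)

lemma linf_nonneg: "0 \<le> linf x"
  using linf_attained[of x] by auto

lemma linf_zero [simp]: "linf 0 = 0"
  using linf_attained[of 0] by auto

lemma linf_pos: "x \<noteq> 0 \<Longrightarrow> 1 \<le> linf x"
proof -
  assume "x \<noteq> 0"
  then obtain i where "x $ i \<noteq> 0" by (auto simp: vec_eq_iff)
  then have "1 \<le> real_of_int \<bar>x $ i\<bar>" by linarith
  also have "\<dots> \<le> linf x" using linf_le_iff[of x "linf x"] by simp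
  finally show ?thesis .
qed

lemma linf_triangle: "linf (x + y) \<le> linf x + linf y"
  unfolding linf_le_iff
proof
  fix i
  have "real_of_int \<bar>x $ i\<bar> \<le> linf x" "real_of_int \<bar>y $ i\<bar> \<le> linf y"
    using linf_le_iff[of x "linf x"] linf_le_iff[of y "linf y"] by auto
  then show "real_of_int \<bar>(x + y) $ i\<bar> \<le> linf x + linf y" by simp
qed

lemma linf_minus: "linf (- x) = linf x"
  by (simp add: linf_def)

lemma linf_triangle_diff: "linf (x - y) \<le> linf x + linf y"
  using linf_triangle[of x "- y"] by (simp add: linf_minus)

lemma bij_betw_vec_nth:
  "bij_betw vec_nth {x. \<forall>i. x $ i \<in> A i} (PiE UNIV A)"
  unfolding bij_betw_def
  by (auto simp: inj_on_def vec_nth_inject PiE_UNIV_domain intro!: image_eqI[of _ _ "vec_lambda _"])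

lemma finite_vec_box: "(\<And>i. finite (A i)) \<Longrightarrow> finite {x :: 'b ^ 'd::finite. \<forall>i. x $ i \<in> A i}"
  using bij_betw_finite[OF bij_betw_vec_nth[of A]] finite_PiE[of UNIV A] by auto

lemma card_vec_box: "card {x :: 'b ^ 'd::finite. \<forall>i. x $ i \<in> A} = card A ^ CARD('d)"
  using bij_betw_same_card[OF bij_betw_vec_nth[of "\<lambda>_. A"]] by (simp add: card_PiE)

definition cube :: "nat \<Rightarrow> (int ^ 'd::finite) set" where
  "cube k = {x. \<forall>i. x $ i \<in> {0..<2 ^ k}}"

lemma finite_cube [simp]: "finite (cube k)"
  unfolding cube_def by (rule finite_vec_box) auto

lemma zero_in_cube [simp]: "0 \<in> cube k"
  by (simp add: cube_def)

lemma cube_nonempty [simp]: "cube k \<noteq> {}"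
  using zero_in_cube by blast

lemma card_cube: "card (cube k :: (int ^ 'd::finite) set) = 2 ^ (k * CARD('d))"
  unfolding cube_def by (subst card_vec_box) (simp add: nat_power_eq power_mult)

lemma finite_box [simp]: "finite (box r)"
proof -
  have "a \<in> {- \<lfloor>r\<rfloor>..\<lfloor>r\<rfloor>}" if "real_of_int \<bar>a\<bar> \<le> r" for a :: int
    using that by (auto simp: le_floor_iff) linarith+
  then have "box r \<subseteq> {x. \<forall>i. x $ i \<in> {- \<lfloor>r\<rfloor>..\<lfloor>r\<rfloor>}}"
    unfolding box_def by blast
  then show ?thesis by (rule finite_subset) (rule finite_vec_box, simp)
qed

lemma card_box:
  assumes "0 \<le> r"
  shows "card (box r :: (int ^ 'd::finite) set) = nat (2 * \<lfloor>r\<rfloor> + 1) ^ CARD('d)"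
proof -
  have *: "real_of_int \<bar>a\<bar> \<le> r \<longleftrightarrow> a \<in> {- \<lfloor>r\<rfloor>..\<lfloor>r\<rfloor>}" for a :: int
    by (auto simp: le_floor_iff) linarith+
  show ?thesis unfolding box_def * by (subst card_vec_box) simp
qed

lemma card_box_ge: "0 \<le> r \<Longrightarrow> r ^ CARD('d) \<le> real (card (box r :: (int ^ 'd::finite) set))"
proof -
  assume r: "0 \<le> r"
  have "r \<le> real_of_int \<lfloor>r\<rfloor> + 1" by linarith
  moreover have "0 \<le> real_of_int \<lfloor>r\<rfloor>" using r by simp
  ultimately have "r \<le> 2 * real_of_int \<lfloor>r\<rfloor> + 1" by linarith
  then have "r \<le> real (nat (2 * \<lfloor>r\<rfloor> + 1))" by simp
  then show ?thesis using r unfolding card_box[OF r] of_nat_power by (intro power_mono)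
qed

lemma card_box_le:
  assumes "1 \<le> r"
  shows "real (card (box r :: (int ^ 'd::finite) set)) \<le> (3 * r) ^ CARD('d)"
proof -
  have "real (nat (2 * \<lfloor>r\<rfloor> + 1)) \<le> 3 * r" using assms of_int_floor_le[of r] by linarith
  moreover have "0 \<le> r" using assms by simp
  ultimately show ?thesis unfolding card_box[OF \<open>0 \<le> r\<close>] of_nat_power by (intro power_mono) auto
qed

lemma zero_in_box [simp]: "0 \<le> r \<Longrightarrow> 0 \<in> box r"
  by (simp add: box_linf)

lemma box_mono: "r \<le> r' \<Longrightarrow> box r \<subseteq> box r'"
  by (auto simp: box_linf)

lemma cube_subset_box: "cube k \<subseteq> box (2 ^ k)"
proof
  fix x :: "int ^ 'd" assume x: "x \<in> cube k"
  have "real_of_int \<bar>x $ i\<bar> \<le> real_of_int (2 ^ k)" for i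
  proof -
    have "0 \<le> x $ i" "x $ i < 2 ^ k" using x by (auto simp: cube_def)
    then show ?thesis unfolding of_int_le_iff by simp
  qed
  then show "x \<in> box (2 ^ k)" by (simp add: box_def)
qed

lemma diff_cube: "x \<in> cube k \<Longrightarrow> y \<in> cube k \<Longrightarrow> y - x \<in> box (2 ^ k)"
proof -
  assume x: "x \<in> cube k" "y \<in> cube k"
  have "real_of_int \<bar>(y - x) $ i\<bar> \<le> real_of_int (2 ^ k)" for i
  proof -
    have "0 \<le> x $ i" "x $ i < 2 ^ k" "0 \<le> y $ i" "y $ i < 2 ^ k" using x by (auto simp: cube_def)
    then show ?thesis unfolding of_int_le_iff by simp
  qed
  then show "y - x \<in> box (2 ^ k)" by (simp add: box_def)
qed

definition corners :: "nat \<Rightarrow> (int ^ 'd::finite) set" where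
  "corners k = {b. \<forall>i. b $ i \<in> {0, 2 ^ k}}"

lemma finite_corners [simp]: "finite (corners k)"
  unfolding corners_def by (rule finite_vec_box) auto

lemma card_corners: "card (corners k :: (int ^ 'd::finite) set) = 2 ^ CARD('d)"
  unfolding corners_def by (subst card_vec_box) (simp add: numeral_2_eq_2)

lemma linf_corners: "b \<in> corners k \<Longrightarrow> linf b \<le> 2 ^ k"
proof -
  assume b: "b \<in> corners k"
  have "real_of_int \<bar>b $ i\<bar> \<le> 2 ^ k" for i
  proof -
    have "b $ i = 0 \<or> b $ i = 2 ^ k" using b by (simp add: corners_def)
    then show ?thesis by auto
  qed
  then show ?thesis by (simp add: linf_le_iff)
qed

lemma corner_cube_subset: "b \<in> corners k \<Longrightarrow> (\<lambda>x. x + b) ` cube k \<subseteq> cube (Suc k)"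
proof
  fix y assume b: "b \<in> corners k" and "y \<in> (\<lambda>x. x + b) ` cube k"
  then obtain x where y: "y = x + b" and x: "x \<in> cube k" by blast
  have "0 \<le> y $ i \<and> y $ i < 2 ^ Suc k" for i
  proof -
    have "0 \<le> x $ i" "x $ i < 2 ^ k" "b $ i = 0 \<or> b $ i = 2 ^ k" using x b by (auto simp: cube_def corners_def)
    then show ?thesis by (auto simp: y)
  qed
  then show "y \<in> cube (Suc k)" by (simp add: cube_def)
qed

lemma corner_cube_disjoint:
  assumes "b \<in> corners k" "b' \<in> corners k" "b \<noteq> b'"
  shows "(\<lambda>x. x + b) ` cube k \<inter> (\<lambda>x. x + b') ` cube k = {}"
proof (rule ccontr)
  assume "\<not> ?thesis"
  then obtain x x' where x: "x \<in> cube k" "x' \<in> cube k" "x + b = x' + b'" by blast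
  obtain i where i: "b $ i \<noteq> b' $ i" using assms(3) by (auto simp: vec_eq_iff)
  have "x $ i + b $ i = x' $ i + b' $ i" using x(3) by (metis vector_add_component)
  moreover have "0 \<le> x $ i" "x $ i < 2 ^ k" "0 \<le> x' $ i" "x' $ i < 2 ^ k" using x by (auto simp: cube_def)
  moreover have "b $ i = 0 \<or> b $ i = 2 ^ k" "b' $ i = 0 \<or> b' $ i = 2 ^ k" using assms by (auto simp: corners_def)
  ultimately show False using i by auto
qed

section \<open>Kernels with the interaction near the origin reduced\<close>

definition rad :: "(int ^ 'd::finite) set \<Rightarrow> real" where
  "rad e = Max (linf ` e)"

lemma rad_pair: "rad {x, y} = max (linf x) (linf y)"
  by (simp add: rad_def)

lemma bij_add: "bij (\<lambda>x. x + b :: 'a :: ab_group_add)"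
  by (rule bij_betwI[of _ _ _ "\<lambda>x. x - b"]) auto

lemma card_2_image_add: "card ((\<lambda>x. x + b :: 'a :: ab_group_add) ` e) = 2 \<longleftrightarrow> card e = 2"
  by (simp add: card_image inj_on_def)

lemma rad_shift:
  assumes "card e = 2"
  shows "rad ((\<lambda>x. x + b) ` e) \<le> rad e + linf b"
proof -
  obtain x y where e: "e = {x, y}" using assms by (auto simp: card_2_iff)
  show ?thesis using linf_triangle[of x b] linf_triangle[of y b] by (simp add: e rad_pair max_def)
qed

lemma rad_nonneg: "card e = 2 \<Longrightarrow> 0 \<le> rad e"
  by (auto simp: card_2_iff rad_pair linf_nonneg max_def)

lemma rad_subset: "e \<in> pairs_in (box r) \<Longrightarrow> rad e \<le> r"
  by (auto simp: pairs_in_def card_2_iff rad_pair box_linf)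

text \<open>\<open>g\<close> is the distance from the origin up to which the weight is nearly flat.
  Increasing \<open>g\<close> shrinks the hole, and the weight released in this way is the
  sprinkling.\<close>

definition hole :: "real \<Rightarrow> real \<Rightarrow> real \<Rightarrow> (int ^ 'd::finite) set \<Rightarrow> real" where
  "hole D lam g e = (if card e = 2 then lam * (rad e + g) powr (- D) else 0)"

text \<open>The weight per pair released at scale \<open>k\<close>. The factor 1/3 is from
  \<open>powr_diff_ge\<close>; 11 is 9 + 2, where 9 is the offset in \<open>giant_merge\<close> and
  2 bounds the radius of pairs in the next cube, in units of \<open>2 ^ k\<close>.\<close>

definition sprinkle_rate :: "real \<Rightarrow> real \<Rightarrow> nat \<Rightarrow> real" where
  "sprinkle_rate D lam k = lam / 3 * (11 * 2 ^ k) powr (- D)"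

lemma hole_nonneg: "0 \<le> lam \<Longrightarrow> 0 \<le> hole D lam g e"
  by (simp add: hole_def)

lemma hole_antimono:
  assumes "0 \<le> lam" "0 \<le> D" "0 < g" "g \<le> g'"
  shows "hole D lam g' e \<le> hole D lam g e"
  using assms rad_nonneg[of e] by (auto simp: hole_def intro!: mult_left_mono powr_mono2')

text \<open>Increasing the base by a factor 3/2 multiplies the power by at most 2/3, as the exponent
  is at most -1; a third of it is released.\<close>

lemma powr_diff_ge:
  fixes X Y D u :: real
  assumes "1 \<le> D" "0 < X" "X \<le> u" "3 * X \<le> 2 * Y"
  shows "u powr (- D) / 3 \<le> X powr (- D) - Y powr (- D)"
proof -
  have "Y powr (- D) \<le> (3 / 2 * X) powr (- D)" using assms by (intro powr_mono2') auto
  also have "\<dots> = (3 / 2) powr (- D) * X powr (- D)" using assms by (intro powr_mult)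
  also have "\<dots> \<le> (3 / 2) powr (- 1) * X powr (- D)" using assms by (intro mult_right_mono powr_mono) auto
  also have "\<dots> = 2 / 3 * X powr (- D)" by (simp add: powr_minus_divide)
  finally have "X powr (- D) / 3 \<le> X powr (- D) - Y powr (- D)" by simp
  moreover have "u powr (- D) \<le> X powr (- D)" using assms by (intro powr_mono2') auto
  ultimately show ?thesis by linarith
qed

lemma hole_sprinkle:
  assumes "1 \<le> D" "0 < lam" "0 < X" "3 * (rad e + X) \<le> 2 * (rad e + Y) \<or> e \<notin> pairs_in L"
    "e \<in> pairs_in L \<Longrightarrow> rad e + X \<le> 11 * 2 ^ k" "X \<le> Y"
  shows "hole D lam Y e + sprinkle (sprinkle_rate D lam k) L e \<le> hole D lam X e"
proof (cases "e \<in> pairs_in L")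
  case True
  then have e: "card e = 2" by (simp add: pairs_in_def)
  have "(11 * 2 ^ k) powr (- D) / 3 \<le> (rad e + X) powr (- D) - (rad e + Y) powr (- D)"
    using assms True rad_nonneg[OF e] by (intro powr_diff_ge) auto
  then have "lam * ((11 * 2 ^ k) powr (- D) / 3) \<le> lam * ((rad e + X) powr (- D) - (rad e + Y) powr (- D))"
    using assms by (intro mult_left_mono) auto
  then show ?thesis using True e by (simp add: hole_def sprinkle_def sprinkle_rate_def algebra_simps)
next
  case False
  then show ?thesis using hole_antimono[of lam D X Y e] assms by (simp add: sprinkle_def)
qed

text \<open>Translating by \<open>b\<close> moves a pair at most \<open>linf b\<close> further from
  the origin, so the larger offset compensates for the missing translation invariance.\<close>

lemma hole_shift:
  assumes "0 \<le> lam" "0 \<le> D" "0 < g"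
  shows "hole D lam (g + linf b) e \<le> hole D lam g ((\<lambda>x. x + b) ` e)"
proof (cases "card e = 2")
  case True
  have "rad ((\<lambda>x. x + b) ` e) + g \<le> rad e + (g + linf b)" using rad_shift[OF True, of b] by simp
  moreover have "0 \<le> rad ((\<lambda>x. x + b) ` e)" using True by (intro rad_nonneg) (simp add: card_2_image_add)
  ultimately show ?thesis
    using assms True by (auto simp: hole_def card_2_image_add intro!: mult_left_mono powr_mono2')
qed (use assms in \<open>simp add: hole_def\<close>)

text \<open>The distance between two points is at most twice the larger of their norms; this is the
  source of the factor \<open>2 powr D\<close> in the assumption on the kernel.\<close>

lemma hole_le:
  assumes "0 \<le> lam" "0 \<le> D" "0 \<le> g" "x \<noteq> y"
  shows "hole D lam g {x, y} \<le> lam * 2 powr D * linf (x - y) powr (- D)"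
proof -
  have l: "1 \<le> linf (x - y)" using assms(4) by (intro linf_pos) auto
  have "linf (x - y) / 2 \<le> rad {x, y} + g" using linf_triangle_diff[of x y] assms(3) by (simp add: rad_pair)
  then have "(rad {x, y} + g) powr (- D) \<le> (linf (x - y) / 2) powr (- D)"
    using l assms by (intro powr_mono2') auto
  also have "\<dots> = 2 powr D * linf (x - y) powr (- D)" using l by (simp add: powr_divide powr_minus_divide)
  finally show ?thesis using assms by (simp add: hole_def card_insert_if mult_left_mono mult.assoc)
qed

section \<open>Runaway growth of the largest cluster\<close>

text \<open>The part \<open>2 * B + 1\<close> keeps \<open>z\<close> above \<open>B\<close> when
  half of \<open>z 0\<close> is lost; the square makes the first relative loss so small that the
  geometric series of losses stays below 1/2.\<close>

definition growth_const :: "real \<Rightarrow> real \<Rightarrow> real \<Rightarrow> real" where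
  "growth_const \<nu> C B = 2 * B + 1 + (4 * C / (1 - 1 / sqrt \<nu>))\<^sup>2"

text \<open>As long as the density \<open>p\<close> has lost at most half of its initial value,
  \<open>z\<close> grows like \<open>\<nu> ^ i\<close>, so the loss at step \<open>i\<close> is at
  most \<open>\<epsilon> * r ^ i\<close>. These losses sum to at most 1/2, which reproduces the
  hypothesis.\<close>

lemma runaway_growth:
  fixes p z :: "nat \<Rightarrow> real"
  assumes \<nu>: "1 < \<nu>" and C: "0 \<le> C" and B: "0 \<le> B" and c: "0 < c"
    and z: "\<And>i. z i = c * \<nu> ^ i * p i"
    and step: "\<And>i. B < z i \<Longrightarrow> (1 - C / sqrt (z i)) * p i \<le> p (Suc i)"
    and start: "growth_const \<nu> C B \<le> z 0"
  shows "p 0 / 2 \<le> p i"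
proof -
  define r where "r = 1 / sqrt \<nu>"
  define \<epsilon> where "\<epsilon> = 2 * C / sqrt (z 0)"
  have r: "0 < r" "r < 1" using \<nu> by (auto simp: r_def)
  have z0: "2 * B + 1 \<le> z 0" "(4 * C / (1 - r))\<^sup>2 \<le> z 0"
    using start B zero_le_power2[of "4 * C / (1 - r)"] unfolding growth_const_def r_def by linarith+
  have z0pos: "0 < z 0" using z0 B by linarith
  have p0: "0 < p 0" using z0pos c z[of 0] by (simp add: zero_less_mult_iff)
  have "4 * C / (1 - r) \<le> sqrt (z 0)" using z0(2) by (rule real_le_rsqrt)
  then have "4 * C \<le> sqrt (z 0) * (1 - r)" using r by (simp only: pos_divide_le_eq)
  then have "2 * C \<le> (1 - r) / 2 * sqrt (z 0)" by (simp add: mult.commute)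
  then have \<epsilon>: "\<epsilon> \<le> (1 - r) / 2" "0 \<le> \<epsilon>"
    using C z0pos by (simp_all add: \<epsilon>_def pos_divide_le_eq)
  have S: "\<epsilon> * (\<Sum>j<i. r ^ j) \<le> 1 / 2" for i
  proof -
    have "(1 - r) * (\<Sum>j<i. r ^ j) = 1 - r ^ i" using r by (simp add: sum_gp_strict)
    also have "\<dots> \<le> 1" using r by simp
    finally have "(1 - r) / 2 * (\<Sum>j<i. r ^ j) \<le> 1 / 2" by simp
    moreover have "\<epsilon> * (\<Sum>j<i. r ^ j) \<le> (1 - r) / 2 * (\<Sum>j<i. r ^ j)"
      using r \<epsilon> by (intro mult_right_mono sum_nonneg) auto
    ultimately show ?thesis by (rule order_trans[rotated])
  qed
  have S2: "p 0 / 2 \<le> (1 - \<epsilon> * (\<Sum>j<i. r ^ j)) * p 0" for i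
  proof -
    have "1 / 2 \<le> 1 - \<epsilon> * (\<Sum>j<i. r ^ j)" using S[of i] by linarith
    from mult_right_mono[OF this, of "p 0"] p0 show ?thesis by simp
  qed
  have main: "(1 - \<epsilon> * (\<Sum>j<i. r ^ j)) * p 0 \<le> p i" for i
  proof (induction i)
    case (Suc i)
    have half: "p 0 / 2 \<le> p i" using Suc.IH S2[of i] by linarith
    have \<nu>i: "1 \<le> \<nu> ^ i" using \<nu> by simp
    have zi: "z 0 * \<nu> ^ i / 2 \<le> z i"
      using half mult_left_mono[of "p 0 / 2" "p i" "c * \<nu> ^ i"] c \<nu> z[of i] z[of 0] by (simp add: mult_ac)
    have "z 0 / 2 * 1 \<le> z 0 / 2 * \<nu> ^ i" using \<nu>i z0pos by (intro mult_left_mono) auto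
    then have B': "B < z i" using zi z0 by simp
    have "0 \<le> z 0 * \<nu> ^ i" using z0pos \<nu>i by (intro mult_nonneg_nonneg) auto
    \<comment> \<open>One half would be available; one quarter makes the square root equal to
      \<open>sqrt (z 0) / 2\<close>, which is the 2 in the definition of
      \<open>\<epsilon>\<close>.\<close>
    then have "z 0 / 4 * \<nu> ^ i \<le> z i" using zi by simp
    then have "sqrt (z 0 / 4 * \<nu> ^ i) \<le> sqrt (z i)" by simp
    then have sq: "sqrt (z 0) / 2 * sqrt \<nu> ^ i \<le> sqrt (z i)"
      by (simp add: real_sqrt_mult real_sqrt_divide real_sqrt_power)
    have "C / sqrt (z i) \<le> C / (sqrt (z 0) / 2 * sqrt \<nu> ^ i)"
      using sq C z0pos \<nu> B' B by (intro divide_left_mono mult_pos_pos) auto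
    also have "\<dots> = \<epsilon> * r ^ i" by (simp add: \<epsilon>_def r_def power_one_over field_simps)
    finally have loss: "C / sqrt (z i) \<le> \<epsilon> * r ^ i" .
    have pi: "0 \<le> p i" using half p0 by linarith
    have e1: "\<epsilon> * r ^ i \<le> 1" using mult_left_le[of "r ^ i" \<epsilon>] \<epsilon> r power_le_one[of r i] by simp
    have "(1 - \<epsilon> * (\<Sum>j<Suc i. r ^ j)) * p 0 \<le> (1 - \<epsilon> * r ^ i) * ((1 - \<epsilon> * (\<Sum>j<i. r ^ j)) * p 0)"
    proof -
      have "0 \<le> \<epsilon> * r ^ i * (\<epsilon> * (\<Sum>j<i. r ^ j)) * p 0"
        using \<epsilon> r p0 by (intro mult_nonneg_nonneg sum_nonneg) auto
      then show ?thesis by (simp add: algebra_simps)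
    qed
    also have "\<dots> \<le> (1 - \<epsilon> * r ^ i) * p i" using e1 by (intro mult_left_mono Suc.IH) auto
    also have "\<dots> \<le> (1 - C / sqrt (z i)) * p i" using loss pi by (intro mult_right_mono) auto
    also have "\<dots> \<le> p (Suc i)" by (rule step[OF B'])
    finally show ?case .
  qed simp
  show ?thesis using main[of i] S2[of i] by linarith
qed

text \<open>The growth factor is the volume factor \<open>2 ^ d\<close> times
  \<open>2 powr (- (d + \<alpha>) / 2)\<close>, the change of the square root of the sprinkling rate
  per scale. It exceeds 1 exactly when \<alpha> < d.\<close>

definition giant_const :: "nat \<Rightarrow> real \<Rightarrow> real" where
  "giant_const d \<alpha> = growth_const (2 powr ((real d - \<alpha>) / 2)) (4 ^ d + 1) (4 ^ d)"

text \<open>The factors 3 and 44 come from inverting \<open>sprinkle_rate\<close> two scales up,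
  where \<open>11 * 2 ^ 2\<close> is 44.\<close>

definition local_const :: "nat \<Rightarrow> real \<Rightarrow> real" where
  "local_const d \<alpha> = (2 * 163\<^sup>2 * (giant_const d \<alpha>)\<^sup>2 + 4) * 3 * 44 powr (real d + \<alpha>)"

lemma local_const_pos: "0 < local_const d \<alpha>"
proof -
  have "0 < 2 * 163\<^sup>2 * (giant_const d \<alpha>)\<^sup>2 + 4"
    by (intro add_nonneg_pos mult_nonneg_nonneg) auto
  then show ?thesis unfolding local_const_def by simp
qed

text \<open>Absence of percolation enters only through a vanishing average of the two-point function
  along arbitrarily large scales. \<open>W_ge\<close> leaves room for a hole of strength
  \<open>lam\<close> with any offset.\<close>

locale subcritical_kernel =
  fixes W :: "(int ^ 'd::finite) set \<Rightarrow> real" and \<alpha> lam D :: real and d :: nat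
  assumes d_eq: "d = CARD('d)" and D_eq: "D = real d + \<alpha>"
    and alpha: "0 < \<alpha>" "\<alpha> < real d" and lam: "0 < lam"
    and W_nonneg: "0 \<le> W e"
    and W_shift: "W ((\<lambda>x. x + b) ` e) = W e"
    and W_ge: "x \<noteq> y \<Longrightarrow> lam * 2 powr D * linf (x - y) powr (- D) \<le> W {x, y}"
    and no_percolation: "0 < \<epsilon> \<Longrightarrow> \<exists>n\<ge>k. (\<Sum>z\<in>box (2 ^ n). tau W 0 z) < \<epsilon> * 2 ^ (n * d)"
begin

abbreviation "hl \<equiv> hole D lam"
abbreviation "q k \<equiv> sprinkle_rate D lam k"

definition Wr :: "real \<Rightarrow> (int ^ 'd) set \<Rightarrow> real" where
  "Wr g e = W e - hl g e"

lemma D_ge: "1 \<le> D"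
  using alpha by (cases d) (auto simp: D_eq)

lemma hl_le_W:
  assumes "0 \<le> g"
  shows "hl g e \<le> W e"
proof (cases "card e = 2")
  case True
  then obtain x y where e: "e = {x, y}" "x \<noteq> y" by (auto simp: card_2_iff)
  show ?thesis using hole_le[of lam D g x y] W_ge[OF e(2)] e assms lam D_ge by simp
qed (simp add: hole_def W_nonneg)

lemma Wr_nonneg: "0 \<le> g \<Longrightarrow> 0 \<le> Wr g e"
  using hl_le_W[of g e] by (simp add: Wr_def)

lemma tau_Wr_nonneg: "0 \<le> g \<Longrightarrow> 0 \<le> tau (Wr g) x y"
  by (intro tau_nonneg Wr_nonneg)

lemma Wr_le: "Wr g e \<le> W e"
  using hole_nonneg[of lam D g e] lam by (simp add: Wr_def)

lemma Wr_mono: "0 < g \<Longrightarrow> g \<le> g' \<Longrightarrow> Wr g e \<le> Wr g' e"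
  using hole_antimono[of lam D g g' e] lam D_ge by (simp add: Wr_def)

lemma Wr_shift: "0 < g \<Longrightarrow> Wr g ((\<lambda>x. x + b) ` e) \<le> Wr (g + linf b) e"
  using hole_shift[of lam D g b e] lam D_ge by (simp add: Wr_def W_shift)

lemma q_pos: "0 < q k"
  using lam by (simp add: sprinkle_rate_def)

lemma q_add: "sqrt (q (k + i)) = sqrt (q k) * (2 powr (- D / 2)) ^ i"
proof -
  have "(2 :: real) ^ i = 2 powr real i" by (simp add: powr_realpow)
  then have "(11 * 2 ^ (k + i)) powr (- D) = (11 * 2 ^ k) powr (- D) * (2 powr (- D)) powr (real i)"
    by (simp add: power_add powr_mult powr_powr mult_ac)
  also have "(2 powr (- D)) powr (real i) = (2 powr (- D)) ^ i" by (simp add: powr_realpow)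
  finally have "q (k + i) = q k * (2 powr (- D)) ^ i" by (simp add: sprinkle_rate_def)
  moreover have "sqrt (2 powr (- D)) = 2 powr (- D / 2)" by (simp add: powr_half_sqrt[symmetric] powr_powr)
  ultimately show ?thesis by (simp add: real_sqrt_mult real_sqrt_power)
qed

text \<open>The offset is proportional to the side, so the reference kernel increases with
  \<open>k\<close>; its increase supplies the edges that merge the subcubes.\<close>

definition giant :: "nat \<Rightarrow> real" where
  "giant k = Emx (Wr (8 * 2 ^ k)) (cube k)"

lemma giant_ge_1: "1 \<le> giant k"
  unfolding giant_def by (rule Emx_ge_1) (auto intro: Wr_nonneg)

text \<open>In units of \<open>2 ^ k\<close> the offset grows from 8 to 16. The displacement of a
  subcube raises the 8 to at most 9, and the passage from 9 to 16 releases \<open>q k\<close> on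
  every pair of the larger cube.\<close>

lemma giant_merge:
  assumes s: "0 \<le> s" and \<delta>: "4 ^ d * exp (- (q k * s\<^sup>2)) < 1"
  shows "(1 - 4 ^ d * exp (- (q k * s\<^sup>2))) * (2 ^ d * (giant k - s)) \<le> giant (Suc k)"
proof -
  let ?u = "2 ^ k :: real"
  let ?L = "cube (Suc k) :: (int ^ 'd) set"
  let ?I = "corners k :: (int ^ 'd) set"
  \<comment> \<open>Removing the sprinkling from the target kernel gives a base kernel that still
    dominates a translated copy of the one defining \<open>giant k\<close>.\<close>
  define u where "u e = Wr (16 * ?u) e - sprinkle (q k) ?L e" for e
  have hs: "hl (16 * ?u) e + sprinkle (q k) ?L e \<le> hl (9 * ?u) e" for e
  proof (rule hole_sprinkle)
    have u: "0 < ?u" by simp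
    have r: "rad e \<le> 2 * ?u" if "e \<in> pairs_in ?L"
    proof -
      have "e \<in> pairs_in (box (2 ^ Suc k))" using that cube_subset_box[of "Suc k"] unfolding pairs_in_def by blast
      from rad_subset[OF this] show ?thesis by simp
    qed
    have "3 * (rad e + 9 * ?u) \<le> 2 * (rad e + 16 * ?u)" if "e \<in> pairs_in ?L"
      using r[OF that] u by argo
    then show "3 * (rad e + 9 * ?u) \<le> 2 * (rad e + 16 * ?u) \<or> e \<notin> pairs_in ?L" by blast
    show "rad e + 9 * ?u \<le> 11 * 2 ^ k" if "e \<in> pairs_in ?L"
      using r[OF that] u by argo
  qed (use D_ge lam in auto)
  have u0: "0 \<le> u e" for e
    using hs[of e] hl_le_W[of "9 * ?u" e] by (simp add: u_def Wr_def)
  have y: "giant k \<le> Emx u ((\<lambda>x. x + b) ` cube k)" if b: "b \<in> ?I" for b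
  proof -
    have "Wr (8 * ?u) e \<le> u ((\<lambda>x. x + b) ` e)" for e
    proof -
      let ?e = "(\<lambda>x. x + b) ` e"
      have inv: "(\<lambda>x. x + - b) ` ?e = e" by (simp add: image_image)
      have "hl (16 * ?u) ?e + sprinkle (q k) ?L ?e \<le> hl (9 * ?u) ?e" by (rule hs)
      also have "\<dots> \<le> hl (8 * ?u + linf (- b)) ?e"
        using linf_corners[OF b] lam D_ge linf_nonneg[of b]
        by (intro hole_antimono) (auto simp: linf_minus intro: add_pos_nonneg)
      also have "\<dots> \<le> hl (8 * ?u) ((\<lambda>x. x + - b) ` ?e)"
        using lam D_ge by (intro hole_shift) auto
      finally show ?thesis unfolding inv by (simp add: u_def Wr_def W_shift)
    qed
    then have "giant k \<le> Emx (\<lambda>e. u ((\<lambda>x. x + b) ` e)) (cube k)"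
      unfolding giant_def by (intro Emx_mono) (auto intro: Wr_nonneg)
    also have "\<dots> = Emx u ((\<lambda>x. x + b) ` cube k)" by (rule Emx_image[symmetric, OF bij_add])
    finally show ?thesis .
  qed
  have card: "real (card ?I) = 2 ^ d" by (simp add: card_corners d_eq)
  have card2: "real (card ?I) ^ 2 = 4 ^ d"
  proof -
    have "((2 :: real) ^ d)\<^sup>2 = (2\<^sup>2) ^ d" by (simp only: power_mult[symmetric] mult.commute)
    then show ?thesis unfolding card by simp
  qed
  have "(1 - 4 ^ d * exp (- (q k * s\<^sup>2))) * (real (card ?I) * (giant k - s)) \<le> Emx (Wr (16 * ?u)) ?L"
  proof (rule Emx_merge[where u = u and c = "\<lambda>b. (\<lambda>x. x + b) ` cube k"])
    show "4 ^ d * exp (- (q k * s\<^sup>2)) = real (card ?I) ^ 2 * exp (- (q k * s\<^sup>2))" by (simp only: card2)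
    show "u e + sprinkle (q k) ?L e \<le> Wr (16 * ?u) e" for e by (simp add: u_def)
    show "(\<lambda>x. x + i) ` cube k \<inter> (\<lambda>x. x + j) ` cube k = {}" if "i \<in> ?I" "j \<in> ?I" "i \<noteq> j" for i j
      by (rule corner_cube_disjoint[OF that])
    show "finite ((\<lambda>x. x + i) ` cube k) \<and> (\<lambda>x. x + i) ` cube k \<noteq> {} \<and> (\<lambda>x. x + i) ` cube k \<subseteq> ?L" if "i \<in> ?I" for i
      using corner_cube_subset[OF that] by simp
  qed (use u0 q_pos[of k] s \<delta> y in auto)
  then show ?thesis unfolding card by (simp add: giant_def)
qed

lemma tau_shift: "tau W (x + b) (y + b) = tau W x y"
  by (subst tau_image[OF bij_add]) (simp add: W_shift)

lemma sum_tau_cube_le: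
  "(\<Sum>x\<in>cube n. \<Sum>y\<in>cube n. tau W x y) \<le> 2 ^ (n * d) * (\<Sum>z\<in>box (2 ^ n). tau W 0 z)"
proof -
  have "(\<Sum>y\<in>cube n. tau W x y) \<le> (\<Sum>z\<in>box (2 ^ n). tau W 0 z)" if x: "x \<in> cube n" for x
  proof -
    have "(\<Sum>y\<in>cube n. tau W x y) = (\<Sum>y\<in>cube n. tau W 0 (y - x))"
      using tau_shift[of 0 x] by (intro sum.cong refl) (metis add_0 diff_add_cancel)
    also have "\<dots> = (\<Sum>z\<in>(\<lambda>y. y - x) ` cube n. tau W 0 z)"
      by (subst sum.reindex) (auto simp: inj_on_def)
    also have "\<dots> \<le> (\<Sum>z\<in>box (2 ^ n). tau W 0 z)"
      using diff_cube[OF x] by (intro sum_mono2) (auto intro: tau_nonneg W_nonneg)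
    finally show ?thesis .
  qed
  then have "(\<Sum>x\<in>cube n. \<Sum>y\<in>cube n. tau W x y) \<le> of_nat (card (cube n :: (int ^ 'd) set)) * (\<Sum>z\<in>box (2 ^ n). tau W 0 z)"
    by (rule sum_bounded_above)
  then show ?thesis by (simp add: card_cube d_eq)
qed

text \<open>A cluster exceeding the natural scale \<open>(q k) powr (- 1 / 2)\<close> would keep a positive density
  at all larger scales.\<close>
lemma giant_less: "giant k < giant_const d \<alpha> / sqrt (q k)"
proof (rule ccontr)
  assume "\<not> ?thesis"
  then have start: "giant_const d \<alpha> \<le> giant k * sqrt (q k)"
    using q_pos[of k] by (simp add: field_simps not_less)
  define p where "p i = giant (k + i) / 2 ^ ((k + i) * d)" for i
  \<comment> \<open>Cluster size relative to the natural scale: the square of \<open>z i\<close> is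
    the expected number of open sprinkled edges between two clusters of this size.\<close>
  define z where "z i = giant (k + i) * sqrt (q (k + i))" for i
  define \<nu> where "\<nu> = 2 powr ((real d - \<alpha>) / 2)"
  have \<nu>: "1 < \<nu>" using alpha unfolding \<nu>_def by (intro gr_one_powr) auto
  have growth: "p 0 / 2 \<le> p i" for i
  proof (rule runaway_growth[OF \<nu>, where C = "4 ^ d + 1" and B = "4 ^ d" and c = "2 ^ (k * d) * sqrt (q k)" and z = z])
    show "z i = 2 ^ (k * d) * sqrt (q k) * \<nu> ^ i * p i" for i
    proof -
      have "\<nu> = 2 ^ d * 2 powr (- D / 2)"
        by (simp add: \<nu>_def powr_realpow[symmetric] powr_add[symmetric] D_eq field_simps)
      then have "\<nu> ^ i = 2 ^ (i * d) * (2 powr (- D / 2)) ^ i"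
        by (simp add: power_mult_distrib power_mult[symmetric] mult.commute)
      then show ?thesis by (simp add: z_def p_def q_add power_add distrib_right)
    qed
    show "growth_const \<nu> (4 ^ d + 1) (4 ^ d) \<le> z 0"
      using start by (simp add: z_def giant_const_def \<nu>_def)
    fix i assume zi: "4 ^ d < z i"
    let ?z = "z i" and ?g = "giant (k + i)"
    have z1: "1 < ?z" using zi one_le_power[of "4 :: real" d] by linarith
    \<comment> \<open>This threshold makes \<open>q * s\<^sup>2\<close> equal to \<open>z i\<close>,
      while \<open>s\<close> is only the fraction \<open>1 / sqrt (z i)\<close> of the cluster. Both
      losses are then of order \<open>1 / sqrt (z i)\<close>, and \<open>z i > 4 ^ d\<close> keeps
      the failure probability below 1.\<close>
    define s where "s = ?g / sqrt ?z"
    have g0: "0 < ?g" using giant_ge_1[of "k + i"] by linarith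
    have "?z\<^sup>2 = ?g\<^sup>2 * q (k + i)" using q_pos[of "k + i"] by (simp add: z_def power_mult_distrib)
    then have qs: "q (k + i) * s\<^sup>2 = ?z"
      using z1 by (simp add: s_def power_divide field_simps power2_eq_square)
    have "?z \<le> exp ?z" using exp_ge_add_one_self[of ?z] by linarith
    then have "1 / exp ?z \<le> 1 / ?z" using z1 by (intro divide_left_mono) auto
    then have "exp (- ?z) \<le> 1 / ?z" by (simp add: exp_minus field_simps)
    then have e: "4 ^ d * exp (- ?z) \<le> 4 ^ d / ?z" using mult_left_mono[of "exp (- ?z)" "1 / ?z" "4 ^ d"] by simp
    also have "\<dots> < 1" using zi z1 by (simp add: field_simps)
    finally have \<delta>: "4 ^ d * exp (- ?z) < 1" .
    have sz: "sqrt ?z \<le> ?z" using z1 by (intro real_le_lsqrt) (auto simp: power2_eq_square)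
    have "4 ^ d / ?z \<le> 4 ^ d / sqrt ?z" using sz z1 by (intro divide_left_mono) auto
    with e have e': "4 ^ d * exp (- ?z) \<le> 4 ^ d / sqrt ?z" by linarith
    have "1 - (4 ^ d + 1) / sqrt ?z = 1 - 4 ^ d / sqrt ?z - 1 / sqrt ?z" by (simp add: add_divide_distrib)
    also have "\<dots> \<le> 1 - 4 ^ d * exp (- ?z) - 1 / sqrt ?z" using e' by simp
    also have "\<dots> \<le> (1 - 4 ^ d * exp (- ?z)) * (1 - 1 / sqrt ?z)"
      using z1 by (simp add: algebra_simps)
    finally have "(1 - (4 ^ d + 1) / sqrt ?z) * ?g \<le> (1 - 4 ^ d * exp (- ?z)) * (1 - 1 / sqrt ?z) * ?g"
      using g0 by (intro mult_right_mono) auto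
    also have "\<dots> = (1 - 4 ^ d * exp (- ?z)) * (?g - s)" by (simp add: s_def algebra_simps)
    finally have "2 ^ d * ((1 - (4 ^ d + 1) / sqrt ?z) * ?g) \<le> 2 ^ d * ((1 - 4 ^ d * exp (- ?z)) * (?g - s))"
      by (intro mult_left_mono) auto
    also have "\<dots> \<le> giant (Suc (k + i))"
      using giant_merge[of s "k + i"] \<delta> g0 z1 unfolding qs by (simp add: s_def mult_ac)
    finally have "2 ^ d * ((1 - (4 ^ d + 1) / sqrt ?z) * ?g) / (2 ^ d * 2 ^ ((k + i) * d))
        \<le> giant (Suc (k + i)) / (2 ^ d * 2 ^ ((k + i) * d))" by (rule divide_right_mono) simp
    then show "(1 - (4 ^ d + 1) / sqrt ?z) * p i \<le> p (Suc i)"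
      by (simp add: p_def power_add)
  qed (use q_pos[of k] in auto)
  \<comment> \<open>By \<open>Emx_sq_le\<close>, a density of at least \<open>p 0 / 2\<close> at
    scale n forces the average of the two-point function to be at least this square.\<close>
  define \<epsilon> where "\<epsilon> = (p 0 / 2)\<^sup>2"
  have p0: "0 < p 0" using giant_ge_1[of k] by (simp add: p_def)
  then have "0 < \<epsilon>" by (simp add: \<epsilon>_def)
  from no_percolation[OF this, of k] obtain n where n: "k \<le> n" "(\<Sum>z\<in>box (2 ^ n). tau W 0 z) < \<epsilon> * 2 ^ (n * d)"
    by blast
  define i where "i = n - k"
  have ni: "n = k + i" using n(1) by (simp add: i_def)
  have "giant n \<le> Emx W (cube n)"
    unfolding giant_def by (intro Emx_mono Wr_nonneg Wr_le) auto
  then have "(giant n)\<^sup>2 \<le> (Emx W (cube n))\<^sup>2" using giant_ge_1[of n] by (intro power_mono) auto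
  also have "\<dots> \<le> (\<Sum>x\<in>cube n. \<Sum>y\<in>cube n. tau W x y)" by (intro Emx_sq_le W_nonneg) auto
  also have "\<dots> \<le> 2 ^ (n * d) * (\<Sum>z\<in>box (2 ^ n). tau W 0 z)" by (rule sum_tau_cube_le)
  also have "\<dots> < 2 ^ (n * d) * (\<epsilon> * 2 ^ (n * d))" using n(2) by (intro mult_strict_left_mono) auto
  also have "\<dots> = (p 0 / 2 * 2 ^ (n * d))\<^sup>2" by (simp add: \<epsilon>_def power2_eq_square)
  finally have "giant n < p 0 / 2 * 2 ^ (n * d)"
    by (rule power2_less_imp_less) (use p0 in simp)
  moreover have "p 0 / 2 * 2 ^ (n * d) \<le> giant n"
    using growth[of i] unfolding p_def[of i] ni[symmetric] by (simp only: pos_le_divide_eq zero_less_power zero_less_numeral)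
  ultimately show False by linarith
qed

section \<open>Susceptibility of the reduced kernel\<close>

text \<open>Stopping at offset 4 instead of 8 leaves \<open>q k\<close> on every pair of the cube,
  which is the sprinkling under which the second moment would explode.\<close>

lemma sum_tau_cube_Wr_le:
  "(\<Sum>x\<in>cube k. \<Sum>y\<in>cube k. tau (Wr (4 * 2 ^ k)) x y) \<le> (2 * 163\<^sup>2 * (giant_const d \<alpha>)\<^sup>2 + 4) / q k"
proof (rule sum_tau_le_of_Emx[where v = "Wr (8 * 2 ^ k)"])
  show "Wr (4 * 2 ^ k) e + sprinkle (q k) (cube k) e \<le> Wr (8 * 2 ^ k) e" for e
  proof -
    have u: "0 < (2 :: real) ^ k" by simp
    have r: "rad e \<le> 2 ^ k" if "e \<in> pairs_in (cube k)"
    proof -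
      have "e \<in> pairs_in (box (2 ^ k))" using that cube_subset_box[of k] unfolding pairs_in_def by blast
      from rad_subset[OF this] show ?thesis .
    qed
    have "3 * (rad e + 4 * 2 ^ k) \<le> 2 * (rad e + 8 * 2 ^ k)" "rad e + 4 * 2 ^ k \<le> 11 * 2 ^ k"
      if "e \<in> pairs_in (cube k)"
      using r[OF that] u by argo+
    then have "hl (8 * 2 ^ k) e + sprinkle (q k) (cube k) e \<le> hl (4 * 2 ^ k) e"
      using D_ge lam by (intro hole_sprinkle) auto
    then show ?thesis by (simp add: Wr_def)
  qed
  show "Emx (Wr (8 * 2 ^ k)) (cube k) \<le> giant_const d \<alpha> / sqrt (q k)"
    using giant_less[of k] by (simp add: giant_def)
qed (auto intro: Wr_nonneg q_pos)

text \<open>The double sum over a cube becomes a sum seen from the origin by averaging over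
  \<open>2 ^ (i * d)\<close> translates, which turns the order \<open>2 powr (i * D)\<close> into
  \<open>2 powr (i * \<alpha>)\<close>.\<close>

lemma sum_tau_Wr_le:
  assumes g: "0 < g" "g \<le> 12 * 2 ^ i"
  shows "(\<Sum>z\<in>box (2 ^ i). tau (Wr g) 0 z) \<le> local_const d \<alpha> * 2 powr (real i * \<alpha>) / lam"
proof -
  let ?u = "2 ^ i :: real"
  \<comment> \<open>From such a point the box of radius \<open>2 ^ i\<close> stays inside the cube
    of side \<open>4 * 2 ^ i\<close>. The translation raises the offset from at most 12 to at most
    15, in units of \<open>2 ^ i\<close>, below the available 16.\<close>
  define C :: "(int ^ 'd) set" where "C = {b. \<forall>j. b $ j \<in> {2 * 2 ^ i..<3 * 2 ^ i}}"
  have cC: "card C = 2 ^ (i * d)" unfolding C_def by (subst card_vec_box) (simp add: nat_power_eq power_mult d_eq)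
  have fC: "finite C" unfolding C_def by (rule finite_vec_box) auto
  let ?Q = "cube (i + 2) :: (int ^ 'd) set"
  have each: "(\<Sum>z\<in>box ?u. tau (Wr g) 0 z) \<le> (\<Sum>y\<in>?Q. tau (Wr (4 * 2 ^ (i + 2))) b y)" if b: "b \<in> C" for b
  proof -
    have bj: "2 * 2 ^ i \<le> b $ j" "b $ j < 3 * 2 ^ i" for j using b by (auto simp: C_def)
    have "real_of_int \<bar>b $ j\<bar> \<le> real_of_int (3 * 2 ^ i)" for j
      unfolding of_int_le_iff using bj[of j] zero_less_power[of "2::int" i] by linarith
    then have lb: "linf b \<le> 3 * ?u" unfolding linf_le_iff by simp
    have Wle: "Wr g e \<le> Wr (4 * 2 ^ (i + 2)) ((\<lambda>x. x + b) ` e)" for e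
    proof -
      have inv: "(\<lambda>x. x + - b) ` (\<lambda>x. x + b) ` e = e" by (simp add: image_image)
      have "Wr g ((\<lambda>x. x + - b) ` (\<lambda>x. x + b) ` e) \<le> Wr (g + linf (- b)) ((\<lambda>x. x + b) ` e)"
        by (rule Wr_shift) fact
      also have "\<dots> \<le> Wr (4 * 2 ^ (i + 2)) ((\<lambda>x. x + b) ` e)"
        using g lb linf_nonneg[of b] by (intro Wr_mono) (auto simp: linf_minus intro: add_pos_nonneg)
      finally show ?thesis unfolding inv .
    qed
    have "(\<Sum>z\<in>box ?u. tau (Wr g) 0 z) \<le> (\<Sum>z\<in>box ?u. tau (Wr (4 * 2 ^ (i + 2))) (0 + b) (z + b))"
      unfolding tau_image[OF bij_add] using Wle g by (intro sum_mono tau_mono Wr_nonneg) auto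
    also have "\<dots> = (\<Sum>y\<in>(\<lambda>z. z + b) ` box ?u. tau (Wr (4 * 2 ^ (i + 2))) b y)"
      by (subst sum.reindex) (auto simp: inj_on_def)
    also have "\<dots> \<le> (\<Sum>y\<in>?Q. tau (Wr (4 * 2 ^ (i + 2))) b y)"
    proof (rule sum_mono2)
      show "(\<lambda>z. z + b) ` box ?u \<subseteq> ?Q"
      proof
        fix y assume "y \<in> (\<lambda>z. z + b) ` box ?u"
        then obtain z where y: "y = z + b" and z: "z \<in> box ?u" by blast
        have "0 \<le> y $ j \<and> y $ j < 2 ^ (i + 2)" for j
        proof -
          have "real_of_int \<bar>z $ j\<bar> \<le> real_of_int (2 ^ i)" using z by (simp add: box_def)
          then have "\<bar>z $ j\<bar> \<le> 2 ^ i" unfolding of_int_le_iff .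
          moreover have "y $ j = z $ j + b $ j" "(2 :: int) ^ (i + 2) = 4 * 2 ^ i" by (simp_all add: y)
          moreover have "0 < (2 :: int) ^ i" by simp
          ultimately show ?thesis using bj[of j] by (intro conjI) linarith+
        qed
        then show "y \<in> ?Q" by (simp add: cube_def)
      qed
    qed (auto intro: tau_Wr_nonneg)
    finally show ?thesis .
  qed
  have CQ: "C \<subseteq> ?Q"
  proof
    fix b assume "b \<in> C"
    then have bj: "2 * 2 ^ i \<le> b $ j" "b $ j < 3 * 2 ^ i" for j by (auto simp: C_def)
    have "0 \<le> b $ j \<and> b $ j < 2 ^ (i + 2)" for j
    proof -
      have "(2 :: int) ^ (i + 2) = 4 * 2 ^ i" "0 < (2 :: int) ^ i" by simp_all
      then show ?thesis using bj[of j] by (intro conjI) linarith+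
    qed
    then show "b \<in> ?Q" by (simp add: cube_def)
  qed
  have "real (card C) * (\<Sum>z\<in>box ?u. tau (Wr g) 0 z) \<le> (\<Sum>b\<in>C. \<Sum>y\<in>?Q. tau (Wr (4 * 2 ^ (i + 2))) b y)"
    by (rule sum_bounded_below) (rule each)
  also have "\<dots> \<le> (\<Sum>b\<in>?Q. \<Sum>y\<in>?Q. tau (Wr (4 * 2 ^ (i + 2))) b y)"
    using CQ by (intro sum_mono2 sum_nonneg) (auto intro: tau_Wr_nonneg)
  also have "\<dots> \<le> (2 * 163\<^sup>2 * (giant_const d \<alpha>)\<^sup>2 + 4) / q (i + 2)" by (rule sum_tau_cube_Wr_le)
  also have "\<dots> = (2 * 163\<^sup>2 * (giant_const d \<alpha>)\<^sup>2 + 4) * 3 / lam * (44 * ?u) powr D"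
    using lam by (simp add: sprinkle_rate_def powr_minus field_simps)
  also have "(44 * ?u) powr D = 44 powr D * (2 ^ (i * d) * 2 powr (real i * \<alpha>))"
    by (simp add: powr_mult powr_realpow[symmetric] powr_powr powr_add[symmetric] D_eq algebra_simps)
  finally have "2 ^ (i * d) * (\<Sum>z\<in>box ?u. tau (Wr g) 0 z) \<le> 2 ^ (i * d) * (local_const d \<alpha> * 2 powr (real i * \<alpha>) / lam)"
    by (simp add: cC local_const_def D_eq mult_ac)
  then show ?thesis by (rule mult_left_le_imp_le) simp
qed

end

section \<open>From the reduced kernel to the full kernel\<close>

definition ratio :: "nat \<Rightarrow> real \<Rightarrow> real" where
  "ratio d \<alpha> = 2 powr (\<alpha> - real d)"

definition boot_const :: "nat \<Rightarrow> real \<Rightarrow> real" where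
  "boot_const d \<alpha> = 2 powr (real d + \<alpha>) * local_const d \<alpha> * 3 ^ d * 2 powr \<alpha>"

text \<open>Number of scales above the observed box at which the hole begins, chosen so that
  restoring it costs at most half of the assumed bound. It depends on d and \<alpha> only.\<close>

definition gap :: "nat \<Rightarrow> real \<Rightarrow> nat" where
  "gap d \<alpha> = (LEAST s. boot_const d \<alpha> * ratio d \<alpha> ^ s / (1 - ratio d \<alpha>) \<le> 1 / 2)"

lemma ratio: "\<alpha> < real d \<Longrightarrow> 0 < ratio d \<alpha> \<and> ratio d \<alpha> < 1"
  unfolding ratio_def by (simp add: powr_less_one)

lemma gap:
  assumes "\<alpha> < real d"
  shows "boot_const d \<alpha> * ratio d \<alpha> ^ gap d \<alpha> / (1 - ratio d \<alpha>) \<le> 1 / 2"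
  unfolding gap_def
proof (rule LeastI_ex)
  have "(\<lambda>s. boot_const d \<alpha> * ratio d \<alpha> ^ s / (1 - ratio d \<alpha>)) \<longlonglongrightarrow> boot_const d \<alpha> * 0 / (1 - ratio d \<alpha>)"
    using ratio[OF assms] by (intro tendsto_intros LIMSEQ_realpow_zero) auto
  then have "\<forall>\<^sub>F s in sequentially. boot_const d \<alpha> * ratio d \<alpha> ^ s / (1 - ratio d \<alpha>) < 1 / 2"
    by (intro order_tendstoD(2)) auto
  then obtain s where "boot_const d \<alpha> * ratio d \<alpha> ^ s / (1 - ratio d \<alpha>) < 1 / 2"
    using eventually_sequentially by auto
  then show "\<exists>s. boot_const d \<alpha> * ratio d \<alpha> ^ s / (1 - ratio d \<alpha>) \<le> 1 / 2" by (auto intro: less_imp_le)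
qed

definition final_const :: "nat \<Rightarrow> real \<Rightarrow> real" where
  "final_const d \<alpha> = 2 * local_const d \<alpha> * 2 powr (real (gap d \<alpha>) * \<alpha>)"

lemma fin_edges_vertices:
  assumes "E \<in> fin_edges"
  shows "finite (\<Union>E)"
proof (rule finite_Union)
  fix e assume "e \<in> E"
  then have "card e = 2" using fin_edgesD(2)[OF assms] by (auto simp: pairs_def)
  then show "finite e" by (simp add: card_ge_0_finite)
qed (rule fin_edgesD(1)[OF assms])

context subcritical_kernel
begin

definition mass :: "nat \<Rightarrow> real" where
  "mass k = (\<Sum>z\<in>box (2 ^ k). tau W 0 z)"

lemma mass_nonneg: "0 \<le> mass k"
  unfolding mass_def by (intro sum_nonneg tau_nonneg W_nonneg)

text \<open>The least dyadic box containing both points has side comparable to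
  \<open>rad + 2 ^ m\<close>; at \<open>j = 0\<close> the offset takes the place of the radius. The
  majorant is a sum of products in \<open>z\<close> and \<open>u\<close>, so that the sums over the
  two ends of the hole edge factorise.\<close>

lemma hl_dyadic_le:
  assumes "z \<in> box (2 ^ (m + n))" "u \<in> box (2 ^ (m + n))"
  shows "hl (2 ^ m) {z, u} \<le> (\<Sum>j\<le>n. lam * 2 powr D * (2 ^ (m + j)) powr (- D)
      * (of_bool (z \<in> box (2 ^ (m + j))) * of_bool (u \<in> box (2 ^ (m + j)))))"
    (is "_ \<le> (\<Sum>j\<le>n. ?c j * ?b j)")
proof -
  define P where "P j \<longleftrightarrow> z \<in> box (2 ^ (m + j)) \<and> u \<in> box (2 ^ (m + j))" for j
  define j where "j = (LEAST j. P j)"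
  have "P n" using assms by (simp add: P_def)
  then have j: "P j" "j \<le> n" unfolding j_def by (rule LeastI, rule Least_le)
  have "2 ^ (m + j) / 2 \<le> rad {z, u} + 2 ^ m"
  proof (cases j)
    case 0
    have "0 \<le> rad {z, u}" by (simp add: rad_pair max_def linf_nonneg)
    then show ?thesis unfolding 0 by simp
  next
    case (Suc i)
    then have "\<not> P i" using not_less_Least[of i P] unfolding j_def by simp
    then have "2 ^ (m + i) \<le> rad {z, u}" by (auto simp: P_def box_linf rad_pair)
    then show ?thesis unfolding Suc by (simp add: add_increasing2)
  qed
  then have "(rad {z, u} + 2 ^ m) powr (- D) \<le> (2 ^ (m + j) / 2) powr (- D)"
    using D_ge by (intro powr_mono2') auto
  also have "\<dots> = 2 powr D * (2 ^ (m + j)) powr (- D)" by (simp add: powr_divide powr_minus_divide)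
  finally have "hl (2 ^ m) {z, u} \<le> ?c j * ?b j"
    using j(1) lam by (simp add: hole_def P_def mult.assoc)
  also have "\<dots> \<le> (\<Sum>j\<le>n. ?c j * ?b j)"
    using j(2) lam by (intro member_le_sum) auto
  finally show ?thesis .
qed

lemma sum_tau_box_le:
  assumes "k \<le> i"
  shows "(\<Sum>u\<in>box (2 ^ i). \<Sum>y\<in>box (2 ^ k). tau W u y) \<le> (3 * 2 ^ k) ^ d * mass (Suc i)"
proof -
  have "(\<Sum>u\<in>box (2 ^ i). tau W u y) \<le> mass (Suc i)" if y: "y \<in> box (2 ^ k)" for y
  proof -
    have "(\<Sum>u\<in>box (2 ^ i). tau W u y) = (\<Sum>u\<in>box (2 ^ i). tau W 0 (u - y))"
      using tau_shift[of 0 y] by (intro sum.cong refl) (metis add_0 diff_add_cancel tau_sym)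
    also have "\<dots> = (\<Sum>z\<in>(\<lambda>u. u - y) ` box (2 ^ i). tau W 0 z)"
      by (subst sum.reindex) (auto simp: inj_on_def)
    also have "\<dots> \<le> mass (Suc i)" unfolding mass_def
    proof (rule sum_mono2)
      have "(2 :: real) ^ k \<le> 2 ^ i" using assms by (intro power_increasing) auto
      then have "linf (u - y) \<le> 2 ^ Suc i" if "u \<in> box (2 ^ i)" for u
        using linf_triangle_diff[of u y] that y unfolding box_linf mem_Collect_eq power_Suc by linarith
      then show "(\<lambda>u. u - y) ` box (2 ^ i) \<subseteq> box (2 ^ Suc i)" by (auto simp: box_linf)
    qed (auto intro: tau_nonneg W_nonneg)
    finally show ?thesis .
  qed
  then have "(\<Sum>y\<in>box (2 ^ k). \<Sum>u\<in>box (2 ^ i). tau W u y) \<le> of_nat (card (box (2 ^ k) :: (int ^ 'd) set)) * mass (Suc i)"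
    by (rule sum_bounded_above)
  also have "\<dots> \<le> (3 * 2 ^ k) ^ d * mass (Suc i)"
    unfolding d_eq by (intro mult_right_mono card_box_le mass_nonneg) auto
  finally show ?thesis by (subst sum.swap)
qed

text \<open>The target box has radius \<open>2 ^ k\<close>, but the hole starts only
  \<open>gap\<close> scales higher. Below, the reduced kernel gives the bound directly; above, a
  hole edge at scale \<open>m + j\<close> contributes with weight
  \<open>ratio ^ (gap + j)\<close>.\<close>

lemma mass_bootstrap:
  assumes a: "\<And>k. mass k \<le> a * 2 powr (real k * \<alpha>)"
  shows "mass k \<le> (final_const d \<alpha> / 2 / lam + a / 2) * 2 powr (real k * \<alpha>)"
proof -
  define m where "m = k + gap d \<alpha>"
  let ?g = "2 ^ m :: real"
  let ?T = "\<lambda>w x y. tau w x y"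
  let ?\<rho> = "ratio d \<alpha>"
  have a0: "0 \<le> a" using order_trans[OF mass_nonneg a[of 0]] by simp
  have \<rho>: "0 < ?\<rho>" "?\<rho> < 1" using ratio[OF alpha(2)] by auto
  have loc: "(\<Sum>z\<in>box (2 ^ i). tau (Wr ?g) 0 z) \<le> local_const d \<alpha> * 2 powr (real i * \<alpha>) / lam" if "m \<le> i" for i
  proof (rule sum_tau_Wr_le)
    have "?g \<le> 2 ^ i" using that by (intro power_increasing) auto
    then show "?g \<le> 12 * 2 ^ i" using zero_le_power[of "2 :: real" i] by linarith
  qed simp
  have kbox: "(box (2 ^ k) :: (int ^ 'd) set) \<subseteq> box (2 ^ m)"
    by (intro box_mono power_increasing) (auto simp: m_def)
  have "(\<Sum>y\<in>box (2 ^ k). EE W (\<lambda>G. of_bool (conn G 0 y))) \<le> (final_const d \<alpha> / 2 / lam + a / 2) * 2 powr (real k * \<alpha>)"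
  proof (rule EE_sum_le[where E\<^sub>0 = "{}"])
    fix E :: "(int ^ 'd) set set" assume E: "E \<in> fin_edges"
    have fl: "finite (linf ` \<Union>E)" using fin_edges_vertices[OF E] by simp
    obtain n :: nat where n: "\<And>x. x \<in> \<Union>E \<Longrightarrow> linf x \<le> 2 ^ (m + n)"
    proof -
      obtain B where B: "\<And>x. x \<in> \<Union>E \<Longrightarrow> linf x \<le> B"
        using bdd_above_finite[OF fl] unfolding bdd_above_def by blast
      obtain n :: nat where "B < 2 ^ n" using real_arch_pow[of 2 B] by auto
      also have "(2 :: real) ^ n \<le> 2 ^ (m + n)" by (intro power_increasing) auto
      finally show ?thesis using that[of n] B by (meson less_imp_le order_trans)
    qed
    define V :: "(int ^ 'd) set" where "V = box (2 ^ (m + n))"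
    have V: "finite V" "\<Union>E \<subseteq> V" "0 \<in> V"
      unfolding V_def using n by (simp, auto simp: box_linf)
    let ?P = "\<lambda>w x y. pexp E w (\<lambda>G. of_bool (conn G x y)) :: real"
    let ?c = "\<lambda>j. lam * 2 powr D * (2 ^ (m + j)) powr (- D)"
    let ?b = "\<lambda>j z. of_bool (z \<in> box (2 ^ (m + j))) :: real"
    have Weq: "(\<lambda>e. Wr ?g e + hl ?g e) = W" by (simp add: Wr_def)
    have step: "?P W 0 y \<le> ?T (Wr ?g) 0 y + (\<Sum>z\<in>V. \<Sum>u\<in>V. ?T (Wr ?g) 0 z * (\<Sum>j\<le>n. ?c j * (?b j z * ?b j u)) * ?T W u y)" for y
    proof -
      have "?P W 0 y \<le> ?P (Wr ?g) 0 y + (\<Sum>z\<in>V. \<Sum>u\<in>V. ?P (Wr ?g) 0 z * hl ?g {z, u} * ?P W u y)"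
        using pexp_conn_le[OF fin_edgesD(1)[OF E], of "Wr ?g" "hl ?g" V 0 y] V Wr_nonneg[of ?g] lam
        unfolding Weq by (simp add: hole_nonneg)
      also have "\<dots> \<le> ?T (Wr ?g) 0 y + (\<Sum>z\<in>V. \<Sum>u\<in>V. ?T (Wr ?g) 0 z * (\<Sum>j\<le>n. ?c j * (?b j z * ?b j u)) * ?T W u y)"
      proof (intro add_mono sum_mono mult_mono)
        show "hl ?g {z, u} \<le> (\<Sum>j\<le>n. ?c j * (?b j z * ?b j u))" if "z \<in> V" "u \<in> V" for z u
          using that unfolding V_def by (rule hl_dyadic_le)
        have "0 \<le> (\<Sum>j\<le>n. ?c j * (?b j z * ?b j u))" for z u using lam by (intro sum_nonneg) auto
        then show "0 \<le> ?T (Wr ?g) 0 z * (\<Sum>j\<le>n. ?c j * (?b j z * ?b j u))" for z u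
          by (intro mult_nonneg_nonneg tau_Wr_nonneg) auto
      qed (use lam in \<open>auto intro!: pexp_conn_le_tau E W_nonneg Wr_nonneg hole_nonneg pexp_nonneg tau_Wr_nonneg\<close>)
      finally show ?thesis .
    qed
    have sum_b: "(\<Sum>z\<in>V. ?b j z * f z) = (\<Sum>z\<in>box (2 ^ (m + j)). f z)" if "j \<le> n" for j and f :: "int ^ 'd \<Rightarrow> real"
    proof -
      have "box (2 ^ (m + j)) \<subseteq> V" unfolding V_def using that by (intro box_mono power_increasing) auto
      then have "(\<Sum>z\<in>box (2 ^ (m + j)). f z) = (\<Sum>z\<in>V. if z \<in> box (2 ^ (m + j)) then f z else 0)"
        using V(1) by (simp add: sum.If_cases Int_absorb1)
      also have "\<dots> = (\<Sum>z\<in>V. ?b j z * f z)" by (rule sum.cong) auto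
      finally show ?thesis ..
    qed
    have "(\<Sum>y\<in>box (2 ^ k). ?P W 0 y) \<le> (\<Sum>y\<in>box (2 ^ k). ?T (Wr ?g) 0 y)
       + (\<Sum>y\<in>box (2 ^ k). \<Sum>z\<in>V. \<Sum>u\<in>V. ?T (Wr ?g) 0 z * (\<Sum>j\<le>n. ?c j * (?b j z * ?b j u)) * ?T W u y)"
      unfolding sum.distrib[symmetric] by (rule sum_mono) (rule step)
    also have "(\<Sum>y\<in>box (2 ^ k). \<Sum>z\<in>V. \<Sum>u\<in>V. ?T (Wr ?g) 0 z * (\<Sum>j\<le>n. ?c j * (?b j z * ?b j u)) * ?T W u y)
       = (\<Sum>j\<le>n. ?c j * ((\<Sum>z\<in>V. ?b j z * ?T (Wr ?g) 0 z) * (\<Sum>u\<in>V. ?b j u * (\<Sum>y\<in>box (2 ^ k). ?T W u y))))"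
    proof -
      have "(\<Sum>y\<in>box (2 ^ k). \<Sum>z\<in>V. \<Sum>u\<in>V. ?T (Wr ?g) 0 z * (\<Sum>j\<le>n. ?c j * (?b j z * ?b j u)) * ?T W u y)
        = (\<Sum>y\<in>box (2 ^ k). \<Sum>z\<in>V. \<Sum>u\<in>V. \<Sum>j\<le>n. ?c j * ((?b j z * ?T (Wr ?g) 0 z) * (?b j u * ?T W u y)))"
        by (simp only: sum_distrib_left sum_distrib_right mult_ac)
      also have "\<dots> = (\<Sum>j\<le>n. \<Sum>z\<in>V. \<Sum>u\<in>V. \<Sum>y\<in>box (2 ^ k). ?c j * ((?b j z * ?T (Wr ?g) 0 z) * (?b j u * ?T W u y)))"
        by (simp only: sum.swap[where A = "box (2 ^ k)"] sum.swap[where B = "{..n}"])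
      also have "\<dots> = (\<Sum>j\<le>n. ?c j * ((\<Sum>z\<in>V. ?b j z * ?T (Wr ?g) 0 z) * (\<Sum>u\<in>V. ?b j u * (\<Sum>y\<in>box (2 ^ k). ?T W u y))))"
        by (simp only: sum_distrib_left[symmetric] sum_distrib_right[symmetric])
      finally show ?thesis .
    qed
    also have "\<dots> \<le> (\<Sum>j\<le>n. boot_const d \<alpha> * a * 2 powr (real k * \<alpha>) * ?\<rho> ^ (gap d \<alpha>) * ?\<rho> ^ j)"
    proof (rule sum_mono)
      fix j assume "j \<in> {..n}"
      then have j: "j \<le> n" by simp
      have "?c j * ((\<Sum>z\<in>V. ?b j z * ?T (Wr ?g) 0 z) * (\<Sum>u\<in>V. ?b j u * (\<Sum>y\<in>box (2 ^ k). ?T W u y)))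
         = ?c j * ((\<Sum>z\<in>box (2 ^ (m + j)). ?T (Wr ?g) 0 z) * (\<Sum>u\<in>box (2 ^ (m + j)). \<Sum>y\<in>box (2 ^ k). ?T W u y))"
        by (simp only: sum_b[OF j])
      also have "\<dots> \<le> ?c j * ((local_const d \<alpha> * 2 powr (real (m + j) * \<alpha>) / lam) * ((3 * 2 ^ k) ^ d * (a * 2 powr (real (Suc (m + j)) * \<alpha>))))"
      proof (intro mult_left_mono mult_mono loc)
        have "(\<Sum>u\<in>box (2 ^ (m + j)). \<Sum>y\<in>box (2 ^ k). ?T W u y) \<le> (3 * 2 ^ k) ^ d * mass (Suc (m + j))"
          by (rule sum_tau_box_le) (simp add: m_def)
        also have "\<dots> \<le> (3 * 2 ^ k) ^ d * (a * 2 powr (real (Suc (m + j)) * \<alpha>))" by (intro mult_left_mono a) auto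
        finally show "(\<Sum>u\<in>box (2 ^ (m + j)). \<Sum>y\<in>box (2 ^ k). ?T W u y) \<le> (3 * 2 ^ k) ^ d * (a * 2 powr (real (Suc (m + j)) * \<alpha>))" .
      qed (use lam local_const_pos[of d \<alpha>] in \<open>auto intro!: sum_nonneg tau_nonneg W_nonneg\<close>)
      also have "\<dots> = boot_const d \<alpha> * a * 2 powr (real k * \<alpha>) * ?\<rho> ^ (gap d \<alpha>) * ?\<rho> ^ j"
      proof -
        have p2: "(2 :: real) ^ i = 2 powr real i" for i by (simp add: powr_realpow)
        have \<rho>p: "?\<rho> ^ i = 2 powr ((\<alpha> - real d) * real i)" for i
          unfolding ratio_def by (simp add: powr_realpow[symmetric] powr_powr)
        have e1: "(2 ^ (m + j)) powr (- D) = 2 powr (- real (m + j) * D)" unfolding p2 powr_powr by (simp only: mult_minus_left mult_minus_right)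
        have e2: "(3 * 2 ^ k :: real) ^ d = 3 ^ d * 2 powr (real k * real d)"
          by (simp add: power_mult_distrib p2 powr_realpow[symmetric] powr_powr)
        \<comment> \<open>The exponents are hole, reduced susceptibility, volume of the target box
          and full susceptibility; together they leave \<open>k * \<alpha>\<close> and a factor
          \<open>2 powr (\<alpha> - d)\<close> for each scale beyond \<open>k\<close>, up to a
          constant.\<close>
        have "2 powr (- real (m + j) * D) * 2 powr (real (m + j) * \<alpha>) * 2 powr (real k * real d) * 2 powr (real (Suc (m + j)) * \<alpha>)
            = 2 powr \<alpha> * 2 powr (real k * \<alpha>) * 2 powr ((\<alpha> - real d) * real (gap d \<alpha>)) * 2 powr ((\<alpha> - real d) * real j)"
          unfolding powr_add[symmetric] by (rule arg_cong[where f = "(powr) 2"]) (simp add: m_def D_eq algebra_simps)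
        note e3 = this
        have "lam * x * A1 * (c * A2 / lam * (t * A3 * (a * A4))) = x * c * t * a * (A1 * A2 * A3 * A4)"
          for x A1 c A2 t A3 A4 :: real using lam by simp
        then show ?thesis unfolding e1 e2 \<rho>p boot_const_def D_eq[symmetric] by (simp only: e3) simp
      qed
      finally show "?c j * ((\<Sum>z\<in>V. ?b j z * ?T (Wr ?g) 0 z) * (\<Sum>u\<in>V. ?b j u * (\<Sum>y\<in>box (2 ^ k). ?T W u y)))
         \<le> boot_const d \<alpha> * a * 2 powr (real k * \<alpha>) * ?\<rho> ^ (gap d \<alpha>) * ?\<rho> ^ j" .
    qed
    also have "\<dots> = boot_const d \<alpha> * a * 2 powr (real k * \<alpha>) * ?\<rho> ^ (gap d \<alpha>) * (\<Sum>j\<le>n. ?\<rho> ^ j)"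
      by (simp add: sum_distrib_left)
    also have "\<dots> \<le> boot_const d \<alpha> * a * 2 powr (real k * \<alpha>) * ?\<rho> ^ (gap d \<alpha>) * (1 / (1 - ?\<rho>))"
    proof (rule mult_left_mono)
      have "(1 - ?\<rho>) * (\<Sum>j\<le>n. ?\<rho> ^ j) = 1 - ?\<rho> ^ Suc n" by (rule sum_gp_basic)
      also have "\<dots> \<le> 1" using \<rho> by simp
      finally show "(\<Sum>j\<le>n. ?\<rho> ^ j) \<le> 1 / (1 - ?\<rho>)" using \<rho> by (simp add: field_simps)
      show "0 \<le> boot_const d \<alpha> * a * 2 powr (real k * \<alpha>) * ?\<rho> ^ (gap d \<alpha>)"
        using a0 \<rho> local_const_pos[of d \<alpha>] by (auto simp: boot_const_def)
    qed
    also have "\<dots> = (boot_const d \<alpha> * ?\<rho> ^ (gap d \<alpha>) / (1 - ?\<rho>)) * (a * 2 powr (real k * \<alpha>))" by simp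
    also have "\<dots> \<le> 1 / 2 * (a * 2 powr (real k * \<alpha>))"
      using a0 by (intro mult_right_mono gap alpha) auto
    finally have "(\<Sum>y\<in>box (2 ^ k). ?P W 0 y) \<le> (\<Sum>y\<in>box (2 ^ k). ?T (Wr ?g) 0 y) + 1 / 2 * (a * 2 powr (real k * \<alpha>))"
      by simp
    also have "(\<Sum>y\<in>box (2 ^ k). ?T (Wr ?g) 0 y) \<le> (\<Sum>y\<in>box (2 ^ m). ?T (Wr ?g) 0 y)"
      by (intro sum_mono2 kbox tau_Wr_nonneg) auto
    also have "\<dots> \<le> local_const d \<alpha> * 2 powr (real m * \<alpha>) / lam" by (rule loc) simp
    also have "\<dots> = final_const d \<alpha> / 2 / lam * 2 powr (real k * \<alpha>)"
      by (simp add: final_const_def m_def powr_add distrib_right)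
    finally show "(\<Sum>y\<in>box (2 ^ k). ?P W 0 y) \<le> (final_const d \<alpha> / 2 / lam + a / 2) * 2 powr (real k * \<alpha>)"
      by (simp add: algebra_simps)
  qed (auto intro: mono_of_conn W_nonneg)
  then show ?thesis by (simp add: mass_def tau_def)
qed

text \<open>The assumed \<open>a\<close> serves only to make the supremum finite; the halving in the
  bootstrap then removes it from the result.\<close>

lemma mass_le:
  assumes "\<And>k. mass k \<le> a * 2 powr (real k * \<alpha>)"
  shows "mass k \<le> final_const d \<alpha> / lam * 2 powr (real k * \<alpha>)"
proof -
  let ?r = "\<lambda>k. mass k / 2 powr (real k * \<alpha>)"
  let ?B = "final_const d \<alpha> / 2 / lam"
  define S where "S = (SUP k. ?r k)"
  have bdd: "bdd_above (range ?r)"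
    by (rule bdd_aboveI2[of _ _ a]) (use assms in \<open>simp add: pos_divide_le_eq\<close>)
  have "?r k \<le> S" for k unfolding S_def by (rule cSUP_upper[OF _ bdd]) simp
  then have S: "mass k \<le> S * 2 powr (real k * \<alpha>)" for k by (simp add: pos_divide_le_eq)
  have "?r k \<le> ?B + S / 2" for k using mass_bootstrap[OF S, of k] by (simp add: pos_divide_le_eq)
  then have "S \<le> ?B + S / 2" unfolding S_def by (intro cSUP_least) (auto simp: S_def)
  then have "S \<le> final_const d \<alpha> / lam" by simp
  then have "S * 2 powr (real k * \<alpha>) \<le> final_const d \<alpha> / lam * 2 powr (real k * \<alpha>)" by (intro mult_right_mono) auto
  with S[of k] show ?thesis by linarith
qed

end

section \<open>The law of long-range percolation\<close>

definition wt :: "('a \<Rightarrow> 'a \<Rightarrow> real) \<Rightarrow> real \<Rightarrow> 'a set \<Rightarrow> real" where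
  "wt J \<beta> e = (if e \<in> pairs then \<beta> * pair_weight J e else 0)"

lemma pair_weight_pair:
  assumes "x \<noteq> y" "\<And>x y. J x y = J y x"
  shows "pair_weight J {x, y} = J x y"
proof -
  define a where "a = (SOME z. z \<in> {x, y})"
  have a: "a \<in> {x, y}" unfolding a_def by (rule someI[of _ x]) simp
  define b where "b = (SOME z. z \<in> {x, y} \<and> z \<noteq> a)"
  have "\<exists>z. z \<in> {x, y} \<and> z \<noteq> a" using assms(1) a by auto
  then have b: "b \<in> {x, y} \<and> b \<noteq> a" unfolding b_def by (rule someI_ex)
  have "pair_weight J {x, y} = J a b" by (simp add: pair_weight_def Let_def a_def b_def)
  then show ?thesis using a b assms(2) by auto
qed

lemma pair_in_pairs [simp]: "{x, y} \<in> pairs \<longleftrightarrow> x \<noteq> y"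
  by (auto simp: pairs_def card_insert_if)

lemma wt_pair: "x \<noteq> y \<Longrightarrow> (\<And>x y. J x y = J y x) \<Longrightarrow> wt J \<beta> {x, y} = \<beta> * J x y"
  by (simp add: wt_def pair_weight_pair)

lemma wt_nonneg: "0 \<le> \<beta> \<Longrightarrow> (\<And>x y. 0 \<le> J x y) \<Longrightarrow> 0 \<le> wt J \<beta> e"
  by (simp add: wt_def pair_weight_def Let_def)

lemma wt_mono: "\<beta> \<le> \<beta>' \<Longrightarrow> (\<And>x y. 0 \<le> J x y) \<Longrightarrow> wt J \<beta> e \<le> wt J \<beta>' e"
  by (simp add: wt_def pair_weight_def Let_def mult_right_mono)

text \<open>The passage from points of the product space to the edge sets of the finite-volume
  calculus.\<close>

definition cfg :: "('a set \<Rightarrow> bool) \<Rightarrow> 'a set set" where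
  "cfg \<omega> = {e \<in> pairs. \<omega> e}"

lemma connected_in_cfg: "connected_in \<omega> x y \<longleftrightarrow> conn (cfg \<omega>) x y"
proof -
  have "adj \<omega> = adj (\<lambda>e. e \<in> cfg \<omega>)" by (auto simp: adj_def cfg_def)
  then show ?thesis by (simp add: conn_def connected_in_def)
qed

lemma space_lrp: "space (lrp J \<beta>) = PiE pairs (\<lambda>_. UNIV)"
  by (simp add: lrp_def space_PiM)

context
  fixes J :: "'a \<Rightarrow> 'a \<Rightarrow> real" and \<beta> :: real
  assumes J0: "\<And>x y. 0 \<le> J x y" and \<beta>0: "0 \<le> \<beta>"
begin

abbreviation "edge_law e \<equiv> measure_pmf (bernoulli_pmf (1 - exp (- \<beta> * pair_weight J e)))"

interpretation E: product_prob_space edge_law pairs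
  by unfold_locales

interpretation L: prob_space "lrp J \<beta>"
  unfolding lrp_def by (rule E.prob_space_axioms)

lemma prob_space_lrp: "prob_space (lrp J \<beta>)"
  by (rule L.prob_space_axioms)

lemma cfg_eq_emb:
  assumes "E \<in> fin_edges" "A \<subseteq> E"
  shows "{\<omega> \<in> space (lrp J \<beta>). cfg \<omega> \<inter> E = A} = prod_emb pairs edge_law E (PiE E (\<lambda>e. {e \<in> A}))"
  using fin_edgesD[OF assms(1)] assms(2)
  by (auto simp: prod_emb_def space_lrp cfg_def PiE_iff restrict_def extensional_def)

lemma cfg_sets [measurable]:
  assumes "E \<in> fin_edges"
  shows "{\<omega> \<in> space (lrp J \<beta>). cfg \<omega> \<inter> E = A} \<in> sets (lrp J \<beta>)"
proof (cases "A \<subseteq> E")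
  case True
  show ?thesis unfolding cfg_eq_emb[OF assms True] unfolding lrp_def
    by (rule sets_PiM_I) (use fin_edgesD[OF assms] in auto)
next
  case False
  then have *: "{\<omega> \<in> space (lrp J \<beta>). cfg \<omega> \<inter> E = A} = {}" by auto
  show ?thesis unfolding * by (rule sets.empty_sets)
qed

lemma measure_cfg_eq:
  assumes "E \<in> fin_edges" "A \<subseteq> E"
  shows "measure (lrp J \<beta>) {\<omega> \<in> space (lrp J \<beta>). cfg \<omega> \<inter> E = A}
    = (\<Prod>e\<in>E. if e \<in> A then 1 - exp (- wt J \<beta> e) else exp (- wt J \<beta> e))"
proof -
  note E = fin_edgesD[OF assms(1)]
  have "measure (lrp J \<beta>) {\<omega> \<in> space (lrp J \<beta>). cfg \<omega> \<inter> E = A} = (\<Prod>e\<in>E. measure (edge_law e) {e \<in> A})"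
    unfolding cfg_eq_emb[OF assms] unfolding lrp_def
    by (rule E.measure_PiM_emb) (use E in auto)
  also have "\<dots> = (\<Prod>e\<in>E. if e \<in> A then 1 - exp (- wt J \<beta> e) else exp (- wt J \<beta> e))"
  proof (rule prod.cong[OF refl])
    fix e assume "e \<in> E"
    then have "e \<in> pairs" using E by auto
    moreover have "0 \<le> \<beta> * pair_weight J e" using J0 \<beta>0 by (simp add: pair_weight_def Let_def)
    ultimately show "measure (edge_law e) {e \<in> A} = (if e \<in> A then 1 - exp (- wt J \<beta> e) else exp (- wt J \<beta> e))"
      by (simp add: measure_pmf_single wt_def)
  qed
  finally show ?thesis .
qed

lemma cylinder:
  assumes "E \<in> fin_edges"
  shows "{\<omega> \<in> space (lrp J \<beta>). P (cfg \<omega> \<inter> E)} \<in> sets (lrp J \<beta>)" (is "?S \<in> _")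
    and "measure (lrp J \<beta>) {\<omega> \<in> space (lrp J \<beta>). P (cfg \<omega> \<inter> E)} = pexp E (wt J \<beta>) (\<lambda>\<eta>. of_bool (P \<eta>))"
proof -
  let ?C = "\<lambda>A. {\<omega> \<in> space (lrp J \<beta>). cfg \<omega> \<inter> E = A}"
  let ?I = "{A \<in> Pow E. P A}"
  have fI: "finite ?I" using fin_edgesD(1)[OF assms] by simp
  have eq: "?S = (\<Union>A\<in>?I. ?C A)" by auto
  show "?S \<in> sets (lrp J \<beta>)" unfolding eq using fI cfg_sets[OF assms] by (intro sets.finite_UN) auto
  have "measure (lrp J \<beta>) ?S = (\<Sum>A\<in>?I. measure (lrp J \<beta>) (?C A))"
    unfolding eq by (rule L.finite_measure_finite_Union) (use fI cfg_sets[OF assms] in \<open>auto simp: disjoint_family_on_def\<close>)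
  also have "\<dots> = (\<Sum>A\<in>?I. \<Prod>e\<in>E. if e \<in> A then 1 - exp (- wt J \<beta> e) else exp (- wt J \<beta> e))"
    by (intro sum.cong refl measure_cfg_eq assms) auto
  also have "\<dots> = pexp E (wt J \<beta>) (\<lambda>\<eta>. of_bool (P \<eta>))"
    unfolding pexp_def using fin_edgesD(1)[OF assms] by (intro sum.mono_neutral_cong_left) auto
  finally show "measure (lrp J \<beta>) ?S = pexp E (wt J \<beta>) (\<lambda>\<eta>. of_bool (P \<eta>))" .
qed

end

section \<open>Connection events and infinite clusters under the percolation law\<close>

context
  fixes J :: "int ^ 'd::finite \<Rightarrow> int ^ 'd \<Rightarrow> real" and \<beta> :: real
  assumes J0: "\<And>x y. 0 \<le> J x y" and \<beta>0: "0 \<le> \<beta>"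
begin

interpretation L: prob_space "lrp J \<beta>"
  by (rule prob_space_lrp[OF J0 \<beta>0])

abbreviation "Om \<equiv> space (lrp J \<beta>)"

lemma conn_exhaust:
  fixes x y :: "int ^ 'd"
  assumes "conn (cfg \<omega>) x y"
  shows "\<exists>n::nat. conn (cfg \<omega> \<inter> pairs_in (box (real n))) x y"
  using assms
proof (induction rule: conn_induct)
  case (step y z)
  then obtain n where n: "conn (cfg \<omega> \<inter> pairs_in (box (real n))) x y" by blast
  obtain m :: nat where m: "max (linf y) (linf z) \<le> real m" using real_arch_simple by blast
  let ?N = "max m n"
  have "pairs_in (box (real n)) \<subseteq> pairs_in (box (real ?N) :: (int ^ 'd) set)"
    using box_mono[of "real n" "real ?N"] unfolding pairs_in_def by auto
  then have "conn (cfg \<omega> \<inter> pairs_in (box (real ?N))) x y"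
    by (intro conn_mono[OF _ n]) blast
  moreover have "conn (cfg \<omega> \<inter> pairs_in (box (real ?N))) y z"
    by (rule conn_edge) (use m step.hyps in \<open>auto simp: box_linf\<close>)
  ultimately show ?case by (blast intro: conn_trans)
qed auto

lemma connected_eq_UN:
  "{\<omega> \<in> Om. connected_in \<omega> x y} = (\<Union>n::nat. {\<omega> \<in> Om. conn (cfg \<omega> \<inter> pairs_in (box (real n))) x y})"
  unfolding connected_in_cfg using conn_exhaust by (auto intro: conn_mono)

lemma connected_sets: "{\<omega> \<in> Om. connected_in \<omega> x y} \<in> sets (lrp J \<beta>)"
  unfolding connected_eq_UN by (intro sets.countable_UN) (auto intro!: cylinder(1)[OF J0 \<beta>0])

text \<open>Every connection uses finitely many edges, so the event is the increasing union of its
  restrictions to boxes, whose probabilities are finite sums.\<close>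

lemma conn_prob_eq_tau: "conn_prob J \<beta> x y = tau (wt J \<beta>) x y"
proof (rule antisym)
  have w: "0 \<le> wt J \<beta> e" for e by (rule wt_nonneg[OF \<beta>0 J0])
  let ?A = "\<lambda>n::nat. {\<omega> \<in> Om. conn (cfg \<omega> \<inter> pairs_in (box (real n))) x y}"
  have fe: "pairs_in (box (real n)) \<in> (fin_edges :: (int ^ 'd) set set set)" for n :: nat by simp
  have "incseq ?A"
  proof (rule incseq_SucI)
    fix n
    have "pairs_in (box (real n)) \<subseteq> pairs_in (box (real (Suc n)) :: (int ^ 'd) set)"
      using box_mono[of "real n" "real (Suc n)"] unfolding pairs_in_def by auto
    then show "?A n \<subseteq> ?A (Suc n)" by (auto intro: conn_mono[rotated])
  qed
  then have "(\<lambda>n. measure (lrp J \<beta>) (?A n)) \<longlonglongrightarrow> measure (lrp J \<beta>) (\<Union>n. ?A n)"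
    by (intro L.finite_Lim_measure_incseq) (auto intro!: cylinder(1)[OF J0 \<beta>0])
  moreover have "measure (lrp J \<beta>) (?A n) \<le> tau (wt J \<beta>) x y" for n
  proof -
    have "measure (lrp J \<beta>) (?A n) = pexp (pairs_in (box (real n))) (wt J \<beta>) (\<lambda>\<eta>. of_bool (conn \<eta> x y))"
      by (rule cylinder(2)[OF J0 \<beta>0 fe])
    also have "\<dots> \<le> tau (wt J \<beta>) x y" by (rule pexp_conn_le_tau[OF fe w])
    finally show ?thesis .
  qed
  ultimately show "conn_prob J \<beta> x y \<le> tau (wt J \<beta>) x y"
    unfolding conn_prob_def connected_eq_UN by (intro LIMSEQ_le_const2) auto
  show "tau (wt J \<beta>) x y \<le> conn_prob J \<beta> x y"
    unfolding tau_def
  proof (rule EE_least[OF _ mono_of_conn fin_edges_empty w])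
    fix E :: "(int ^ 'd) set set" assume E: "E \<in> fin_edges"
    have "pexp E (wt J \<beta>) (\<lambda>\<omega>. of_bool (conn \<omega> x y)) = measure (lrp J \<beta>) {\<omega> \<in> Om. conn (cfg \<omega> \<inter> E) x y}"
      by (rule cylinder(2)[OF J0 \<beta>0 E, symmetric])
    also have "\<dots> \<le> conn_prob J \<beta> x y"
      unfolding conn_prob_def by (intro L.finite_measure_mono connected_sets) (auto simp: connected_in_cfg intro: conn_mono[rotated])
    finally show "pexp E (wt J \<beta>) (\<lambda>\<omega>. of_bool (conn \<omega> x y)) \<le> conn_prob J \<beta> x y" .
  qed
qed

definition escape :: "int ^ 'd \<Rightarrow> nat \<Rightarrow> ((int ^ 'd) set \<Rightarrow> bool) set" where
  "escape x n = {\<omega> \<in> Om. \<exists>y. y \<notin> box (real n) \<and> connected_in \<omega> x y}"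

lemma escape_sets: "escape x n \<in> sets (lrp J \<beta>)"
proof -
  have "escape x n = (\<Union>y\<in>- box (real n). {\<omega> \<in> Om. connected_in \<omega> x y})" by (auto simp: escape_def)
  then show ?thesis by (auto intro!: sets.countable_UN' connected_sets)
qed

lemma infinite_cluster_eq: "{\<omega> \<in> Om. infinite {y. connected_in \<omega> x y}} = (\<Inter>n. escape x n)"
proof -
  have "finite K \<longleftrightarrow> (\<exists>n::nat. K \<subseteq> box (real n))" for K :: "(int ^ 'd) set"
  proof
    assume "finite K"
    then have "finite (linf ` K)" by simp
    from bdd_above_finite[OF this] obtain B where B: "\<And>x. x \<in> K \<Longrightarrow> linf x \<le> B"
      unfolding bdd_above_def by blast
    obtain n :: nat where "B \<le> real n" using real_arch_simple by blast
    then have "K \<subseteq> box (real n)" using B order_trans by (auto simp: box_linf)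
    then show "\<exists>n::nat. K \<subseteq> box (real n)" ..
  qed (auto intro: finite_subset)
  then have "infinite K \<longleftrightarrow> (\<forall>n::nat. \<exists>y. y \<notin> box (real n) \<and> y \<in> K)" for K :: "(int ^ 'd) set" by blast
  then show ?thesis unfolding escape_def by auto
qed

lemma infinite_cluster_sets: "{\<omega> \<in> Om. infinite {y. connected_in \<omega> x y}} \<in> sets (lrp J \<beta>)"
  unfolding infinite_cluster_eq by (intro sets.countable_INT) (auto intro: escape_sets)

lemma has_infinite_cluster_sets: "{\<omega> \<in> Om. has_infinite_cluster \<omega>} \<in> sets (lrp J \<beta>)"
proof -
  have "{\<omega> \<in> Om. has_infinite_cluster \<omega>} = (\<Union>x. {\<omega> \<in> Om. infinite {y. connected_in \<omega> x y}})"
    by (auto simp: has_infinite_cluster_def)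
  then show ?thesis by (auto intro!: sets.countable_UN' infinite_cluster_sets)
qed

text \<open>Without an infinite cluster the probability that the origin reaches beyond radius
  \<open>M\<close> tends to 0. It bounds the two-point function off a fixed box, whose own
  contribution is negligible in large volume; \<open>3 ^ d\<close> compensates for
  \<open>card_box_le\<close>.\<close>

lemma no_percolation_sum:
  assumes np: "measure (lrp J \<beta>) {\<omega> \<in> Om. has_infinite_cluster \<omega>} = 0" and \<epsilon>: "0 < \<epsilon>"
  shows "\<exists>n\<ge>k. (\<Sum>z\<in>box (2 ^ n). tau (wt J \<beta>) 0 z) < \<epsilon> * 2 ^ (n * CARD('d))"
proof -
  let ?d = "CARD('d)"
  let ?P = "measure (lrp J \<beta>)"
  have "?P {\<omega> \<in> Om. infinite {y. connected_in \<omega> 0 y}} \<le> ?P {\<omega> \<in> Om. has_infinite_cluster \<omega>}"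
    by (intro L.finite_measure_mono has_infinite_cluster_sets) (auto simp: has_infinite_cluster_def)
  then have "?P (\<Inter>n. escape 0 n) = 0" using np measure_nonneg[of "lrp J \<beta>"] by (metis infinite_cluster_eq antisym)
  moreover have "decseq (escape 0)"
  proof (rule decseq_SucI)
    fix n show "escape 0 (Suc n) \<subseteq> escape 0 n"
      using box_mono[of "real n" "real (Suc n)"] by (auto simp: escape_def)
  qed
  then have "(\<lambda>n. ?P (escape 0 n)) \<longlonglongrightarrow> ?P (\<Inter>n. escape 0 n)"
    by (intro L.finite_Lim_measure_decseq) (auto intro: escape_sets)
  ultimately have "\<forall>\<^sub>F n in sequentially. ?P (escape 0 n) < \<epsilon> / (2 * 3 ^ ?d)"
    using \<epsilon> by (intro order_tendstoD(2)) auto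
  then obtain M where M: "?P (escape 0 M) < \<epsilon> / (2 * 3 ^ ?d)" using eventually_sequentially by auto
  let ?B = "real (card (box (real M) :: (int ^ 'd) set))"
  obtain m :: nat where m: "2 * ?B / \<epsilon> < 2 ^ m" using real_arch_pow[of 2] by auto
  define n where "n = max k m"
  have le: "tau (wt J \<beta>) 0 z \<le> of_bool (z \<in> box (real M)) + ?P (escape 0 M)" for z
  proof (cases "z \<in> box (real M)")
    case True
    have "tau (wt J \<beta>) 0 z \<le> 1" unfolding conn_prob_eq_tau[symmetric] conn_prob_def by (rule L.prob_le_1)
    also have "\<dots> \<le> 1 + ?P (escape 0 M)" by simp
    finally show ?thesis using True by simp
  next
    case False
    then have "tau (wt J \<beta>) 0 z \<le> ?P (escape 0 M)"
      unfolding conn_prob_eq_tau[symmetric] conn_prob_def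
      by (intro L.finite_measure_mono escape_sets) (auto simp: escape_def)
    then show ?thesis using False by simp
  qed
  have "(\<Sum>z\<in>box (2 ^ n). tau (wt J \<beta>) 0 z) \<le> (\<Sum>z\<in>(box (2 ^ n) :: (int ^ 'd) set). of_bool (z \<in> box (real M)) + ?P (escape 0 M))"
    by (rule sum_mono) (rule le)
  also have "\<dots> = (\<Sum>z\<in>(box (2 ^ n) :: (int ^ 'd) set). of_bool (z \<in> box (real M))) + real (card (box (2 ^ n) :: (int ^ 'd) set)) * ?P (escape 0 M)"
    by (simp add: sum.distrib)
  also have "(\<Sum>z\<in>(box (2 ^ n) :: (int ^ 'd) set). of_bool (z \<in> box (real M)) :: real) \<le> ?B"
    by (simp add: sum.If_cases of_bool_def card_mono)
  also have "real (card (box (2 ^ n) :: (int ^ 'd) set)) * ?P (escape 0 M) \<le> (3 * 2 ^ n) ^ ?d * (\<epsilon> / (2 * 3 ^ ?d))"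
    using M by (intro mult_mono card_box_le) auto
  also have "(3 * 2 ^ n) ^ ?d * (\<epsilon> / (2 * 3 ^ ?d)) = \<epsilon> / 2 * 2 ^ (n * ?d)"
    by (simp add: power_mult_distrib power_mult)
  finally have 1: "(\<Sum>z\<in>box (2 ^ n). tau (wt J \<beta>) 0 z) \<le> ?B + \<epsilon> / 2 * 2 ^ (n * ?d)" by simp
  have "(2 :: real) ^ m \<le> 2 ^ (n * ?d)"
  proof (rule power_increasing)
    have "m \<le> n * 1" by (simp add: n_def)
    also have "\<dots> \<le> n * ?d" by (intro mult_le_mono) (auto simp: Suc_le_eq)
    finally show "m \<le> n * ?d" .
  qed simp
  with m have "2 * ?B / \<epsilon> < 2 ^ (n * ?d)" by linarith
  then have "?B < \<epsilon> / 2 * 2 ^ (n * ?d)" using \<epsilon> by (simp add: field_simps)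
  with 1 have "(\<Sum>z\<in>box (2 ^ n). tau (wt J \<beta>) 0 z) < \<epsilon> * 2 ^ (n * ?d)" by linarith
  then show ?thesis by (intro exI[of _ n]) (simp add: n_def)
qed

text \<open>A bounded susceptibility makes the connection probabilities from \<open>x\<close>
  summable, so Borel-Cantelli leaves only finitely many points connected to \<open>x\<close>,
  simultaneously for the countably many \<open>x\<close>.\<close>

lemma finite_clusters:
  assumes B: "\<And>x L. finite L \<Longrightarrow> (\<Sum>z\<in>L. tau (wt J \<beta>) x z) \<le> B"
  shows "measure (lrp J \<beta>) {\<omega> \<in> Om. has_infinite_cluster \<omega>} = 0"
proof -
  have "AE \<omega> in lrp J \<beta>. finite {y. connected_in \<omega> x y}" for x
  proof -
    define A where "A n = (if n \<in> range (to_nat :: int ^ 'd \<Rightarrow> nat) then {\<omega> \<in> Om. connected_in \<omega> x (from_nat n)} else {})" for n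
    have "summable (\<lambda>n. measure (lrp J \<beta>) (A n))"
    proof (rule summableI_nonneg_bounded)
      fix N
      let ?L = "{y :: int ^ 'd. to_nat y < N}"
      have fL: "finite ?L"
        using finite_imageD[of to_nat ?L] finite_subset[of "to_nat ` ?L" "{..<N}"] by (auto simp: inj_on_def)
      have "(\<Sum>n<N. measure (lrp J \<beta>) (A n)) = (\<Sum>n\<in>to_nat ` ?L. measure (lrp J \<beta>) (A n))"
        by (rule sum.mono_neutral_right) (auto simp: A_def)
      also have "\<dots> = (\<Sum>y\<in>?L. measure (lrp J \<beta>) (A (to_nat y)))"
        by (subst sum.reindex) (auto simp: inj_on_def)
      also have "\<dots> = (\<Sum>y\<in>?L. tau (wt J \<beta>) x y)"
        by (simp add: A_def conn_prob_def conn_prob_eq_tau[symmetric])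
      also have "\<dots> \<le> B" by (rule B[OF fL])
      finally show "(\<Sum>n<N. measure (lrp J \<beta>) (A n)) \<le> B" .
    qed simp
    then have "AE \<omega> in lrp J \<beta>. \<forall>\<^sub>F n in sequentially. \<omega> \<in> space (lrp J \<beta>) - A n"
      by (intro borel_cantelli_AE1) (auto simp: A_def L.emeasure_eq_measure connected_sets)
    then show ?thesis
    proof (rule AE_mp, intro AE_I2 impI)
      fix \<omega> assume \<omega>: "\<omega> \<in> Om" and "\<forall>\<^sub>F n in sequentially. \<omega> \<in> space (lrp J \<beta>) - A n"
      then obtain N where N: "\<And>n. N \<le> n \<Longrightarrow> \<omega> \<notin> A n" unfolding eventually_sequentially by blast
      have "to_nat y < N" if "connected_in \<omega> x y" for y
        using N[of "to_nat y"] that \<omega> by (force simp: A_def not_le)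
      then have "to_nat ` {y. connected_in \<omega> x y} \<subseteq> {..<N}" by auto
      then have "finite (to_nat ` {y. connected_in \<omega> x y})" by (rule finite_subset) simp
      then show "finite {y. connected_in \<omega> x y}" by (rule finite_imageD) simp
    qed
  qed
  then have "AE \<omega> in lrp J \<beta>. \<forall>x. finite {y. connected_in \<omega> x y}" by (simp add: AE_all_countable)
  then have "AE \<omega> in lrp J \<beta>. \<not> has_infinite_cluster \<omega>" by (auto simp: has_infinite_cluster_def)
  then show ?thesis using L.prob_eq_0[OF has_infinite_cluster_sets] by simp
qed

end

section \<open>Subcriticality at small \<open>\<beta>\<close>\<close>

lemma pexp_zero: "finite E \<Longrightarrow> pexp E (\<lambda>_. 0) f = f {}"
  by (induction E arbitrary: f rule: finite_induct) (auto simp: pexp_insert)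

lemma conn_empty [simp]: "conn {} x y \<longleftrightarrow> x = y"
  by (auto simp: conn_def connected_in_def adj_def)

text \<open>Comparison with a branching process of mean offspring \<open>r\<close>: with weaker
  weight 0 the conditioned cluster in \<open>pexp_conn_le\<close> is the single point
  \<open>x\<close>, and the estimate becomes a recursion over the first step.\<close>

lemma sum_tau_le_geometric:
  fixes w :: "'a set \<Rightarrow> real"
  assumes w: "\<And>e. 0 \<le> w e" and r: "r < 1"
    and sum: "\<And>x V. finite V \<Longrightarrow> (\<Sum>u\<in>V. w {x, u}) \<le> r" and L: "finite L"
  shows "(\<Sum>y\<in>L. tau w x y) \<le> 1 / (1 - r)"
  unfolding tau_def
proof (rule EE_sum_le[where E\<^sub>0 = "{}"])
  fix E :: "'a set set" assume E: "E \<in> fin_edges"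
  define V where "V = insert x (L \<union> \<Union>E)"
  have V: "finite V" "\<Union>E \<subseteq> V" "x \<in> V" "L \<subseteq> V" using fin_edges_vertices[OF E] L by (auto simp: V_def)
  let ?P = "\<lambda>x y. pexp E w (\<lambda>\<omega>. of_bool (conn \<omega> x y)) :: real"
  \<comment> \<open>In finite volume the supremum of the susceptibilities is a maximum, hence
    finite, and \<open>X \<le> 1 + r * X\<close> can be solved for \<open>X\<close>.\<close>
  define X where "X = Max ((\<lambda>x. \<Sum>y\<in>V. ?P x y) ` V)"
  have le: "(\<Sum>y\<in>V. ?P x y) \<le> X" if "x \<in> V" for x unfolding X_def using that V by (intro Max_ge) auto
  have P0: "0 \<le> ?P x y" for x y by (intro pexp_nonneg w) auto
  have X0: "0 \<le> X" using le[OF V(3)] sum_nonneg[of V "?P x"] P0 by (meson order_trans)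
  have "(\<Sum>y\<in>V. ?P x y) \<le> 1 + r * X" if x: "x \<in> V" for x
  proof -
    have "?P x y \<le> of_bool (x = y) + (\<Sum>u\<in>V. w {x, u} * ?P u y)" if y: "y \<in> V" for y
    proof -
      have "?P x y \<le> of_bool (x = y) + (\<Sum>z\<in>V. \<Sum>u\<in>V. of_bool (x = z) * w {z, u} * ?P u y)"
        using pexp_conn_le[OF fin_edgesD(1)[OF E], of "\<lambda>_. 0" w V x y] V x w
        by (simp add: pexp_zero[OF fin_edgesD(1)[OF E]])
      also have "(\<Sum>z\<in>V. \<Sum>u\<in>V. of_bool (x = z) * w {z, u} * ?P u y) = (\<Sum>z\<in>V. if x = z then \<Sum>u\<in>V. w {z, u} * ?P u y else 0)"
        by (rule sum.cong) auto
      also have "\<dots> = (\<Sum>u\<in>V. w {x, u} * ?P u y)" using V x by simp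
      finally show ?thesis .
    qed
    then have "(\<Sum>y\<in>V. ?P x y) \<le> (\<Sum>y\<in>V. of_bool (x = y) + (\<Sum>u\<in>V. w {x, u} * ?P u y))" by (rule sum_mono)
    also have "\<dots> = 1 + (\<Sum>u\<in>V. w {x, u} * (\<Sum>y\<in>V. ?P u y))"
      using V x by (simp add: sum.distrib of_bool_def sum_distrib_left) (rule sum.swap)
    also have "\<dots> \<le> 1 + (\<Sum>u\<in>V. w {x, u} * X)" by (intro add_left_mono sum_mono mult_left_mono le w)
    also have "\<dots> = 1 + (\<Sum>u\<in>V. w {x, u}) * X" by (simp add: sum_distrib_right)
    also have "\<dots> \<le> 1 + r * X" by (intro add_left_mono mult_right_mono sum V X0)
    finally show ?thesis .
  qed
  then have "X \<le> 1 + r * X" unfolding X_def using V by (intro Max.boundedI) (auto simp: X_def)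
  then have "X \<le> 1 / (1 - r)" using r by (simp add: field_simps)
  moreover have "(\<Sum>y\<in>L. ?P x y) \<le> (\<Sum>y\<in>V. ?P x y)" using V P0 by (intro sum_mono2) auto
  ultimately show "(\<Sum>y\<in>L. ?P x y) \<le> 1 / (1 - r)" using le[OF V(3)] by linarith
qed (auto intro: mono_of_conn w L)

section \<open>From two parameters to the critical one\<close>

lemma wt_shift:
  assumes "kernel_ok J"
  shows "wt J \<beta> ((\<lambda>x. x + b) ` e) = wt J \<beta> e"
proof (cases "e \<in> pairs")
  case True
  then obtain x y where e: "e = {x, y}" "x \<noteq> y" by (auto simp: pairs_def card_2_iff)
  have sym: "J x y = J y x" and tr: "J x y = J 0 (y - x)" for x y
    using assms unfolding kernel_ok_def by blast+
  have "J (x + b) (y + b) = J x y" using tr[of "x + b" "y + b"] tr[of x y] by simp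
  then show ?thesis using e sym by (simp add: wt_pair)
next
  case False
  then have "(\<lambda>x. x + b) ` e \<notin> pairs" by (simp add: pairs_def card_2_image_add)
  then show ?thesis using False by (simp add: wt_def)
qed

text \<open>The locale is used twice. At \<open>\<beta>'\<close>, the hole is paid for by the
  difference \<open>\<beta>' - \<beta>\<close>, which yields a bound at \<open>\<beta>\<close> with
  a constant that blows up as the parameters approach. It is only the input that makes the bootstrap
  at \<open>\<beta>\<close> legitimate, whose constant involves \<beta> alone.\<close>

lemma two_point_sum_le:
  fixes J :: "int ^ 'd::finite \<Rightarrow> int ^ 'd \<Rightarrow> real"
  defines "d \<equiv> CARD('d)"
  assumes alpha: "0 < \<alpha>" "\<alpha> < real d" and J: "kernel_ok J" and c: "0 < c"
    and Jc: "\<And>x y. x \<noteq> y \<Longrightarrow> c * linf (x - y) powr (- real d - \<alpha>) \<le> J x y"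
    and \<beta>: "0 < \<beta>" "\<beta> < \<beta>'"
    and np: "measure (lrp J \<beta>') {\<omega> \<in> space (lrp J \<beta>'). has_infinite_cluster \<omega>} = 0"
  shows "(\<Sum>z\<in>box (2 ^ k). tau (wt J \<beta>) 0 z)
    \<le> final_const d \<alpha> * 2 powr (real d + \<alpha>) / (c * \<beta>) * 2 powr (real k * \<alpha>)"
proof -
  let ?D = "real d + \<alpha>"
  have J0: "0 \<le> J x y" and sym: "J x y = J y x" for x y using J unfolding kernel_ok_def by blast+
  have exponent: "- real d - \<alpha> = - ?D" by simp
  let ?lam = "(\<beta>' - \<beta>) * c / 2 powr ?D"
  have wt_ge: "t * c * linf (x - y) powr (- ?D) \<le> wt J t {x, y}" if "x \<noteq> y" "0 \<le> t" for x y t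
  proof -
    have "wt J t {x, y} = t * J x y" by (rule wt_pair[OF that(1) sym])
    then show ?thesis
      using mult_left_mono[OF Jc[OF that(1)] that(2)] unfolding exponent by (simp add: mult.assoc)
  qed
  interpret A: subcritical_kernel "wt J \<beta>'" \<alpha> ?lam ?D d
  proof
    show "\<exists>n\<ge>k. (\<Sum>z\<in>box (2 ^ n). tau (wt J \<beta>') 0 z) < \<epsilon> * 2 ^ (n * d)" if "0 < \<epsilon>" for \<epsilon> k
      unfolding d_def by (rule no_percolation_sum[OF J0 _ np that]) (use \<beta> in simp)
    show "?lam * 2 powr ?D * linf (x - y) powr (- ?D) \<le> wt J \<beta>' {x, y}" if "x \<noteq> y" for x y
    proof -
      have "?lam * 2 powr ?D * linf (x - y) powr (- ?D) = (\<beta>' - \<beta>) * c * linf (x - y) powr (- ?D)" by simp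
      also have "\<dots> \<le> \<beta>' * c * linf (x - y) powr (- ?D)" using \<beta> c by (intro mult_right_mono) auto
      also have "\<dots> \<le> wt J \<beta>' {x, y}" using \<beta> by (intro wt_ge that) auto
      finally show ?thesis .
    qed
  qed (use alpha \<beta> c J J0 in \<open>auto simp: d_def wt_shift intro: wt_nonneg\<close>)
  \<comment> \<open>With offset 1 the hole still lies below the part
    \<open>(\<beta>' - \<beta>) * J\<close> of the kernel, so the reduced kernel at
    \<open>\<beta>'\<close> dominates the full kernel at \<open>\<beta>\<close>.\<close>
  have prior: "(\<Sum>z\<in>box (2 ^ k). tau (wt J \<beta>) 0 z) \<le> local_const d \<alpha> / ?lam * 2 powr (real k * \<alpha>)" for k
  proof -
    have "wt J \<beta> e \<le> A.Wr 1 e" for e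
    proof (cases "e \<in> pairs")
      case True
      then obtain x y where e: "e = {x, y}" "x \<noteq> y" by (auto simp: pairs_def card_2_iff)
      have "hole ?D ?lam 1 {x, y} \<le> ?lam * 2 powr ?D * linf (x - y) powr (- ?D)"
        using A.lam alpha by (intro hole_le e) auto
      also have "\<dots> = (\<beta>' - \<beta>) * c * linf (x - y) powr (- ?D)" by simp
      also have "\<dots> \<le> wt J (\<beta>' - \<beta>) {x, y}" using \<beta> by (intro wt_ge e) auto
      also have "\<dots> = wt J \<beta>' {x, y} - wt J \<beta> {x, y}" using wt_pair[OF e(2) sym] by (simp add: algebra_simps)
      finally show ?thesis by (simp add: A.Wr_def e(1))
    qed (simp add: A.Wr_def hole_def wt_def pairs_def)
    then have "(\<Sum>z\<in>box (2 ^ k). tau (wt J \<beta>) 0 z) \<le> (\<Sum>z\<in>box (2 ^ k). tau (A.Wr 1) 0 z)"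
      using \<beta> J0 by (intro sum_mono tau_mono wt_nonneg) auto
    also have "\<dots> \<le> local_const d \<alpha> * 2 powr (real k * \<alpha>) / ?lam"
    proof (rule A.sum_tau_Wr_le)
      show "1 \<le> 12 * (2 :: real) ^ k" using one_le_power[of "2 :: real" k] by linarith
    qed simp
    finally show ?thesis by (simp only: times_divide_eq_left)
  qed
  interpret B: subcritical_kernel "wt J \<beta>" \<alpha> "\<beta> * c / 2 powr ?D" ?D d
  proof
    show "\<exists>n\<ge>k. (\<Sum>z\<in>box (2 ^ n). tau (wt J \<beta>) 0 z) < \<epsilon> * 2 ^ (n * d)" if eps: "0 < \<epsilon>" for \<epsilon> k
    proof -
      obtain n where n: "n \<ge> k" "(\<Sum>z\<in>box (2 ^ n). tau (wt J \<beta>') 0 z) < \<epsilon> * 2 ^ (n * d)"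
        using A.no_percolation[OF eps] by blast
      have "(\<Sum>z\<in>box (2 ^ n). tau (wt J \<beta>) 0 z) \<le> (\<Sum>z\<in>box (2 ^ n). tau (wt J \<beta>') 0 z)"
        using \<beta> J0 by (intro sum_mono tau_mono wt_nonneg wt_mono) auto
      with n show ?thesis by force
    qed
    show "\<beta> * c / 2 powr ?D * 2 powr ?D * linf (x - y) powr (- ?D) \<le> wt J \<beta> {x, y}" if "x \<noteq> y" for x y
      using wt_ge[OF that, of \<beta>] \<beta> by simp
  qed (use alpha \<beta> c J J0 in \<open>auto simp: d_def wt_shift intro: wt_nonneg\<close>)
  have "B.mass k \<le> final_const d \<alpha> / (\<beta> * c / 2 powr ?D) * 2 powr (real k * \<alpha>)"
    by (rule B.mass_le[where a = "local_const d \<alpha> / ?lam"]) (use prior in \<open>simp add: B.mass_def\<close>)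
  then show ?thesis by (simp add: B.mass_def mult.commute)
qed

lemma pexp_wt_tendsto:
  "((\<lambda>\<beta>. pexp E (wt J \<beta>) f) \<longlongrightarrow> pexp E (wt J b) f) (at_left b)"
proof -
  have "((\<lambda>\<beta>. wt J \<beta> e) \<longlongrightarrow> wt J b e) (at_left b)" for e
    unfolding wt_def by (cases "e \<in> pairs") (auto intro!: tendsto_intros)
  then have "((\<lambda>\<beta>. if e \<in> G then 1 - exp (- wt J \<beta> e) else exp (- wt J \<beta> e))
      \<longlongrightarrow> (if e \<in> G then 1 - exp (- wt J b e) else exp (- wt J b e))) (at_left b)" for e G
    by (cases "e \<in> G") (auto intro!: tendsto_intros)
  then show ?thesis unfolding pexp_def by (intro tendsto_sum tendsto_mult tendsto_prod tendsto_const)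
qed

theorem theorem1p1:
  fixes \<alpha> :: real
  assumes "0 < \<alpha>" and "\<alpha> < real CARD('d::finite)"
  shows "\<exists>A::real. \<forall>(J :: int ^ 'd \<Rightarrow> int ^ 'd \<Rightarrow> real) (c::real).
           kernel_ok J \<and> c > 0 \<and>
           (\<forall>x y. x \<noteq> y \<longrightarrow> J x y \<ge> c * linf (x - y) powr (- real CARD('d) - \<alpha>))
           \<longrightarrow> (\<forall>r::real. r \<ge> 1 \<longrightarrow>
                 (1 / real (card (box r :: (int ^ 'd) set))) * (\<Sum>x\<in>box r. conn_prob J (beta_c J) 0 x)
                 \<le> A / (c * beta_c J) * r powr (- real CARD('d) + \<alpha>))"
proof -
  let ?d = "CARD('d)"
  define K where "K = final_const ?d \<alpha> * 2 powr (real ?d + \<alpha>)"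
  have K: "0 < K" using local_const_pos by (simp add: K_def final_const_def)
  have "(1 / real (card (box r :: (int ^ 'd) set))) * (\<Sum>x\<in>box r. conn_prob J (beta_c J) 0 x)
       \<le> K * 2 powr \<alpha> / (c * beta_c J) * r powr (- real ?d + \<alpha>)"
    if J: "kernel_ok J" and c: "0 < c"
      and Jc: "\<And>x y. x \<noteq> y \<Longrightarrow> c * linf (x - y) powr (- real ?d - \<alpha>) \<le> J x y" and r: "1 \<le> r"
    for J :: "int ^ 'd \<Rightarrow> int ^ 'd \<Rightarrow> real" and c r :: real
  proof -
    have J0: "0 \<le> J x y" and sym: "J x y = J y x" and tr: "J x y = J 0 (y - x)" for x y
      using J unfolding kernel_ok_def by blast+
    have summ: "J 0 summable_on UNIV" using J unfolding kernel_ok_def by blast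
    have tau0: "0 \<le> tau (wt J \<beta>) x y" if "0 \<le> \<beta>" for \<beta> x y
      using that J0 by (intro tau_nonneg wt_nonneg)
    let ?perc = "\<lambda>\<beta>. measure (lrp J \<beta>) {\<omega> \<in> space (lrp J \<beta>). has_infinite_cluster \<omega>}"
    let ?b = "beta_c J"
    define S where "S = {\<beta>. \<beta> \<ge> 0 \<and> ?perc \<beta> > 0}"
    have b: "?b = Inf S" by (simp add: beta_c_def S_def)
    have zero: "?perc \<beta> = 0" if "0 \<le> \<beta>" "\<beta> \<notin> S" for \<beta>
      using that measure_nonneg[of "lrp J \<beta>"] by (auto simp: S_def not_less intro: antisym)
    have bound: "(\<Sum>z\<in>box (2 ^ k). tau (wt J \<beta>) 0 z) \<le> K / (c * \<beta>) * 2 powr (real k * \<alpha>)"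
      if "0 < \<beta>" "\<beta> < \<beta>'" "\<beta>' \<notin> S" for \<beta> \<beta>' k
      using two_point_sum_le[OF assms J c Jc that(1,2) zero] that unfolding K_def by simp
    \<comment> \<open>At \<open>2 * K / c\<close> the bound on the box of radius 1 would be 1/2,
      although the origin alone contributes 1.\<close>
    have ne: "S \<noteq> {}"
    proof
      assume "S = {}"
      define \<beta> where "\<beta> = 2 * K / c"
      have \<beta>: "0 < \<beta>" using K c by (simp add: \<beta>_def)
      have "1 \<le> tau (wt J \<beta>) 0 (0 :: int ^ 'd)" using \<beta> J0 by (intro tau_refl_ge wt_nonneg) auto
      also have "\<dots> \<le> (\<Sum>z\<in>box (2 ^ 0). tau (wt J \<beta>) 0 z)"
        using \<beta> by (intro member_le_sum) (auto intro: tau0)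
      also have "\<dots> \<le> K / (c * \<beta>)" using bound[of \<beta> "\<beta> + 1" 0] \<beta> \<open>S = {}\<close> by simp
      also have "\<dots> = 1 / 2" using K c by (simp add: \<beta>_def)
      finally show False by simp
    qed
    define s where "s = infsum (J 0) UNIV"
    have s0: "0 \<le> s" unfolding s_def by (rule infsum_nonneg) (rule J0)
    \<comment> \<open>Below this value the expected degree is at most 1/2, and the branching bound
      excludes infinite clusters. A positive \<open>beta_c\<close> is needed for the limit of
      \<open>K / (c * \<beta>)\<close>.\<close>
    have small: "1 / (2 * (s + 1)) \<le> \<beta>" if "\<beta> \<in> S" for \<beta>
    proof (rule ccontr)
      assume "\<not> ?thesis"
      then have lt: "\<beta> * (2 * (s + 1)) < 1" using s0 by (simp add: field_simps not_le)
      have \<beta>0: "0 \<le> \<beta>" using that by (simp add: S_def)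
      have "(\<Sum>u\<in>V. wt J \<beta> {x, u}) \<le> 1 / 2" if V: "finite V" for x and V :: "(int ^ 'd) set"
      proof -
        have "(\<Sum>u\<in>V. wt J \<beta> {x, u}) \<le> (\<Sum>u\<in>V. \<beta> * J 0 (u - x))"
        proof (rule sum_mono)
          fix u
          show "wt J \<beta> {x, u} \<le> \<beta> * J 0 (u - x)"
          proof (cases "x = u")
            case True
            then show ?thesis using \<beta>0 J0 by (simp add: wt_def pairs_def)
          qed (use tr[of x u] sym in \<open>simp add: wt_pair\<close>)
        qed
        also have "\<dots> = \<beta> * (\<Sum>z\<in>(\<lambda>u. u - x) ` V. J 0 z)"
          by (subst sum.reindex) (auto simp: inj_on_def sum_distrib_left)
        also have "\<dots> \<le> \<beta> * s"
          unfolding s_def using V J0 summ by (intro mult_left_mono finite_sum_le_infsum \<beta>0) auto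
        also have "\<dots> \<le> 1 / 2" using lt \<beta>0 by (simp add: algebra_simps)
        finally show ?thesis .
      qed
      then have *: "(\<Sum>z\<in>L. tau (wt J \<beta>) x z) \<le> 1 / (1 - 1 / 2)" if "finite L" for x and L :: "(int ^ 'd) set"
        using that \<beta>0 J0 by (intro sum_tau_le_geometric wt_nonneg) auto
      have "?perc \<beta> = 0" by (rule finite_clusters[OF J0 \<beta>0 *])
      then show False using that by (simp add: S_def)
    qed
    have "1 / (2 * (s + 1)) \<le> ?b" unfolding b by (rule cInf_greatest[OF ne small])
    moreover have "0 < 1 / (2 * (s + 1))" using s0 by simp
    ultimately have b0: "0 < ?b" by (rule less_le_trans[rotated])
    have notin: "\<beta> \<notin> S" if "\<beta> < ?b" for \<beta>
    proof
      assume "\<beta> \<in> S"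
      then have "?b \<le> \<beta>" unfolding b by (rule cInf_lower) (auto intro: bdd_belowI[of _ 0] simp: S_def)
      with that show False by simp
    qed
    have below: "(\<Sum>z\<in>box (2 ^ k). tau (wt J \<beta>) 0 z) \<le> K / (c * \<beta>) * 2 powr (real k * \<alpha>)"
      if "0 < \<beta>" "\<beta> < ?b" for \<beta> k
      using bound[of \<beta> "(\<beta> + ?b) / 2" k] notin[of "(\<beta> + ?b) / 2"] that by simp
    \<comment> \<open>For each finite edge set the expectations are continuous in \<beta>, so the
      bound below \<open>beta_c\<close> survives the left limit; the supremum over edge sets is
      taken afterwards.\<close>
    have crit: "(\<Sum>z\<in>box (2 ^ k). tau (wt J ?b) 0 z) \<le> K / (c * ?b) * 2 powr (real k * \<alpha>)" for k
      unfolding tau_def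
    proof (rule EE_sum_le[where E\<^sub>0 = "{}"])
      fix E :: "(int ^ 'd) set set" assume E: "E \<in> fin_edges"
      let ?f = "\<lambda>\<beta>. \<Sum>z\<in>box (2 ^ k). pexp E (wt J \<beta>) (\<lambda>G. of_bool (conn G 0 z)) :: real"
      show "?f ?b \<le> K / (c * ?b) * 2 powr (real k * \<alpha>)"
      proof (rule tendsto_le[of "at_left ?b"])
        show "(?f \<longlongrightarrow> ?f ?b) (at_left ?b)" by (intro tendsto_sum pexp_wt_tendsto)
        show "((\<lambda>\<beta>. K / (c * \<beta>) * 2 powr (real k * \<alpha>)) \<longlongrightarrow> K / (c * ?b) * 2 powr (real k * \<alpha>)) (at_left ?b)"
          using b0 c by (intro tendsto_intros) auto
        have "?f \<beta> \<le> K / (c * \<beta>) * 2 powr (real k * \<alpha>)" if "0 < \<beta>" "\<beta> < ?b" for \<beta>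
        proof -
          have "?f \<beta> \<le> (\<Sum>z\<in>box (2 ^ k). tau (wt J \<beta>) 0 z)"
            using that J0 by (intro sum_mono pexp_conn_le_tau E wt_nonneg) auto
          also note below[OF that]
          finally show ?thesis .
        qed
        moreover have "\<forall>\<^sub>F \<beta> in at_left ?b. \<beta> \<in> {0<..<?b}" using b0 by (rule eventually_at_left_real)
        ultimately show "\<forall>\<^sub>F \<beta> in at_left ?b. ?f \<beta> \<le> K / (c * \<beta>) * 2 powr (real k * \<alpha>)"
          by (auto elim!: eventually_mono)
      qed simp
    qed (use b0 J0 in \<open>auto intro: mono_of_conn wt_nonneg\<close>)
    \<comment> \<open>Rounding \<open>r\<close> up to a power of two costs a factor of at most 2 in
      the radius, hence the \<open>2 powr \<alpha>\<close> in the final constant.\<close>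
    have "\<exists>k::nat. r \<le> 2 ^ k \<and> 2 ^ k \<le> 2 * r"
    proof -
      define k where "k = (LEAST k. r \<le> 2 ^ k)"
      obtain m :: nat where m: "r < 2 ^ m" using real_arch_pow[of 2 r] by auto
      have 1: "r \<le> 2 ^ k"
        unfolding k_def by (rule LeastI[where P = "\<lambda>k. r \<le> 2 ^ k" and k = m]) (use m in simp)
      have "2 ^ k \<le> 2 * r"
      proof (cases k)
        case (Suc i)
        then have "\<not> r \<le> 2 ^ i" using not_less_Least[of i "\<lambda>k. r \<le> 2 ^ k"] unfolding k_def by simp
        then show ?thesis by (simp add: Suc)
      qed (use r in simp)
      with 1 show ?thesis by blast
    qed
    then obtain k :: nat where k: "r \<le> 2 ^ k" "2 ^ k \<le> 2 * r" by blast
    have "(\<Sum>x\<in>box r. conn_prob J ?b 0 x) = (\<Sum>x\<in>box r. tau (wt J ?b) 0 x)"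
      using b0 J0 by (intro sum.cong refl conn_prob_eq_tau) auto
    also have "\<dots> \<le> (\<Sum>x\<in>box (2 ^ k). tau (wt J ?b) 0 x)"
      using b0 box_mono[OF k(1)] by (intro sum_mono2) (auto intro: tau0)
    also have "\<dots> \<le> K / (c * ?b) * 2 powr (real k * \<alpha>)" by (rule crit)
    also have "2 powr (real k * \<alpha>) = (2 ^ k) powr \<alpha>" by (simp add: powr_realpow[symmetric] powr_powr)
    also have "K / (c * ?b) * (2 ^ k) powr \<alpha> \<le> K / (c * ?b) * (2 * r) powr \<alpha>"
      using k assms K c b0 by (intro mult_left_mono powr_mono2) auto
    also have "(2 * r) powr \<alpha> = 2 powr \<alpha> * r powr \<alpha>" using r by (simp add: powr_mult)
    finally have sum: "(\<Sum>x\<in>box r. conn_prob J ?b 0 x) \<le> K * 2 powr \<alpha> / (c * ?b) * r powr \<alpha>" by simp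
    have rd: "r ^ ?d \<le> real (card (box r :: (int ^ 'd) set))" using r by (intro card_box_ge) auto
    have rd0: "0 < r ^ ?d" using r by simp
    have "(1 / real (card (box r :: (int ^ 'd) set))) * (\<Sum>x\<in>box r. conn_prob J ?b 0 x)
        \<le> (1 / r ^ ?d) * (K * 2 powr \<alpha> / (c * ?b) * r powr \<alpha>)"
    proof (rule mult_mono)
      show "1 / real (card (box r :: (int ^ 'd) set)) \<le> 1 / r ^ ?d"
        using rd rd0 by (intro divide_left_mono mult_pos_pos) auto
      show "0 \<le> (\<Sum>x\<in>box r. conn_prob J ?b 0 x)" by (intro sum_nonneg) (simp add: conn_prob_def)
    qed (use sum rd0 in auto)
    also have "\<dots> = K * 2 powr \<alpha> / (c * ?b) * r powr (- real ?d + \<alpha>)"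
    proof -
      have "r powr (- real ?d + \<alpha>) = r powr \<alpha> / r powr real ?d" by (simp add: powr_diff[symmetric])
      also have "\<dots> = r powr \<alpha> / r ^ ?d" using r by (simp add: powr_realpow)
      finally show ?thesis by simp
    qed
    finally show ?thesis .
  qed
  then show ?thesis by (intro exI[of _ "K * 2 powr \<alpha>"]) blast
qed

end
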